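(* Let $\mathrm{Z}$ be a densely defined linear operator in a Banach space $\mathbf{X}$ and let $t>0$. Then $\mathrm{Z}$ is closable and its closure is a generator of a $C_0$-semigroup if and only if there exists a function $\mathrm{F}\in\mathcal{F}_{\mathbf{X}}$ such that: (i) $\mathcal{D}(\mathrm{F}'(0))\supset\mathcal{D}(\mathrm{Z})$ and $\mathrm{F}'(0)f=\mathrm{Z}f$ for $f\in\mathcal{D}(\mathrm{Z})$. (ii) $\mathcal{D}({\mathrm{F}^*}'(0))$ is weak-$*$ dense in $\mathbf{X}^*$. (iii) There exists a dense linear subspace $\mathbf{A}\subseteq\mathcal{D}(\mathrm{Z})$ (dense in $\mathbf{X}$) such that for any $f\in\mathbf{A}$, $s\ge 0$ there exists a sequence $\{f_n^s\}_{n=1}^\infty$, $f_n^s\in\mathcal{D}(\mathrm{Z})$, satisfying: (a) $\lim_{n\to\infty}\|\mathrm{F}(t/n)^{[ns]}f-f_n^s\|=0$; (b) every subsequence of $\{f_n^s\}_{n\in\mathbb{N}}$ has a weakly convergent subsequence; (c) every subsequence of $\{\mathrm{Z}f_n^s\}_{n\in\mathbb{N}}$ has a weakly convergent subsequence. Furthermore, if conditions (i)–(iii) are satisfied, then $\exp(s\overline{\mathrm{Z}})f=\lim_{n\to\infty}\mathrm{F}(s/n)^n f$, $s>0$, for all $f\in\mathbf{X}$.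
   Context: $\mathcal{L}(\mathbf{E})$ is the space of bounded linear operators on a Banach space $\mathbf{E}$ (over $\mathbb{R}$ or $\mathbb{C}$). For $\mathrm{S}:[0,\infty)\to\mathcal{L}(\mathbf{E})$, the (strong) derivative at $0$ is the linear operator $\mathrm{S}'(0)\psi=\lim_{h\to 0}h^{-1}(\mathrm{S}(h)\psi-\mathrm{S}(0)\psi)$ (norm limit, $h>0$), whose domain $\mathcal{D}(\mathrm{S}'(0))$ is the set of all $\psi\in\mathbf{E}$ for which the limit exists. For $\mathrm{F}:[0,\infty)\to\mathcal{L}(\mathbf{X})$, $\mathrm{F}^*$ is the function $s\mapsto(\mathrm{F}(s))^*\in\mathcal{L}(\mathbf{X}^* )$, and ${\mathrm{F}^*}'(0)$ is its strong derivative at $0$ (norm of $\mathbf{X}^*$). $\mathcal{F}_{\mathbf{X}}$ is the set of all functions $\mathrm{F}:[0,\infty)\to\mathcal{L}(\mathbf{X})$ such that $\mathrm{F}(0)=\mathrm{I}$, there exist $M\ge 1$, $a\in\mathbb{R}$ with $\|\mathrm{F}(s/n)^m\|\le M\exp(\frac{am}{n}s)$ for all $n,m\in\mathbb{N}$, $s\ge 0$, and $\mathcal{D}(\mathrm{F}'(0))$ is dense in $\mathbf{X}$. $\overline{\mathrm{Z}}$ is the closure of $\mathrm{Z}$, $\exp(s\overline{\mathrm{Z}})$ is the $C_0$-semigroup generated by $\overline{\mathrm{Z}}$, and $[x]$ is the integer part of $x$. *)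

theory Defs
  imports "HOL-Analysis.Analysis"
begin

section \<open>Banach spaces over the real or complex field\<close>

text \<open>
  The class below has exactly the models \<open>\<real>\<close> and \<open>\<complex>\<close>, up to isometric isomorphism: its
  axiom leaves no other field, and a multiplicative norm on either field that extends the real
  absolute value is the usual one. A Banach space over such a field is a type of class
  \<^class>\<open>banach\<close> together with a scalar multiplication that extends the real one; for
  the scalar field \<^typ>\<open>real\<close> this scalar multiplication is \<^term>\<open>scaleR\<close>.
\<close>

class real_or_complex = real_normed_field +
  assumes real_or_complex:
    "(\<forall>z. \<exists>r. z = r *\<^sub>R 1) \<or>
     (\<exists>i. i * i = - 1 \<and> (\<forall>z. \<exists>r u. z = r *\<^sub>R 1 + u *\<^sub>R i))"

instance real :: real_or_complex
  by standard auto

instance complex :: real_or_complex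
proof
  have "\<i> * \<i> = - 1 \<and> (\<forall>z. \<exists>r u. z = r *\<^sub>R 1 + u *\<^sub>R \<i>)"
    by (auto simp: complex_eq_iff)
  then show "(\<forall>z::complex. \<exists>r. z = r *\<^sub>R 1) \<or>
      (\<exists>i::complex. i * i = - 1 \<and> (\<forall>z. \<exists>r u. z = r *\<^sub>R 1 + u *\<^sub>R i))"
    by blast
qed

locale normed_space_over = vector_space smul
  for smul :: "'k::real_or_complex \<Rightarrow> 'a::real_normed_vector \<Rightarrow> 'a" +
  assumes norm_smul: "norm (smul c x) = norm c * norm x"
    and smul_of_real: "smul (of_real r) x = r *\<^sub>R x"

text \<open>
  The type \<open>'a \<Rightarrow>\<^sub>L 'b\<close> consists of the bounded real-linear maps with the operator norm; the
  bounded operators and functionals over \<open>'k\<close> form closed subsets of it.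
\<close>

definition bounded_operators ::
    "('k::real_or_complex \<Rightarrow> 'a::real_normed_vector \<Rightarrow> 'a) \<Rightarrow> ('a \<Rightarrow>\<^sub>L 'a) set" where
  "bounded_operators smul =
    {A. \<forall>c x. blinfun_apply A (smul c x) = smul c (blinfun_apply A x)}"

definition dual_space ::
    "('k::real_or_complex \<Rightarrow> 'a::real_normed_vector \<Rightarrow> 'a) \<Rightarrow> ('a \<Rightarrow>\<^sub>L 'k) set" where
  "dual_space smul =
    {\<phi>. \<forall>c x. blinfun_apply \<phi> (smul c x) = c * blinfun_apply \<phi> x}"

definition adjoint_op ::
    "('a::real_normed_vector \<Rightarrow>\<^sub>L 'a) \<Rightarrow> ('a \<Rightarrow>\<^sub>L 'k::real_normed_vector) \<Rightarrow> ('a \<Rightarrow>\<^sub>L 'k)" where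
  "adjoint_op A \<phi> = \<phi> o\<^sub>L A"

primrec blinfun_pow ::
    "('a::real_normed_vector \<Rightarrow>\<^sub>L 'a) \<Rightarrow> nat \<Rightarrow> ('a \<Rightarrow>\<^sub>L 'a)" where
  "blinfun_pow A 0 = id_blinfun"
| "blinfun_pow A (Suc n) = A o\<^sub>L blinfun_pow A n"

definition weak_star_topology ::
    "('k::real_or_complex \<Rightarrow> 'a::real_normed_vector \<Rightarrow> 'a) \<Rightarrow> ('a \<Rightarrow>\<^sub>L 'k) topology" where
  "weak_star_topology smul =
    pullback_topology (dual_space smul) blinfun_apply (product_topology (\<lambda>_. euclidean) UNIV)"

definition weakly_converges_to ::
    "('k::real_or_complex \<Rightarrow> 'a::real_normed_vector \<Rightarrow> 'a) \<Rightarrow> (nat \<Rightarrow> 'a) \<Rightarrow> 'a \<Rightarrow> bool" where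
  "weakly_converges_to smul x l \<longleftrightarrow>
    (\<forall>\<phi> \<in> dual_space smul. (\<lambda>n. blinfun_apply \<phi> (x n)) \<longlonglongrightarrow> blinfun_apply \<phi> l)"

definition subseqs_have_weakly_convergent_subseq ::
    "('k::real_or_complex \<Rightarrow> 'a::real_normed_vector \<Rightarrow> 'a) \<Rightarrow> (nat \<Rightarrow> 'a) \<Rightarrow> bool" where
  "subseqs_have_weakly_convergent_subseq smul x \<longleftrightarrow>
    (\<forall>r::nat \<Rightarrow> nat. strict_mono r \<longrightarrow>
      (\<exists>(q::nat \<Rightarrow> nat) l. strict_mono q \<and> weakly_converges_to smul (x \<circ> r \<circ> q) l))"

section \<open>Unbounded operators and semigroups\<close>

text \<open>
  An operator with a domain is identified with its graph, so that \<^term>\<open>Domain Z\<close> is its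
  domain, \<^term>\<open>closure Z\<close> (in the product topology) is the graph of its closure whenever
  \<open>Z\<close> is closable, and equality of graphs is equality of operators including their domains.
\<close>

definition linear_operator ::
    "('k::real_or_complex \<Rightarrow> 'a::real_normed_vector \<Rightarrow> 'a) \<Rightarrow> ('a \<times> 'a) set \<Rightarrow> bool" where
  "linear_operator smul Z \<longleftrightarrow>
    single_valued Z \<and> module.subspace (\<lambda>c (x, y). (smul c x, smul c y)) Z"

definition op_apply :: "('a \<times> 'b) set \<Rightarrow> 'a \<Rightarrow> 'b" where
  "op_apply Z x = (THE y. (x, y) \<in> Z)"

definition closable :: "('a::real_normed_vector \<times> 'a) set \<Rightarrow> bool" where
  "closable Z \<longleftrightarrow> single_valued (closure Z)"

text \<open>
  The strong derivative at 0 of an operator-valued function on the subspace \<open>E\<close> of the ambient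
  type (all of \<open>X\<close>, or the dual of \<open>X\<close>). Only the values of \<open>S\<close> at arguments
  \<open>h \<ge> 0\<close> matter.
\<close>

definition strong_deriv0 ::
    "'e::real_normed_vector set \<Rightarrow> (real \<Rightarrow> 'e \<Rightarrow> 'e) \<Rightarrow> ('e \<times> 'e) set" where
  "strong_deriv0 E S = {(\<psi>, l). \<psi> \<in> E \<and> l \<in> E \<and>
     ((\<lambda>h. inverse h *\<^sub>R (S h \<psi> - S 0 \<psi>)) \<longlongrightarrow> l) (at_right 0)}"

abbreviation op_deriv0 ::
    "(real \<Rightarrow> 'a::real_normed_vector \<Rightarrow>\<^sub>L 'a) \<Rightarrow> ('a \<times> 'a) set" where
  "op_deriv0 F \<equiv> strong_deriv0 UNIV (\<lambda>s. blinfun_apply (F s))"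

abbreviation adjoint_deriv0 ::
    "('k::real_or_complex \<Rightarrow> 'a::real_normed_vector \<Rightarrow> 'a) \<Rightarrow> (real \<Rightarrow> 'a \<Rightarrow>\<^sub>L 'a) \<Rightarrow>
      (('a \<Rightarrow>\<^sub>L 'k) \<times> ('a \<Rightarrow>\<^sub>L 'k)) set" where
  "adjoint_deriv0 smul F \<equiv> strong_deriv0 (dual_space smul) (\<lambda>s. adjoint_op (F s))"

definition C0_semigroup ::
    "('k::real_or_complex \<Rightarrow> 'a::real_normed_vector \<Rightarrow> 'a) \<Rightarrow> (real \<Rightarrow> 'a \<Rightarrow>\<^sub>L 'a) \<Rightarrow> bool" where
  "C0_semigroup smul T \<longleftrightarrow>
    (\<forall>s\<ge>0. T s \<in> bounded_operators smul) \<and>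
    T 0 = id_blinfun \<and>
    (\<forall>s\<ge>0. \<forall>u\<ge>0. T (s + u) = T s o\<^sub>L T u) \<and>
    (\<forall>x. ((\<lambda>s. blinfun_apply (T s) x) \<longlongrightarrow> x) (at_right 0))"

definition generates ::
    "('k::real_or_complex \<Rightarrow> 'a::real_normed_vector \<Rightarrow> 'a) \<Rightarrow> ('a \<times> 'a) set \<Rightarrow>
      (real \<Rightarrow> 'a \<Rightarrow>\<^sub>L 'a) \<Rightarrow> bool" where
  "generates smul A T \<longleftrightarrow> C0_semigroup smul T \<and> op_deriv0 T = A"

section \<open>The approximating functions\<close>

definition F_class ::
    "('k::real_or_complex \<Rightarrow> 'a::real_normed_vector \<Rightarrow> 'a) \<Rightarrow> (real \<Rightarrow> 'a \<Rightarrow>\<^sub>L 'a) set" where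
  "F_class smul = {F.
    (\<forall>s\<ge>0. F s \<in> bounded_operators smul) \<and>
    F 0 = id_blinfun \<and>
    (\<exists>M a. M \<ge> 1 \<and> (\<forall>n\<ge>1. \<forall>m. \<forall>s\<ge>0.
       norm (blinfun_pow (F (s / real n)) m) \<le> M * exp (a * real m / real n * s))) \<and>
    closure (Domain (op_deriv0 F)) = UNIV}"

definition cond_i ::
    "('a::real_normed_vector \<times> 'a) set \<Rightarrow> (real \<Rightarrow> 'a \<Rightarrow>\<^sub>L 'a) \<Rightarrow> bool" where
  "cond_i Z F \<longleftrightarrow> Domain Z \<subseteq> Domain (op_deriv0 F) \<and>
    (\<forall>f \<in> Domain Z. op_apply (op_deriv0 F) f = op_apply Z f)"

definition cond_ii ::
    "('k::real_or_complex \<Rightarrow> 'a::real_normed_vector \<Rightarrow> 'a) \<Rightarrow> (real \<Rightarrow> 'a \<Rightarrow>\<^sub>L 'a) \<Rightarrow> bool" where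
  "cond_ii smul F \<longleftrightarrow>
    weak_star_topology smul closure_of Domain (adjoint_deriv0 smul F) = dual_space smul"

text \<open>
  The sequences of condition (iii) are indexed by \<open>n \<ge> 1\<close>; the entry at 0 is unconstrained and
  does not affect any of the three properties.
\<close>

definition cond_iii ::
    "('k::real_or_complex \<Rightarrow> 'a::real_normed_vector \<Rightarrow> 'a) \<Rightarrow> ('a \<times> 'a) set \<Rightarrow> real \<Rightarrow>
      (real \<Rightarrow> 'a \<Rightarrow>\<^sub>L 'a) \<Rightarrow> bool" where
  "cond_iii smul Z t F \<longleftrightarrow>
    (\<exists>A. module.subspace smul A \<and> A \<subseteq> Domain Z \<and> closure A = UNIV \<and>
      (\<forall>f\<in>A. \<forall>s\<ge>0. \<exists>g::nat \<Rightarrow> 'a.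
        (\<forall>n\<ge>1. g n \<in> Domain Z) \<and>
        (\<lambda>n. norm (blinfun_apply (blinfun_pow (F (t / real n)) (nat \<lfloor>real n * s\<rfloor>)) f - g n))
          \<longlonglongrightarrow> 0 \<and>
        subseqs_have_weakly_convergent_subseq smul g \<and>
        subseqs_have_weakly_convergent_subseq smul (\<lambda>n. op_apply Z (g n))))"

end

theory Submission
  imports Defs "HOL-Library.Diagonal_Subsequence"
begin

text \<open>
  Put \<open>A \<epsilon> = (F \<epsilon> - 1) / \<epsilon>\<close>. By Chernoff's theorem it is enough to show that, for small
  \<open>h > 0\<close>, the range of \<open>1 - h Z\<close> is dense. Let \<open>\<phi>\<close> be a functional that annihilates this
  range. For \<open>f \<in> \<A>\<close> and \<open>s \<ge> 0\<close> pass to a subsequence along which the \<open>f\<^sub>n\<^sup>s\<close> converge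
  weakly to \<open>u\<close>, the \<open>Z f\<^sub>n\<^sup>s\<close> to \<open>v\<close> and the \<open>F(t/n)\<^bsup>[ns]\<^esup> Z f\<close> to \<open>w\<close>; the last limit
  exists because \<open>Z f\<close> can be approximated by elements of \<open>\<A>\<close>. As \<open>A \<epsilon>\<close> commutes with
  \<open>F \<epsilon>\<close>, testing against the weak-* dense domain of the derivative of \<open>F*\<close> gives \<open>v = w\<close>.
  Since \<open>\<phi> u = h \<phi> v\<close>, the numbers \<open>\<phi> (F(t/n)\<^bsup>[ns]\<^esup> (f - h A(t/n) f))\<close> tend to 0 for every
  \<open>s\<close>, and summing them with geometric weights yields \<open>\<phi> f = 0\<close>. No compactness uniform in
  \<open>s\<close> is needed for this, only dominated convergence.

  The semigroup is then the limit of implicit Euler steps with the resolvents of the closure, and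
  \<open>F(s/n)\<^sup>n\<close> is compared with it after smoothing by the resolvents of \<open>A(s/n)\<close> and of the
  closure. In the converse direction \<open>F\<close> is the semigroup itself.
\<close>

text \<open>The obstacle is that the weak limits supplied by (iii) depend on the subsequence and on
  s, without measurability or uniformity in s, so there is no limit orbit whose Laplace transform
  could be taken. The way out is that the numbers to be controlled tend to 0 along every such
  subsequence. They therefore converge for each s without any choice, and the Laplace transform can
  be formed as a sum over the steps, before the limit. The exponent \<omega> \<ge> 1 and the bound
  \<delta> = 1 / (4 \<omega>) on h are fixed so that the geometric weights outweigh the growth of
  the powers of F with an exponential factor to spare. In the product formula the difficulty is that
  F is known to be differentiable at 0 only on the domain of Z, which the semigroup need not leave
  invariant. Placing the resolvent of A \<epsilon> in front of the telescoping sum turns A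
  \<epsilon> into a bounded operator, and strong convergence of resolvents replaces
  differentiability along the orbit. Closability is not a preliminary step: it is read off from the
  generator of the constructed semigroup.\<close>

section \<open>The Hahn-Banach theorem\<close>

definition sublinear :: "('a::real_vector \<Rightarrow> real) \<Rightarrow> bool" where
  "sublinear q \<longleftrightarrow> (\<forall>x y. q (x + y) \<le> q x + q y) \<and> (\<forall>c x. c \<ge> 0 \<longrightarrow> q (c *\<^sub>R x) = c * q x)"

lemma sublinear_add: "sublinear q \<Longrightarrow> q (x + y) \<le> q x + q y"
  by (simp add: sublinear_def)

lemma sublinear_scale: "sublinear q \<Longrightarrow> c \<ge> 0 \<Longrightarrow> q (c *\<^sub>R x) = c * q x"
  by (simp add: sublinear_def)

lemma sublinear_zero: "sublinear q \<Longrightarrow> q 0 = 0"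
  using sublinear_scale[of q 0 0] by simp

lemma sublinear_neg: "sublinear q \<Longrightarrow> - q (- x) \<le> q x"
  using sublinear_add[of q x "- x"] sublinear_zero[of q] by simp

text \<open>Applying the inequality to the scalars \<open>c\<close> and \<open>inverse c\<close>
  turns it into an equation.\<close>

lemma sublinearI:
  assumes add: "\<And>x y. q (x + y) \<le> q x + q y"
    and zero: "q 0 = 0"
    and scale: "\<And>c x. c > 0 \<Longrightarrow> q (c *\<^sub>R x) \<le> c * q x"
  shows "sublinear q"
proof -
  have "q (c *\<^sub>R x) = c * q x" if "c \<ge> 0" for c x
  proof (cases "c = 0")
    case False
    with that have c: "c > 0" by simp
    have "q x \<le> inverse c * q (c *\<^sub>R x)"
      using scale[of "inverse c" "c *\<^sub>R x"] c by simp
    then have "c * q x \<le> q (c *\<^sub>R x)"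
      using c by (simp add: field_simps)
    with scale[OF c, of x] show ?thesis by simp
  qed (simp add: zero)
  then show ?thesis by (simp add: sublinear_def add)
qed

text \<open>The value \<open>t = 0\<close> shows that \<open>q\<close> is only lowered, and
  \<open>t = 1\<close> at the point \<open>- y\<close> gives at most \<open>- q y\<close>. A
  sublinear functional that is left fixed for every \<open>y\<close> is therefore odd, hence
  linear.\<close>

definition sublinear_descent :: "('a::real_vector \<Rightarrow> real) \<Rightarrow> 'a \<Rightarrow> 'a \<Rightarrow> real" where
  "sublinear_descent q y x = (INF t\<in>{0..}. q (x + t *\<^sub>R y) - t * q y)"

lemma sublinear_descent_le:
  assumes "sublinear q" "t \<ge> 0"
  shows "sublinear_descent q y x \<le> q (x + t *\<^sub>R y) - t * q y"
proof -
  have "- q (- x) \<le> q (x + t *\<^sub>R y) - t * q y" if "t \<ge> 0" for t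
    using sublinear_add[OF assms(1), of "x + t *\<^sub>R y" "- x"] sublinear_scale[OF assms(1) that, of y]
    by simp
  then have "bdd_below ((\<lambda>t. q (x + t *\<^sub>R y) - t * q y) ` {0..})"
    by (intro bdd_belowI[of _ "- q (- x)"]) auto
  then show ?thesis
    unfolding sublinear_descent_def using assms(2) by (intro cINF_lower) auto
qed

lemma sublinear_descent_greatest:
  assumes "\<And>t. t \<ge> 0 \<Longrightarrow> b \<le> q (x + t *\<^sub>R y) - t * q y"
  shows "b \<le> sublinear_descent q y x"
  unfolding sublinear_descent_def using assms by (intro cINF_greatest) auto

lemma sublinear_sublinear_descent:
  assumes q: "sublinear q"
  shows "sublinear (sublinear_descent q y)"
proof (rule sublinearI)
  fix x1 x2
  have "sublinear_descent q y (x1 + x2) - (q (x1 + t1 *\<^sub>R y) - t1 * q y) \<le> q (x2 + t2 *\<^sub>R y) - t2 * q y"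
    if "t1 \<ge> 0" "t2 \<ge> 0" for t1 t2
    using sublinear_descent_le[OF q, of "t1 + t2" y "x1 + x2"] that
      sublinear_add[OF q, of "x1 + t1 *\<^sub>R y" "x2 + t2 *\<^sub>R y"]
    by (simp add: algebra_simps)
  then have "sublinear_descent q y (x1 + x2) - (q (x1 + t1 *\<^sub>R y) - t1 * q y) \<le> sublinear_descent q y x2"
    if "t1 \<ge> 0" for t1
    using that by (intro sublinear_descent_greatest) auto
  then have "sublinear_descent q y (x1 + x2) - sublinear_descent q y x2 \<le> sublinear_descent q y x1"
    by (intro sublinear_descent_greatest) (auto simp: algebra_simps)
  then show "sublinear_descent q y (x1 + x2) \<le> sublinear_descent q y x1 + sublinear_descent q y x2"
    by simp
next
  have "q (0 + t *\<^sub>R y) - t * q y = 0" if "t \<ge> 0" for t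
    using sublinear_scale[OF q that, of y] by simp
  then have "0 \<le> sublinear_descent q y 0"
    by (intro sublinear_descent_greatest) simp
  moreover have "sublinear_descent q y 0 \<le> 0"
    using sublinear_descent_le[OF q, of 0 y 0] sublinear_zero[OF q] by simp
  ultimately show "sublinear_descent q y 0 = 0" by simp
next
  fix c :: real and x assume c: "c > 0"
  have "inverse c * sublinear_descent q y (c *\<^sub>R x) \<le> q (x + t *\<^sub>R y) - t * q y" if "t \<ge> 0" for t
  proof -
    have "sublinear_descent q y (c *\<^sub>R x) \<le> q (c *\<^sub>R x + (c * t) *\<^sub>R y) - (c * t) * q y"
      using c that by (intro sublinear_descent_le[OF q]) simp
    also have "\<dots> = c * (q (x + t *\<^sub>R y) - t * q y)"
      using sublinear_scale[OF q, of c "x + t *\<^sub>R y"] c by (simp add: algebra_simps)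
    finally show ?thesis using c by (simp add: field_simps)
  qed
  then have "inverse c * sublinear_descent q y (c *\<^sub>R x) \<le> sublinear_descent q y x"
    by (rule sublinear_descent_greatest)
  then show "sublinear_descent q y (c *\<^sub>R x) \<le> c * sublinear_descent q y x"
    using c by (simp add: field_simps)
qed

text \<open>The bound \<open>- p (- x)\<close> common to all members keeps the infimum finite. The
  chain condition serves the subadditivity: a sum \<open>q x + r y\<close> with two different
  members is at least the value of the smaller one at \<open>x + y\<close>.\<close>

lemma sublinear_INF_chain:
  assumes ne: "C \<noteq> {}"
    and sub: "\<And>q. q \<in> C \<Longrightarrow> sublinear q \<and> q \<le> p"
    and chain: "\<And>q r. q \<in> C \<Longrightarrow> r \<in> C \<Longrightarrow> q \<le> r \<or> r \<le> q"
  shows "sublinear (\<lambda>x. INF q\<in>C. q x)" "\<And>q. q \<in> C \<Longrightarrow> (\<lambda>x. INF q\<in>C. q x) \<le> q"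
proof -
  have "- p (- x) \<le> q x" if "q \<in> C" for q x
    using sublinear_neg[of q x] sub[OF that] by (metis le_funE neg_le_iff_le order_trans)
  then have bdd: "bdd_below ((\<lambda>q. q x) ` C)" for x
    by (intro bdd_belowI[of _ "- p (- x)"]) auto
  have lower: "(INF q\<in>C. q x) \<le> q x" if "q \<in> C" for q x
    using bdd that by (rule cINF_lower)
  then show "(\<lambda>x. INF q\<in>C. q x) \<le> q" if "q \<in> C" for q
    using that by (intro le_funI) auto
  show "sublinear (\<lambda>x. INF q\<in>C. q x)"
  proof (rule sublinearI)
    fix x y
    have "(INF q\<in>C. q (x + y)) \<le> q x + r y" if "q \<in> C" "r \<in> C" for q r
    proof -
      obtain s where s: "s \<in> C" "s \<le> q" "s \<le> r"
        using chain[OF \<open>q \<in> C\<close> \<open>r \<in> C\<close>] \<open>q \<in> C\<close> \<open>r \<in> C\<close> by auto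
      have "(INF q\<in>C. q (x + y)) \<le> s (x + y)" by (rule lower[OF s(1)])
      also have "\<dots> \<le> s x + s y" using sub[OF s(1)] sublinear_add by blast
      also have "\<dots> \<le> q x + r y" using s by (intro add_mono) (auto simp: le_fun_def)
      finally show ?thesis .
    qed
    then have *: "(INF q\<in>C. q (x + y)) - q x \<le> r y" if "q \<in> C" "r \<in> C" for q r
      using that by (simp add: diff_le_eq add.commute)
    have "(INF q\<in>C. q (x + y)) - q x \<le> (INF r\<in>C. r y)" if "q \<in> C" for q
      using *[OF that] ne by (intro cINF_greatest)
    then have "(INF q\<in>C. q (x + y)) - (INF r\<in>C. r y) \<le> q x" if "q \<in> C" for q
      using that by (simp add: diff_le_eq add.commute)
    then have "(INF q\<in>C. q (x + y)) - (INF r\<in>C. r y) \<le> (INF q\<in>C. q x)"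
      using ne by (intro cINF_greatest)
    then show "(INF q\<in>C. q (x + y)) \<le> (INF q\<in>C. q x) + (INF q\<in>C. q y)" by simp
  next
    have "(\<lambda>q. q 0) ` C = {0}" using sub sublinear_zero ne by fastforce
    then show "(INF q\<in>C. q 0) = 0" by simp
  next
    fix c :: real and x assume c: "c > 0"
    have "inverse c * (INF q\<in>C. q (c *\<^sub>R x)) \<le> q x" if "q \<in> C" for q
      using lower[OF that, of "c *\<^sub>R x"] sublinear_scale[of q c x] sub[OF that] c
      by (simp add: field_simps)
    then have "inverse c * (INF q\<in>C. q (c *\<^sub>R x)) \<le> (INF q\<in>C. q x)"
      using ne by (intro cINF_greatest) auto
    then show "(INF q\<in>C. q (c *\<^sub>R x)) \<le> c * (INF q\<in>C. q x)"
      using c by (simp add: field_simps)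
  qed
qed

text \<open>A minimal sublinear functional is fixed by every descent, hence odd and linear.
  Searching below the descent of \<open>p\<close> along \<open>x0\<close>, instead of below
  \<open>p\<close>, forces equality at \<open>x0\<close>.\<close>

lemma Hahn_Banach_sublinear:
  fixes p :: "'a::real_vector \<Rightarrow> real"
  assumes p: "sublinear p"
  shows "\<exists>m. linear m \<and> m \<le> p \<and> m x0 = p x0"
proof -
  define p' where "p' = sublinear_descent p x0"
  define A where "A = {q. sublinear q \<and> q \<le> p'}"
  have p': "sublinear p'" "p' \<le> p" "p' (- x0) \<le> - p x0"
    using sublinear_sublinear_descent[OF p] sublinear_descent_le[OF p, of 0 x0]
      sublinear_descent_le[OF p, of 1 x0 "- x0"] sublinear_zero[OF p]
    by (auto simp: p'_def le_fun_def)
  \<comment> \<open>Zorn's lemma is used for the reversed order, so that a maximal element is a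
    minimal functional and the bound of a nonempty chain is its pointwise infimum.\<close>
  have "\<exists>m\<in>A. \<forall>q\<in>A. m \<ge> q \<longrightarrow> q = m"
  proof (rule predicate_Zorn)
    show "partial_order_on A (relation_of (\<ge>) A)"
      by (rule partial_order_on_relation_ofI) auto
    fix C assume "C \<in> Chains (relation_of (\<ge>) A)"
    then have C: "C \<subseteq> A" and chain: "\<And>q r. q \<in> C \<Longrightarrow> r \<in> C \<Longrightarrow> q \<le> r \<or> r \<le> q"
      by (auto simp: Chains_def relation_of_def)
    show "\<exists>u\<in>A. \<forall>a\<in>C. a \<ge> u"
    proof (cases "C = {}")
      case True
      with p' show ?thesis by (auto simp: A_def)
    next
      case False
      then obtain q0 where q0: "q0 \<in> C" by blast
      have sub: "\<And>q. q \<in> C \<Longrightarrow> sublinear q \<and> q \<le> p'" using C by (auto simp: A_def)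
      let ?u = "\<lambda>x. INF q\<in>C. q x"
      have u: "sublinear ?u" "\<And>q. q \<in> C \<Longrightarrow> ?u \<le> q"
        using sublinear_INF_chain[OF False sub chain] by auto
      have "?u \<in> A" using u q0 sub by (auto simp: A_def intro: order_trans)
      with u show ?thesis by blast
    qed
  qed
  then obtain m where m: "sublinear m" "m \<le> p'"
    and min: "\<And>q. sublinear q \<Longrightarrow> q \<le> p' \<Longrightarrow> q \<le> m \<Longrightarrow> q = m"
    unfolding A_def by blast
  have neg: "m (- y) = - m y" for y
  proof -
    have le: "sublinear_descent m y \<le> m"
      using sublinear_descent_le[OF m(1), of 0 y] by (auto simp: le_fun_def)
    then have "sublinear_descent m y = m"
      using m by (intro min sublinear_sublinear_descent) auto
    then have "m (- y) \<le> - m y"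
      using sublinear_descent_le[OF m(1), of 1 y "- y"] sublinear_zero[OF m(1)] by simp
    with sublinear_neg[OF m(1), of y] show ?thesis by simp
  qed
  have "linear m"
  proof (rule linearI)
    fix x y
    have "m x \<le> m (x + y) - m y"
      using sublinear_add[OF m(1), of "x + y" "- y"] neg[of y] by simp
    with sublinear_add[OF m(1), of x y] show "m (x + y) = m x + m y" by simp
  next
    fix c x show "m (c *\<^sub>R x) = c *\<^sub>R m x"
      using sublinear_scale[OF m(1), of c x] sublinear_scale[OF m(1), of "- c" x] neg[of "(- c) *\<^sub>R x"]
      by (cases "c \<ge> 0") auto
  qed
  moreover have "m \<le> p" using m p' by auto
  moreover have "m x0 = p x0"
  proof -
    have "- m x0 \<le> p' (- x0)" using m(2) neg[of x0] by (auto simp: le_fun_def dest: spec[of _ "- x0"])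
    with p'(3) have "p x0 \<le> m x0" by simp
    with \<open>m \<le> p\<close> show ?thesis by (auto simp: le_fun_def intro: antisym)
  qed
  ultimately show ?thesis by blast
qed

text \<open>The norm of \<open>of_real r - of_real u * i\<close> is accessible only through
  multiplicativity and the triangle inequality. The product with the conjugate is
  \<open>r * r + u * u\<close>, and the conjugate has norm at most
  \<open>\<bar>r\<bar> + \<bar>u\<bar>\<close>; comparing these two crudely costs the factor
  2.\<close>

lemma norm_add_scaled_unit_ge:
  fixes i :: "'k::real_normed_field"
  assumes i: "i * i = - 1"
  shows "\<bar>r\<bar> \<le> 2 * norm (of_real r - of_real u * i)"
proof (cases "r = 0 \<and> u = 0")
  case False
  have "norm i * norm i = 1" using i by (metis norm_minus_cancel norm_mult norm_one)
  then have ni: "norm i = 1" by (metis norm_ge_zero real_sqrt_abs2 abs_of_nonneg real_sqrt_one)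
  let ?z = "of_real r - of_real u * i" and ?w = "of_real r + of_real u * i"
  have "?z * ?w = of_real r * of_real r - (of_real u * of_real u) * (i * i)"
    by (simp add: algebra_simps)
  also have "\<dots> = of_real (r * r + u * u)" by (simp add: i)
  finally have "norm ?z * norm ?w = norm (of_real (r * r + u * u) :: 'k)" by (metis norm_mult)
  also have "\<dots> = r * r + u * u" by (simp only: norm_of_real) simp
  finally have eq: "norm ?z * norm ?w = r * r + u * u" .
  have w: "norm ?w \<le> \<bar>r\<bar> + \<bar>u\<bar>"
    using norm_triangle_ineq[of "of_real r" "of_real u * i"] by (simp add: norm_mult ni)
  have "\<bar>r\<bar> * (\<bar>r\<bar> + \<bar>u\<bar>) \<le> 2 * (r * r + u * u)"
  proof -
    have "2 * (\<bar>r\<bar> * \<bar>u\<bar>) \<le> \<bar>r\<bar>\<^sup>2 + \<bar>u\<bar>\<^sup>2"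
      using sum_squares_bound[of "\<bar>r\<bar>" "\<bar>u\<bar>"] by simp
    moreover have "\<bar>r\<bar> * \<bar>r\<bar> = r * r" "\<bar>u\<bar>\<^sup>2 = u * u" "\<bar>r\<bar>\<^sup>2 = r * r" "0 \<le> u * u" "0 \<le> r * r"
      by (auto simp: power2_eq_square)
    ultimately show ?thesis unfolding distrib_left by linarith
  qed
  also have "\<dots> = 2 * (norm ?z * norm ?w)" by (simp add: eq)
  also have "\<dots> \<le> 2 * norm ?z * (\<bar>r\<bar> + \<bar>u\<bar>)" using w by (simp add: mult_left_mono)
  finally show ?thesis
    using False by (auto dest: mult_right_le_imp_le)
qed auto

context normed_space_over begin

lemma in_dual_spaceD: "\<phi> \<in> dual_space smul \<Longrightarrow> blinfun_apply \<phi> (smul c x) = c * blinfun_apply \<phi> x"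
  by (simp add: dual_space_def)

text \<open>In the complex case a dominated real functional \<open>m\<close> is complexified as
  \<open>m x - m (i x) i\<close>. Its two terms are estimated separately, whence the factor 2; the
  applications use the bounds only up to a constant.\<close>

lemma Hahn_Banach_seminorm:
  fixes p :: "'a \<Rightarrow> real"
  assumes add: "\<And>x y. p (x + y) \<le> p x + p y"
    and scale: "\<And>c x. p (smul c x) = norm c * p x"
    and le: "\<And>x. p x \<le> norm x"
  obtains \<phi> where "\<phi> \<in> dual_space smul" "\<And>x. norm (blinfun_apply \<phi> x) \<le> 2 * p x"
    "p x0 \<le> 2 * norm (blinfun_apply \<phi> x0)"
proof -
  have pr: "p (r *\<^sub>R x) = \<bar>r\<bar> * p x" for r x
    using scale[of "of_real r" x] by (simp add: smul_of_real)
  have "sublinear p" by (auto simp: sublinear_def add pr)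
  from Hahn_Banach_sublinear[OF this, of x0] obtain m where
    lin: "linear m" and m: "\<And>x. m x \<le> p x" "m x0 = p x0" by (auto simp: le_fun_def)
  interpret m: linear m by fact
  have p0: "p x \<ge> 0" for x
    using add[of x "-1 *\<^sub>R x"] pr[of "-1" x] pr[of 0 x] by simp
  have mabs: "\<bar>m x\<bar> \<le> p x" for x
    using m(1)[of x] m(1)[of "-1 *\<^sub>R x"] pr[of "-1" x] m.neg[of x] by simp
  from real_or_complex show thesis
  proof
    assume real: "\<forall>z::'k. \<exists>r. z = r *\<^sub>R 1"
    let ?f = "\<lambda>x. of_real (m x) :: 'k"
    have bl: "bounded_linear ?f"
      by (rule bounded_linear_intro[where K = 1])
        (auto simp: m.add m.scale scaleR_conv_of_real intro: order_trans[OF mabs le])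
    have ap: "blinfun_apply (Blinfun ?f) = ?f" by (rule bounded_linear_Blinfun_apply[OF bl])
    show thesis
    proof (rule that[of "Blinfun ?f"])
      have "?f (smul c x) = c * ?f x" for c x
      proof -
        obtain r where "c = of_real r" using real by (auto simp: scaleR_conv_of_real)
        then show ?thesis by (simp add: smul_of_real m.scale)
      qed
      then show "Blinfun ?f \<in> dual_space smul" by (simp add: dual_space_def ap)
      show "norm (blinfun_apply (Blinfun ?f) x) \<le> 2 * p x" for x
        using mabs[of x] p0[of x] by (simp add: ap)
      show "p x0 \<le> 2 * norm (blinfun_apply (Blinfun ?f) x0)"
        using m(2) p0[of x0] by (simp add: ap)
    qed
  next
    assume "\<exists>i::'k. i * i = - 1 \<and> (\<forall>z. \<exists>r u. z = r *\<^sub>R 1 + u *\<^sub>R i)"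
    then obtain i :: 'k where i: "i * i = - 1" and rep: "\<And>z. \<exists>r u. z = r *\<^sub>R 1 + u *\<^sub>R i"
      by blast
    have "norm i * norm i = 1" using i by (metis norm_minus_cancel norm_mult norm_one)
    then have ni: "norm i = 1" by (metis norm_ge_zero real_sqrt_abs2 abs_of_nonneg real_sqrt_one)
    let ?f = "\<lambda>x. of_real (m x) - of_real (m (smul i x)) * i"
    have ii: "smul i (smul i x) = - x" for x
      using i smul_of_real[of "-1" x] by simp
    have fn: "norm (?f x) \<le> 2 * p x" for x
    proof -
      have "norm (?f x) \<le> \<bar>m x\<bar> + \<bar>m (smul i x)\<bar>"
        using norm_triangle_ineq4[of "of_real (m x)" "of_real (m (smul i x)) * i"]
        by (simp add: norm_mult ni)
      with mabs[of x] mabs[of "smul i x"] scale[of i x] ni show ?thesis by simp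
    qed
    have sr: "smul i (r *\<^sub>R x) = r *\<^sub>R smul i x" for r x
      by (metis scale_left_commute smul_of_real)
    have bl: "bounded_linear ?f"
    proof (rule bounded_linear_intro[where K = 2])
      show "norm (?f x) \<le> norm x * 2" for x using fn[of x] le[of x] by simp
    qed (auto simp: m.add m.scale scale_right_distrib sr scaleR_conv_of_real algebra_simps)
    have ap: "blinfun_apply (Blinfun ?f) = ?f" by (rule bounded_linear_Blinfun_apply[OF bl])
    show thesis
    proof (rule that[of "Blinfun ?f"])
      have "?f (smul c x) = c * ?f x" for c x
      proof -
        obtain r u where c: "c = of_real r + of_real u * i"
          using rep[of c] by (auto simp: scaleR_conv_of_real)
        have "smul c x = r *\<^sub>R x + u *\<^sub>R smul i x"
          unfolding c scale_left_distrib smul_of_real scale_scale[symmetric] ..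
        moreover have "smul i (r *\<^sub>R x + u *\<^sub>R smul i x) = r *\<^sub>R smul i x - u *\<^sub>R x"
          by (simp add: scale_right_distrib sr ii del: scale_scale)
        ultimately have "?f (smul c x) = of_real (r * m x + u * m (smul i x))
            - of_real (r * m (smul i x) - u * m x) * i"
          by (simp add: m.add m.diff m.scale)
        \<comment> \<open>Complex homogeneity holds up to a multiple of \<open>1 + i * i\<close>,
          which vanishes.\<close>
        also have "\<dots> = (of_real r + of_real u * i) * ?f x
           + (of_real u * of_real (m (smul i x))) * (1 + i * i)"
          by (simp add: algebra_simps)
        finally show ?thesis by (simp add: i c)
      qed
      then show "Blinfun ?f \<in> dual_space smul" by (simp add: dual_space_def ap)
      show "norm (blinfun_apply (Blinfun ?f) x) \<le> 2 * p x" for x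
        using fn[of x] by (simp add: ap)
      show "p x0 \<le> 2 * norm (blinfun_apply (Blinfun ?f) x0)"
        using norm_add_scaled_unit_ge[OF i, of "m x0" "m (smul i x0)"] m(2) p0[of x0] by (simp add: ap)
    qed
  qed
qed

lemma dual_space_norming:
  obtains \<phi> where "\<phi> \<in> dual_space smul" "\<And>x. norm (blinfun_apply \<phi> x) \<le> 2 * norm x"
    "norm x0 \<le> 2 * norm (blinfun_apply \<phi> x0)"
  using Hahn_Banach_seminorm[of norm x0] norm_triangle_ineq norm_smul by auto

lemma dual_space_separates:
  assumes "\<And>\<phi>. \<phi> \<in> dual_space smul \<Longrightarrow> blinfun_apply \<phi> x = 0"
  shows "x = 0"
proof -
  obtain \<phi> where "\<phi> \<in> dual_space smul" "norm x \<le> 2 * norm (blinfun_apply \<phi> x)"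
    using dual_space_norming[of x] by blast
  with assms[of \<phi>] show ?thesis by simp
qed

text \<open>The distance to \<open>Y\<close> is a seminorm that vanishes on \<open>Y\<close> and is
  at most the norm. A functional dominated by it and comparable to it at \<open>x\<close>
  annihilates \<open>Y\<close>, so by hypothesis it vanishes at \<open>x\<close>, and the distance
  of \<open>x\<close> is zero.\<close>

lemma dense_subspaceI:
  assumes Y: "module.subspace smul Y"
    and ann: "\<And>\<phi> x. \<phi> \<in> dual_space smul \<Longrightarrow> (\<And>y. y \<in> Y \<Longrightarrow> blinfun_apply \<phi> y = 0) \<Longrightarrow> blinfun_apply \<phi> x = 0"
  shows "closure Y = UNIV"
proof -
  have Y0: "0 \<in> Y" and Yadd: "\<And>x y. x \<in> Y \<Longrightarrow> y \<in> Y \<Longrightarrow> x + y \<in> Y" and Ysc: "\<And>c x. x \<in> Y \<Longrightarrow> smul c x \<in> Y"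
    using Y by (auto simp: subspace_def)
  have ne: "Y \<noteq> {}" using Y0 by auto
  have inf_less: "\<exists>y\<in>Y. dist x y < e" if "infdist x Y < e" for x e
    using that cINF_less_iff[OF ne bdd_belowI2[of Y 0 "dist x"], of e] by (simp add: infdist_notempty[OF ne])
  have add: "infdist (x + y) Y \<le> infdist x Y + infdist y Y" for x y
  proof (rule field_le_epsilon)
    fix e :: real assume "e > 0"
    then obtain a b where "a \<in> Y" "dist x a < infdist x Y + e / 2" "b \<in> Y" "dist y b < infdist y Y + e / 2"
      using inf_less[of x "infdist x Y + e / 2"] inf_less[of y "infdist y Y + e / 2"] by auto
    moreover have "infdist (x + y) Y \<le> dist (x + y) (a + b)"
      using calculation Yadd by (intro infdist_le)
    moreover have "dist (x + y) (a + b) \<le> dist x a + dist y b" by (rule dist_triangle_add)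
    ultimately show "infdist (x + y) Y \<le> infdist x Y + infdist y Y + e" by linarith
  qed
  have sle: "infdist (smul c x) Y \<le> norm c * infdist x Y" if "c \<noteq> 0" for c x
  proof -
    have "infdist (smul c x) Y / norm c \<le> dist x y" if "y \<in> Y" for y
    proof -
      have "infdist (smul c x) Y \<le> dist (smul c x) (smul c y)" using that Ysc by (intro infdist_le)
      also have "\<dots> = norm c * dist x y" by (simp add: dist_norm norm_smul scale_right_diff_distrib[symmetric])
      finally show ?thesis using \<open>c \<noteq> 0\<close> by (simp add: field_simps)
    qed
    then have "infdist (smul c x) Y / norm c \<le> infdist x Y"
      unfolding infdist_notempty[OF ne, of x] using ne by (intro cINF_greatest)
    then show ?thesis using \<open>c \<noteq> 0\<close> by (simp add: field_simps)
  qed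
  have scale: "infdist (smul c x) Y = norm c * infdist x Y" for c x
  proof (cases "c = 0")
    case True then show ?thesis using Y0 by simp
  next
    case False
    then have "infdist x Y \<le> inverse (norm c) * infdist (smul c x) Y"
      using sle[of "inverse c" "smul c x"] by (simp add: norm_inverse)
    then have "norm c * infdist x Y \<le> norm c * (inverse (norm c) * infdist (smul c x) Y)"
      by (rule mult_left_mono) simp
    also have "\<dots> = infdist (smul c x) Y"
      using False by (simp only: mult.assoc[symmetric]) simp
    finally have "norm c * infdist x Y \<le> infdist (smul c x) Y" .
    with sle[OF False, of x] show ?thesis by simp
  qed
  have "infdist x Y = 0" for x
  proof -
    have le: "infdist z Y \<le> norm z" for z
      using infdist_le[OF Y0, of z] by simp
    obtain \<phi> where \<phi>: "\<phi> \<in> dual_space smul" "\<And>x. norm (blinfun_apply \<phi> x) \<le> 2 * infdist x Y"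
      "infdist x Y \<le> 2 * norm (blinfun_apply \<phi> x)"
      using Hahn_Banach_seminorm[of "\<lambda>x. infdist x Y" x, OF add scale le] by blast
    have "blinfun_apply \<phi> y = 0" if "y \<in> Y" for y
      using \<phi>(2)[of y] that by simp
    then have "blinfun_apply \<phi> x = 0" by (rule ann[OF \<phi>(1)])
    with \<phi>(3) show ?thesis using infdist_nonneg[of x Y] by simp
  qed
  then show ?thesis using in_closure_iff_infdist_zero[OF ne] by blast
qed

end

section \<open>Sequences of operators\<close>

text \<open>Sokal's gliding hump: unlike the proof by Baire's theorem, it needs only one sequence of
  operators whose norms grow fast.\<close>

lemma norm_blinfun_ball:
  fixes T :: "'a::real_normed_vector \<Rightarrow>\<^sub>L 'b::real_normed_vector"
  assumes r: "r > 0" and b: "b < norm T"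
  shows "\<exists>y. norm (y - x) \<le> r \<and> norm (T y) \<ge> b * r"
proof (cases "b < 0")
  case True
  then have "b * r \<le> norm (T x)" using r by (smt (verit) mult_neg_pos norm_ge_zero)
  then show ?thesis using r by (intro exI[of _ x]) simp
next
  case False
  then obtain v where v: "norm (T v) > b * norm v"
    using norm_blinfun_bound[of b T] b by (meson not_le)
  then have v0: "norm v > 0" by (metis blinfun.zero_right less_irrefl mult_zero_right norm_zero zero_less_norm_iff)
  define w where "w = (r / norm v) *\<^sub>R v"
  have w: "norm w = r" using v0 r by (simp add: w_def)
  have Tw: "norm (T w) \<ge> b * r"
    using v v0 r by (simp add: w_def blinfun.scaleR_right field_simps)
  have "2 *\<^sub>R T w = T (x + w) - T (x - w)"
    by (simp add: blinfun.add_right blinfun.diff_right scaleR_2)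
  then have "norm (2 *\<^sub>R T w) \<le> norm (T (x + w)) + norm (T (x - w))"
    by (simp only: norm_triangle_ineq4)
  then have "2 * norm (T w) \<le> norm (T (x + w)) + norm (T (x - w))"
    by simp
  \<comment> \<open>The centre \<open>x\<close> drops out of the difference
    \<open>T (x + w) - T (x - w)\<close>, so one of these two points, both at distance
    \<open>r\<close> from \<open>x\<close>, has a large image.\<close>
  then have "norm (T (x + w)) \<ge> b * r \<or> norm (T (x - w)) \<ge> b * r" using Tw by linarith
  then show ?thesis
  proof
    assume "norm (T (x + w)) \<ge> b * r"
    then show ?thesis using w by (intro exI[of _ "x + w"]) simp
  next
    assume "norm (T (x - w)) \<ge> b * r"
    then show ?thesis using w by (intro exI[of _ "x - w"]) simp
  qed
qed

lemma blinfun_gliding_hump: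
  fixes T :: "nat \<Rightarrow> 'a::banach \<Rightarrow>\<^sub>L 'b::real_normed_vector"
  assumes T: "\<And>n. 4 ^ n < norm (T n)"
  shows "\<exists>x. \<forall>B. \<exists>n. norm (T n x) > B"
proof -
  \<comment> \<open>After the step \<open>n\<close> all later steps together move the point by at
    most \<open>1/2 * (1/3) ^ n\<close>. Of the factor 3/4 gained here this loses at most 1/2 and
    leaves 1/4, and norms above \<open>4 ^ n\<close> outgrow \<open>3 ^ n\<close>.\<close>
  have "\<exists>y. norm (y - x) \<le> (1/3) ^ n \<and> norm (T n y) \<ge> (3/4 * norm (T n)) * (1/3) ^ n" for n x
  proof (rule norm_blinfun_ball)
    have "(0::real) < 4 ^ n" by simp
    with T[of n] show "3/4 * norm (T n) < norm (T n)" by linarith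
  qed simp
  then have "\<forall>n. \<forall>x. \<exists>y. norm (y - x) \<le> (1/3) ^ n \<and> norm (T n y) \<ge> (3/4 * norm (T n)) * (1/3) ^ n"
    by blast
  then obtain f where "\<forall>n. \<forall>x. norm (f n x - x) \<le> (1/3) ^ n \<and> norm (T n (f n x)) \<ge> (3/4 * norm (T n)) * (1/3) ^ n"
    unfolding choice_iff by blast
  then have f: "\<And>n x. norm (f n x - x) \<le> (1/3) ^ n"
    "\<And>n x. norm (T n (f n x)) \<ge> (3/4 * norm (T n)) * (1/3) ^ n"
    by auto
  define x where "x = rec_nat 0 (\<lambda>n. f n)"
  have xS: "x (Suc n) = f n (x n)" for n by (simp add: x_def)
  have step: "norm (x (Suc n) - x n) \<le> (1/3) ^ n" for n using f(1) by (simp add: xS)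
  have tel: "norm (x (n + k) - x n) \<le> 3/2 * (1/3) ^ n * (1 - (1/3) ^ k)" for n k
  proof (induction k)
    case (Suc k)
    have "norm (x (n + Suc k) - x n) \<le> norm (x (n + Suc k) - x (n + k)) + norm (x (n + k) - x n)"
      using norm_triangle_ineq[of "x (n + Suc k) - x (n + k)" "x (n + k) - x n"] by simp
    also have "\<dots> \<le> (1/3) ^ (n + k) + 3/2 * (1/3) ^ n * (1 - (1/3) ^ k)"
      using step[of "n + k"] Suc.IH by (intro add_mono) simp_all
    also have "\<dots> = 3/2 * (1/3) ^ n * (1 - (1/3) ^ Suc k)"
      by (simp add: power_add field_simps)
    finally show ?case .
  qed simp
  have tel': "norm (x m - x n) \<le> 3/2 * (1/3) ^ n" if "m \<ge> n" for m n
  proof -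
    have "norm (x m - x n) \<le> 3/2 * (1/3) ^ n * (1 - (1/3) ^ (m - n))"
      using tel[of n "m - n"] that by simp
    also have "\<dots> \<le> 3/2 * (1/3) ^ n * 1" by (intro mult_left_mono) simp_all
    finally show ?thesis by simp
  qed
  have "Cauchy x"
  proof (rule metric_CauchyI)
    fix e :: real assume "e > 0"
    then obtain N where N: "(1/3::real) ^ N < e / 3" using real_arch_pow_inv[of "e / 3" "1/3"] by auto
    have "dist (x m) (x n) < e" if "m \<ge> N" "n \<ge> N" for m n
      using tel'[OF that(1)] tel'[OF that(2)] N norm_triangle_ineq4[of "x m - x N" "x n - x N"]
      by (simp add: dist_norm)
    then show "\<exists>M. \<forall>m\<ge>M. \<forall>n\<ge>M. dist (x m) (x n) < e" by blast
  qed
  then obtain l where l: "x \<longlonglongrightarrow> l" by (auto simp: Cauchy_convergent_iff convergent_def)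
  have dist: "norm (l - x (Suc n)) \<le> 1/2 * (1/3) ^ n" for n
  proof (rule LIMSEQ_le_const2)
    show "(\<lambda>m. norm (x m - x (Suc n))) \<longlonglongrightarrow> norm (l - x (Suc n))"
      by (intro tendsto_intros l)
    show "\<exists>N. \<forall>m\<ge>N. norm (x m - x (Suc n)) \<le> 1/2 * (1/3) ^ n"
      using tel'[of "Suc n"] by (intro exI[of _ "Suc n"]) simp
  qed
  have big: "norm (T n l) \<ge> 1/4 * (4/3) ^ n" for n
  proof -
    have "norm (T n (x (Suc n))) \<le> norm (T n l) + norm (T n (l - x (Suc n)))"
      by (metis blinfun.diff_right norm_minus_commute norm_triangle_sub)
    moreover have "norm (T n (l - x (Suc n))) \<le> norm (T n) * (1/2 * (1/3) ^ n)"
      using norm_blinfun[of "T n" "l - x (Suc n)"] dist[of n] by (meson mult_left_mono norm_ge_zero order_trans)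
    moreover have "norm (T n (x (Suc n))) \<ge> (3/4 * norm (T n)) * (1/3) ^ n" using f(2) by (simp add: xS)
    ultimately have "norm (T n l) \<ge> norm (T n) * (1/4 * (1/3) ^ n)" by linarith
    moreover have "norm (T n) * (1/4 * (1/3) ^ n) \<ge> 4 ^ n * (1/4 * (1/3) ^ n)"
      using T[of n] by (intro mult_right_mono) auto
    ultimately show ?thesis by (simp add: power_divide)
  qed
  have "\<exists>n. norm (T n l) > B" for B
  proof -
    obtain n where "4 * B < (4/3::real) ^ n" using real_arch_pow[of "4/3" "4 * B"] by auto
    then show ?thesis using big[of n] by (intro exI[of _ n]) simp
  qed
  then show ?thesis by blast
qed

section \<open>Strong convergence of bounded sequences of operators\<close>

lemma norm_blinfun_le: "norm (blinfun_apply A x) \<le> C * norm x" if "norm A \<le> C"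
  using norm_blinfun[of A x] mult_right_mono[OF that, of "norm x"] by simp

text \<open>The bound is only an eventual one because the resolvents of the difference quotients are
  controlled only for small step lengths.\<close>

lemma strong_limit_dense:
  fixes T :: "nat \<Rightarrow> 'a::real_normed_vector \<Rightarrow>\<^sub>L 'b::real_normed_vector"
  assumes bd: "eventually (\<lambda>n. norm (T n) \<le> C) sequentially"
    and S: "closure S = UNIV" and lim: "\<And>y. y \<in> S \<Longrightarrow> (\<lambda>n. T n y) \<longlonglongrightarrow> blinfun_apply L y"
  shows "(\<lambda>n. T n x) \<longlonglongrightarrow> blinfun_apply L x"
proof (rule LIMSEQ_I)
  fix e :: real assume e: "e > 0"
  define K where "K = \<bar>C\<bar> + norm L + 1"
  have K: "K > 0" "C + norm L \<le> K" by (auto simp: K_def add_nonneg_pos)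
  have "x \<in> closure S" using S by simp
  then obtain y where y: "y \<in> S" "dist y x < e / (2 * K)"
    using e K by (metis closure_approachable divide_pos_pos mult_pos_pos zero_less_numeral)
  have "eventually (\<lambda>n. norm (T n y - L y) < e / 2) sequentially"
    using tendstoD[OF lim[OF y(1)], of "e / 2"] e by (simp add: dist_norm)
  with bd have "eventually (\<lambda>n. norm (T n x - L x) < e) sequentially"
  proof eventually_elim
    fix n assume n: "norm (T n) \<le> C" "norm (T n y - L y) < e / 2"
    have "T n x - L x = T n (x - y) + (T n y - L y) + L (y - x)"
      by (simp add: blinfun.diff_right)
    then have "norm (T n x - L x) \<le> norm (T n (x - y)) + norm (T n y - L y) + norm (L (y - x))"
      by (simp add: norm_triangle_mono norm_triangle_ineq)
    also have "\<dots> \<le> C * norm (x - y) + norm (T n y - L y) + norm L * norm (x - y)"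
      using norm_blinfun[of "T n" "x - y"] norm_blinfun[of L "y - x"] mult_right_mono[OF n(1), of "norm (x - y)"]
      by (simp add: norm_minus_commute)
    also have "\<dots> = (C + norm L) * norm (x - y) + norm (T n y - L y)"
      by (simp add: distrib_right)
    also have "(C + norm L) * norm (x - y) \<le> K * norm (x - y)"
      using K(2) by (rule mult_right_mono) simp
    also have "K * norm (x - y) \<le> e / 2"
      using y(2) K by (simp add: dist_norm norm_minus_commute field_simps)
    finally show "norm (T n x - L x) < e" using n(2) by linarith
  qed
  then show "\<exists>n0. \<forall>n\<ge>n0. norm (T n x - L x) < e" by (simp add: eventually_sequentially)
qed

lemma strong_limit_exists:
  fixes T :: "nat \<Rightarrow> 'a::real_normed_vector \<Rightarrow>\<^sub>L 'b::banach"
  assumes bd: "eventually (\<lambda>n. norm (T n) \<le> C) sequentially"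
    and S: "closure S = UNIV" and conv: "\<And>y. y \<in> S \<Longrightarrow> convergent (\<lambda>n. T n y)"
  obtains L where "\<And>x. (\<lambda>n. T n x) \<longlonglongrightarrow> blinfun_apply L x" "norm L \<le> C"
proof -
  have C: "C \<ge> 0"
    using bd by (meson eventually_sequentially norm_ge_zero order_trans order_refl)
  have "convergent (\<lambda>n. T n x)" for x
  proof (rule Cauchy_convergent, rule CauchyI)
    fix e :: real assume e: "e > 0"
    have "x \<in> closure S" using S by simp
    then obtain y where y: "y \<in> S" "dist y x < e / (4 * (C + 1))"
      using e C by (metis closure_approachable divide_pos_pos mult_pos_pos zero_less_numeral add_nonneg_pos zero_less_one)
    have small: "C * norm (x - y) \<le> e / 4"
    proof -
      have "C * norm (x - y) \<le> (C + 1) * (e / (4 * (C + 1)))"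
        using y(2) C by (intro mult_mono) (auto simp: dist_norm norm_minus_commute)
      also have "(C + 1) * (e / (4 * (C + 1))) = e / 4" using C nonzero_mult_div_cancel_left[of "C + 1" "e / 4"] by simp
      finally show ?thesis .
    qed
    obtain N1 where N1: "\<And>n. n \<ge> N1 \<Longrightarrow> norm (T n) \<le> C" using bd by (auto simp: eventually_sequentially)
    obtain N2 where N2: "\<And>m n. m \<ge> N2 \<Longrightarrow> n \<ge> N2 \<Longrightarrow> norm (T m y - T n y) < e / 2"
      using CauchyD[OF convergent_Cauchy[OF conv[OF y(1)]], of "e / 2"] e by auto
    have "norm (T m x - T n x) < e" if "m \<ge> max N1 N2" "n \<ge> max N1 N2" for m n
    proof -
      have T: "norm (T k (x - y)) \<le> e / 4" if "k \<ge> N1" for k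
        using norm_blinfun[of "T k" "x - y"] N1[OF that] small by (meson mult_right_mono norm_ge_zero order_trans)
      have "T m x - T n x = T m (x - y) + (T m y - T n y) - T n (x - y)"
        by (simp add: blinfun.diff_right)
      also have "norm \<dots> \<le> norm (T m (x - y)) + norm (T m y - T n y) + norm (T n (x - y))"
        by (meson add_mono norm_triangle_ineq norm_triangle_ineq4 order_refl order_trans)
      finally show ?thesis using T[of m] T[of n] N2[of m n] that by simp
    qed
    then show "\<exists>M. \<forall>m\<ge>M. \<forall>n\<ge>M. norm (T m x - T n x) < e" by blast
  qed
  then obtain f where f: "\<And>x. (\<lambda>n. T n x) \<longlonglongrightarrow> f x" unfolding convergent_def by metis
  have fb: "norm (f x) \<le> C * norm x" for x
  proof (rule tendsto_upperbound[OF tendsto_norm[OF f]])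
    show "eventually (\<lambda>n. norm (T n x) \<le> C * norm x) sequentially"
      using bd by eventually_elim (meson mult_right_mono norm_blinfun norm_ge_zero order_trans)
  qed simp
  have bl: "bounded_linear f"
  proof (rule bounded_linear_intro[where K = C])
    show "f (x + y) = f x + f y" for x y
      using LIMSEQ_unique[OF f[of "x + y"]] tendsto_add[OF f f, of x y] by (simp add: blinfun.add_right)
    show "f (r *\<^sub>R x) = r *\<^sub>R f x" for r x
      using LIMSEQ_unique[OF f[of "r *\<^sub>R x"]] tendsto_scaleR[OF tendsto_const f, of r x]
      by (simp add: blinfun.scaleR_right)
    show "norm (f x) \<le> norm x * C" for x using fb by (simp add: mult.commute)
  qed
  show thesis
  proof (rule that[of "Blinfun f"])
    show "(\<lambda>n. T n x) \<longlonglongrightarrow> blinfun_apply (Blinfun f) x" for x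
      using f by (simp add: bounded_linear_Blinfun_apply[OF bl])
    show "norm (Blinfun f) \<le> C"
      using fb C by (intro norm_blinfun_bound) (simp_all add: bounded_linear_Blinfun_apply[OF bl])
  qed
qed

lemma strong_tendsto_apply:
  fixes T :: "nat \<Rightarrow> 'a::real_normed_vector \<Rightarrow>\<^sub>L 'b::real_normed_vector"
  assumes bd: "eventually (\<lambda>n. norm (T n) \<le> C) sequentially"
    and T: "(\<lambda>n. T n y) \<longlonglongrightarrow> l" and v: "v \<longlonglongrightarrow> y"
  shows "(\<lambda>n. T n (v n)) \<longlonglongrightarrow> l"
proof -
  have "(\<lambda>n. T n (v n - y)) \<longlonglongrightarrow> 0"
  proof (rule Lim_null_comparison)
    show "eventually (\<lambda>n. norm (T n (v n - y)) \<le> C * norm (v n - y)) sequentially"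
      using bd by eventually_elim (rule norm_blinfun_le)
    show "(\<lambda>n. C * norm (v n - y)) \<longlonglongrightarrow> 0"
      using v by (intro tendsto_mult_right_zero tendsto_norm_zero) (simp add: LIM_zero_iff)
  qed
  from tendsto_add[OF this T] show ?thesis by (simp add: blinfun.diff_right)
qed

lemma dense_image:
  fixes f :: "'a::topological_space \<Rightarrow> 'b::topological_space"
  assumes "continuous_on UNIV f" "closure S = UNIV" "closure (range f) = UNIV"
  shows "closure (f ` S) = UNIV"
proof -
  have "f ` closure S \<subseteq> closure (f ` S)"
    using assms(1) by (intro continuous_image_closure_subset[of "closure S" f S]) (auto simp: assms(2))
  then have "closure (range f) \<subseteq> closure (f ` S)"
    unfolding assms(2) by (intro closure_minimal) auto
  then show ?thesis using assms(3) by auto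
qed

section \<open>Averages as integrals of step functions\<close>

lemma step_function_has_integral:
  fixes e :: "nat \<Rightarrow> real"
  assumes n: "n > 0"
  shows "((\<lambda>s. e (nat \<lfloor>real n * s\<rfloor>)) has_integral (\<Sum>k<N. e k) / real n) {0..real N / real n}"
proof (induction N)
  case 0
  show ?case by (simp add: has_integral_refl)
next
  case (Suc N)
  have "((\<lambda>s. e N) has_integral e N / real n) {real N / real n..real (Suc N) / real n}"
    using has_integral_const_real[of "e N" "real N / real n" "real (Suc N) / real n"] n
    by (simp add: field_simps)
  then have "((\<lambda>s. e (nat \<lfloor>real n * s\<rfloor>)) has_integral e N / real n) {real N / real n..real (Suc N) / real n}"
  \<comment> \<open>The floor jumps at the right endpoint of the interval, so this one point is
    removed.\<close>
  proof (rule has_integral_spike_finite[rotated 2])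
    fix s assume s: "s \<in> {real N / real n..real (Suc N) / real n} - {real (Suc N) / real n}"
    have "real N \<le> real n * s" "real n * s < real N + 1"
      using s n by (auto simp: field_simps)
    then have "\<lfloor>real n * s\<rfloor> = int N" by (simp add: floor_unique)
    then show "e (nat \<lfloor>real n * s\<rfloor>) = e N" by simp
  qed simp
  then show ?case
    using has_integral_combine[OF _ _ Suc.IH, of "real (Suc N) / real n" "e N / real n"] n
    by (simp add: field_simps)
qed

text \<open>This passes from convergence at each fixed \<open>s\<close>, where only the index
  \<open>[n s]\<close> is seen, to the whole sum over \<open>k\<close>: the average is the integral
  of a step function in \<open>s\<close>, and dominated convergence applies. The bound includes
  \<open>k = n * S\<close>, the index that belongs to the endpoint.\<close>

lemma average_tendsto_zero:
  fixes e :: "nat \<Rightarrow> nat \<Rightarrow> real"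
  assumes bound: "\<And>n k. k \<le> n * S \<Longrightarrow> \<bar>e n k\<bar> \<le> C"
    and ptw: "\<And>s. 0 \<le> s \<Longrightarrow> s \<le> real S \<Longrightarrow> (\<lambda>n. e n (nat \<lfloor>real n * s\<rfloor>)) \<longlonglongrightarrow> 0"
  shows "(\<lambda>n. (\<Sum>k<n * S. e n k) / real n) \<longlonglongrightarrow> 0"
proof -
  let ?f = "\<lambda>n s. e n (nat \<lfloor>real n * s\<rfloor>)"
  have int: "(?f n has_integral (\<Sum>k<n * S. e n k) / real n) {0..real S}" if "n > 0" for n
    using step_function_has_integral[OF that, of "e n" "n * S"] that by simp
  \<comment> \<open>The shift to \<open>Suc n\<close> avoids \<open>n = 0\<close>, where the sum is
    not represented by the integral.\<close>
  have "(\<lambda>n. integral {0..real S} (?f (Suc n))) \<longlonglongrightarrow> integral {0..real S} (\<lambda>s. 0)"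
  proof (rule dominated_convergence(2)[where h = "\<lambda>s. C"])
    show "?f (Suc n) integrable_on {0..real S}" for n
      using int[of "Suc n"] by blast
    show "norm (?f (Suc n) s) \<le> C" if "s \<in> {0..real S}" for n s
    proof -
      have "real (Suc n) * s \<le> real (Suc n) * real S"
        using that by (intro mult_left_mono) auto
      then have "nat \<lfloor>real (Suc n) * s\<rfloor> \<le> Suc n * S"
        by (metis floor_mono floor_of_nat nat_int nat_mono of_nat_mult)
      then show ?thesis using bound by simp
    qed
    show "(\<lambda>n. ?f (Suc n) s) \<longlonglongrightarrow> 0" if "s \<in> {0..real S}" for s
    proof -
      have "(\<lambda>n. ?f n s) \<longlonglongrightarrow> 0" using that ptw by simp
      then show ?thesis by (rule LIMSEQ_Suc)
    qed
  qed auto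
  moreover have "integral {0..real S} (?f (Suc n)) = (\<Sum>k<Suc n * S. e (Suc n) k) / real (Suc n)" for n
    using int[of "Suc n"] by (intro integral_unique) simp
  ultimately have "(\<lambda>n. (\<Sum>k<Suc n * S. e (Suc n) k) / real (Suc n)) \<longlonglongrightarrow> 0"
    by simp
  then show ?thesis by (rule LIMSEQ_imp_Suc)
qed

text \<open>Weak compactness yields subsequences, but the limit found along them is always the same,
  and this restores convergence of the full sequence. Otherwise the infinitely many indices at
  distance at least \<open>e\<close> from \<open>l\<close> would form a subsequence without a
  refinement converging to \<open>l\<close>.\<close>

lemma LIMSEQ_subseqI:
  fixes x :: "nat \<Rightarrow> 'a::metric_space"
  assumes "\<And>r::nat \<Rightarrow> nat. strict_mono r \<Longrightarrow> \<exists>q::nat \<Rightarrow> nat. strict_mono q \<and> (\<lambda>n. x (r (q n))) \<longlonglongrightarrow> l"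
  shows "x \<longlonglongrightarrow> l"
proof (rule ccontr)
  assume "\<not> x \<longlonglongrightarrow> l"
  then obtain e where e: "e > 0" "\<not> eventually (\<lambda>n. dist (x n) l < e) sequentially"
    by (auto simp: tendsto_iff)
  then have "frequently (\<lambda>n. \<not> dist (x n) l < e) cofinite"
    unfolding cofinite_eq_sequentially not_eventually by blast
  then have inf: "infinite {n. \<not> dist (x n) l < e}"
    unfolding frequently_cofinite .
  let ?r = "enumerate {n. \<not> dist (x n) l < e}"
  have "strict_mono ?r" using inf by (simp add: strict_mono_enumerate)
  from assms[OF this] obtain q :: "nat \<Rightarrow> nat" where q: "(\<lambda>n. x (?r (q n))) \<longlonglongrightarrow> l"
    by blast
  have "\<exists>n. dist (x (?r (q n))) l < e"
    by (rule eventually_happens'[OF sequentially_bot tendstoD[OF q e(1)]])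
  then obtain n where n: "dist (x (?r (q n))) l < e" ..
  have "?r (q n) \<in> {n. \<not> dist (x n) l < e}" by (rule enumerate_in_set[OF inf])
  with n show False by blast
qed

section \<open>Weak and weak-* convergence\<close>

context normed_space_over begin

lemma weakly_converges_toD:
  "weakly_converges_to smul x l \<Longrightarrow> \<phi> \<in> dual_space smul \<Longrightarrow> (\<lambda>n. blinfun_apply \<phi> (x n)) \<longlonglongrightarrow> blinfun_apply \<phi> l"
  by (simp add: weakly_converges_to_def)

lemma weakly_converges_toI:
  "(\<And>\<phi>. \<phi> \<in> dual_space smul \<Longrightarrow> (\<lambda>n. blinfun_apply \<phi> (x n)) \<longlonglongrightarrow> blinfun_apply \<phi> l) \<Longrightarrow>
    weakly_converges_to smul x l"
  by (simp add: weakly_converges_to_def)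

text \<open>The constant is the product of two factors 2, one for the size of a norming functional
  and one for its value at \<open>l\<close>.\<close>

lemma weak_limit_norm_le:
  assumes "weakly_converges_to smul x l" "\<And>n. norm (x n) \<le> C"
  shows "norm l \<le> 4 * C"
proof -
  obtain \<phi> where \<phi>: "\<phi> \<in> dual_space smul" "\<And>x. norm (blinfun_apply \<phi> x) \<le> 2 * norm x"
    "norm l \<le> 2 * norm (blinfun_apply \<phi> l)"
    using dual_space_norming[of l] by blast
  have "norm (blinfun_apply \<phi> (x n)) \<le> 2 * C" for n
    using \<phi>(2)[of "x n"] assms(2)[of n] by simp
  then have "norm (blinfun_apply \<phi> l) \<le> 2 * C"
    by (intro LIMSEQ_le_const2[OF tendsto_norm[OF weakly_converges_toD[OF assms(1) \<phi>(1)]]]) auto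
  with \<phi>(3) show ?thesis by simp
qed

lemma weakly_converges_to_diff:
  "weakly_converges_to smul x l \<Longrightarrow> weakly_converges_to smul y m \<Longrightarrow>
    weakly_converges_to smul (\<lambda>n. x n - y n) (l - m)"
  by (auto simp: weakly_converges_to_def blinfun.diff_right intro: tendsto_diff)

lemma weakly_converges_to_subseq:
  "weakly_converges_to smul x l \<Longrightarrow> strict_mono q \<Longrightarrow> weakly_converges_to smul (\<lambda>n. x (q n)) l"
  unfolding weakly_converges_to_def using LIMSEQ_subseq_LIMSEQ[unfolded o_def] by blast

lemma tendsto_weakly_converges_to:
  "x \<longlonglongrightarrow> l \<Longrightarrow> weakly_converges_to smul x l"
  by (auto simp: weakly_converges_to_def intro: blinfun.tendsto)

lemma weakly_converges_to_cong_norm: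
  assumes "weakly_converges_to smul x l" "(\<lambda>n. norm (y n - x n)) \<longlonglongrightarrow> 0"
  shows "weakly_converges_to smul y l"
proof -
  have "weakly_converges_to smul (\<lambda>n. x n - (x n - y n)) (l - 0)"
    using assms(2) by (intro weakly_converges_to_diff[OF assms(1)] tendsto_weakly_converges_to)
      (simp add: tendsto_norm_zero_iff norm_minus_commute)
  then show ?thesis by simp
qed

lemma weakly_precompactD:
  assumes "subseqs_have_weakly_convergent_subseq smul x" "strict_mono r"
  obtains q l where "strict_mono (q::nat \<Rightarrow> nat)" "weakly_converges_to smul (\<lambda>n. x (r (q n))) l"
  using assms by (auto simp: subseqs_have_weakly_convergent_subseq_def o_def)

end

locale banach_space_over = normed_space_over smul
  for smul :: "'k::real_or_complex \<Rightarrow> 'a::banach \<Rightarrow> 'a"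
begin

text \<open>A diagonal subsequence makes all the \<open>x j\<close> converge weakly at once. Their
  weak limits form a Cauchy sequence, because norm bounds on differences survive weak limits up to a
  constant, and the limit of that sequence is the weak limit of \<open>y\<close>.\<close>

lemma weakly_precompact_limit:
  assumes x: "\<And>j. subseqs_have_weakly_convergent_subseq smul (x j)"
    and near: "\<And>j n. norm (x j n - y n) \<le> \<delta> j" and \<delta>: "\<delta> \<longlonglongrightarrow> 0"
  shows "subseqs_have_weakly_convergent_subseq smul y"
  unfolding subseqs_have_weakly_convergent_subseq_def
proof (intro allI impI)
  fix r :: "nat \<Rightarrow> nat" assume r: "strict_mono r"
  let ?P = "\<lambda>j s. \<exists>l. weakly_converges_to smul (\<lambda>n. x j (r (s n))) l"
  interpret subseqs ?P
  proof
    fix j and s :: "nat \<Rightarrow> nat" assume "strict_mono s"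
    then have "strict_mono (\<lambda>n. r (s n))" using strict_mono_o[OF r] by (simp add: o_def)
    from weakly_precompactD[OF x this, of j]
    obtain q l where "strict_mono q" "weakly_converges_to smul (\<lambda>n. x j (r (s (q n)))) l" .
    then show "\<exists>r'. strict_mono r' \<and> ?P j (s \<circ> r')" unfolding o_def by blast
  qed
  have "?P j (diagseq \<circ> ((+) (Suc j)))" for j
  proof (rule diagseq_holds)
    fix q s :: "nat \<Rightarrow> nat" and j assume q: "strict_mono q" and "?P j s"
    then obtain l where "weakly_converges_to smul (\<lambda>n. x j (r (s n))) l" by blast
    from weakly_converges_to_subseq[OF this q] show "?P j (s \<circ> q)" unfolding o_def by blast
  qed
  then have "\<forall>j. \<exists>l. weakly_converges_to smul (\<lambda>n. x j (r (diagseq (Suc j + n)))) l"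
    unfolding o_def by blast
  from choice[OF this] obtain w where "\<forall>j. weakly_converges_to smul (\<lambda>n. x j (r (diagseq (Suc j + n)))) (w j)" ..
  then have w: "\<And>j. weakly_converges_to smul (\<lambda>n. x j (r (diagseq (Suc j + n)))) (w j)" ..
  \<comment> \<open>The convergence obtained above concerns the diagonal sequence from index
    \<open>Suc j\<close> on; a finite shift does not affect it.\<close>
  have w': "weakly_converges_to smul (\<lambda>n. x j (r (diagseq n))) (w j)" for j
  proof (rule weakly_converges_toI)
    fix \<phi> assume "\<phi> \<in> dual_space smul"
    from weakly_converges_toD[OF w[of j] this]
    have "(\<lambda>n. blinfun_apply \<phi> (x j (r (diagseq (n + Suc j))))) \<longlonglongrightarrow> blinfun_apply \<phi> (w j)"
      by (simp add: add.commute)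
    then show "(\<lambda>n. blinfun_apply \<phi> (x j (r (diagseq n)))) \<longlonglongrightarrow> blinfun_apply \<phi> (w j)"
      by (rule LIMSEQ_offset)
  qed
  have wd: "norm (w i - w j) \<le> 4 * (\<delta> i + \<delta> j)" for i j
  proof (rule weak_limit_norm_le[OF weakly_converges_to_diff[OF w' w']])
    fix n show "norm (x i (r (diagseq n)) - x j (r (diagseq n))) \<le> \<delta> i + \<delta> j"
      using near[of i "r (diagseq n)"] near[of j "r (diagseq n)"]
        norm_triangle_ineq4[of "x i (r (diagseq n)) - y (r (diagseq n))" "x j (r (diagseq n)) - y (r (diagseq n))"]
      by simp
  qed
  have "Cauchy w"
  proof (rule metric_CauchyI)
    fix e :: real assume "e > 0"
    then have "eventually (\<lambda>j. \<bar>\<delta> j\<bar> < e / 8) sequentially"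
      using tendstoD[OF \<delta>, of "e / 8"] by simp
    then obtain N where N: "\<And>j. j \<ge> N \<Longrightarrow> \<bar>\<delta> j\<bar> < e / 8" by (auto simp: eventually_sequentially)
    have "dist (w i) (w j) < e" if "i \<ge> N" "j \<ge> N" for i j
      using wd[of i j] N[OF that(1)] N[OF that(2)] by (simp add: dist_norm)
    then show "\<exists>M. \<forall>i\<ge>M. \<forall>j\<ge>M. dist (w i) (w j) < e" by blast
  qed
  then obtain l where l: "w \<longlonglongrightarrow> l" by (auto simp: Cauchy_convergent_iff convergent_def)
  have "weakly_converges_to smul (\<lambda>n. y (r (diagseq n))) l"
  proof (rule weakly_converges_toI)
    fix \<phi> assume \<phi>: "\<phi> \<in> dual_space smul"
    show "(\<lambda>n. blinfun_apply \<phi> (y (r (diagseq n)))) \<longlonglongrightarrow> blinfun_apply \<phi> l"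
    proof (rule LIMSEQ_I)
      fix e :: real assume e: "e > 0"
      have "(\<lambda>j. norm \<phi> * \<delta> j + norm \<phi> * norm (w j - l)) \<longlonglongrightarrow> norm \<phi> * 0 + norm \<phi> * norm (l - l)"
        by (intro tendsto_intros \<delta> l)
      then have "eventually (\<lambda>j. norm \<phi> * \<delta> j + norm \<phi> * norm (w j - l) < e / 2) sequentially"
        using e by (intro order_tendstoD(2)) auto
      then obtain j where j: "norm \<phi> * \<delta> j + norm \<phi> * norm (w j - l) < e / 2"
        using eventually_happens'[OF sequentially_bot] by blast
      obtain N where N: "\<And>n. n \<ge> N \<Longrightarrow> norm (blinfun_apply \<phi> (x j (r (diagseq n))) - blinfun_apply \<phi> (w j)) < e / 2"
        using LIMSEQ_D[OF weakly_converges_toD[OF w' \<phi>], of "e / 2" j] e by auto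
      have "norm (blinfun_apply \<phi> (y (r (diagseq n))) - blinfun_apply \<phi> l) < e" if "n \<ge> N" for n
      proof -
        let ?y = "y (r (diagseq n))" and ?x = "x j (r (diagseq n))"
        let ?a = "blinfun_apply \<phi> ?x - blinfun_apply \<phi> (w j)" and ?b = "blinfun_apply \<phi> (?x - ?y)"
          and ?c = "blinfun_apply \<phi> (w j - l)"
        have eq: "blinfun_apply \<phi> ?y - blinfun_apply \<phi> l = ?a - ?b + ?c"
          by (simp add: blinfun.diff_right algebra_simps)
        have "norm (blinfun_apply \<phi> ?y - blinfun_apply \<phi> l) \<le> norm ?a + norm ?b + norm ?c"
          unfolding eq using norm_triangle_ineq[of "?a - ?b" ?c] norm_triangle_ineq4[of ?a ?b] by linarith
        also have "norm (blinfun_apply \<phi> (?x - ?y)) \<le> norm \<phi> * \<delta> j"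
          using norm_blinfun[of \<phi> "?x - ?y"] mult_left_mono[OF near norm_ge_zero] by (rule order_trans)
        also have "norm (blinfun_apply \<phi> (w j - l)) \<le> norm \<phi> * norm (w j - l)" by (rule norm_blinfun)
        finally show ?thesis using N[OF that] j by simp
      qed
      then show "\<exists>N. \<forall>n\<ge>N. norm (blinfun_apply \<phi> (y (r (diagseq n))) - blinfun_apply \<phi> l) < e" by blast
    qed
  qed
  then show "\<exists>(q::nat \<Rightarrow> nat) l. strict_mono q \<and> weakly_converges_to smul (y \<circ> r \<circ> q) l"
    using subseq_diagseq by (auto simp: o_def)
qed

end

context normed_space_over begin

lemma convergent_imp_weakly_precompact:
  assumes "x \<longlonglongrightarrow> l"
  shows "subseqs_have_weakly_convergent_subseq smul x"
  unfolding subseqs_have_weakly_convergent_subseq_def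
proof (intro allI impI)
  fix r :: "nat \<Rightarrow> nat" assume "strict_mono r"
  then have "weakly_converges_to smul (x \<circ> r) l"
    by (intro tendsto_weakly_converges_to LIMSEQ_subseq_LIMSEQ assms)
  then show "\<exists>(q::nat \<Rightarrow> nat) l. strict_mono q \<and> weakly_converges_to smul (x \<circ> r \<circ> q) l"
    by (intro exI[of _ id] exI[of _ l]) (simp add: strict_mono_id)
qed

section \<open>The weak-* topology of the dual space\<close>

lemma openin_weak_star_topology:
  "openin (weak_star_topology smul) S \<longleftrightarrow> (\<exists>U. open U \<and> S = blinfun_apply -` U \<inter> dual_space smul)"
  by (simp add: weak_star_topology_def openin_pullback_topology euclidean_product_topology)

lemma topspace_weak_star_topology: "topspace (weak_star_topology smul) = dual_space smul"
  by (auto simp: weak_star_topology_def topspace_pullback_topology)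

text \<open>Evaluation at \<open>x\<close> is weak-* continuous. If some functional did not vanish
  at \<open>x\<close>, the functionals with this property would form a nonempty open set, which
  \<open>D\<close> would have to meet.\<close>

lemma weak_star_dense_separates:
  assumes D: "weak_star_topology smul closure_of D = dual_space smul"
    and x: "\<And>\<phi>. \<phi> \<in> D \<Longrightarrow> blinfun_apply \<phi> x = 0"
  shows "x = 0"
proof (rule dual_space_separates, rule ccontr)
  fix \<phi> assume \<phi>: "\<phi> \<in> dual_space smul" "blinfun_apply \<phi> x \<noteq> 0"
  have "open {f :: 'a \<Rightarrow> 'k. f x \<noteq> 0}"
    using open_vimage[OF _ continuous_on_product_coordinates[of x], of "- {0 :: 'k}"]
    by (auto simp: vimage_def)
  then have op: "openin (weak_star_topology smul) (blinfun_apply -` {f. f x \<noteq> 0} \<inter> dual_space smul)"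
    (is "openin _ ?S") unfolding openin_weak_star_topology by blast
  have "\<phi> \<in> weak_star_topology smul closure_of D" using D \<phi>(1) by simp
  then have all: "\<forall>T. \<phi> \<in> T \<and> openin (weak_star_topology smul) T \<longrightarrow> (\<exists>y. y \<in> D \<and> y \<in> T)"
    unfolding in_closure_of by (rule conjunct2)
  have "\<phi> \<in> ?S" using \<phi> by simp
  then have "\<exists>y. y \<in> D \<and> y \<in> ?S" by (rule mp[OF spec[OF all] conjI[OF _ op]])
  then obtain \<psi> where \<psi>: "\<psi> \<in> D \<and> \<psi> \<in> ?S" ..
  with x[OF conjunct1[OF \<psi>]] show False by simp
qed

lemma weak_star_sequential_closure:
  assumes D: "D \<subseteq> dual_space smul"
    and seq: "\<And>\<phi>. \<phi> \<in> dual_space smul \<Longrightarrow>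
      \<exists>\<psi>. (\<forall>n. \<psi> n \<in> D) \<and> (\<forall>x. (\<lambda>n. blinfun_apply (\<psi> n) x) \<longlonglongrightarrow> blinfun_apply \<phi> x)"
  shows "weak_star_topology smul closure_of D = dual_space smul"
proof
  show "weak_star_topology smul closure_of D \<subseteq> dual_space smul"
    using closure_of_subset_topspace[of "weak_star_topology smul" D]
    by (simp only: topspace_weak_star_topology)
  show "dual_space smul \<subseteq> weak_star_topology smul closure_of D"
  proof
    fix \<phi> assume \<phi>: "\<phi> \<in> dual_space smul"
    from seq[OF this] obtain \<psi> where
      "(\<forall>n. \<psi> n \<in> D) \<and> (\<forall>x. (\<lambda>n. blinfun_apply (\<psi> n) x) \<longlonglongrightarrow> blinfun_apply \<phi> x)" ..
    then have \<psi>: "\<And>n. \<psi> n \<in> D" "\<And>x. (\<lambda>n. blinfun_apply (\<psi> n) x) \<longlonglongrightarrow> blinfun_apply \<phi> x"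
      by simp_all
    have lim: "(\<lambda>n. blinfun_apply (\<psi> n)) \<longlonglongrightarrow> blinfun_apply \<phi>"
      using \<psi>(2) limitin_componentwise[where X = "\<lambda>_. euclidean" and I = UNIV
        and f = "\<lambda>n. blinfun_apply (\<psi> n)" and l = "blinfun_apply \<phi>" and F = sequentially]
      by (simp add: euclidean_product_topology)
    show "\<phi> \<in> weak_star_topology smul closure_of D"
      unfolding in_closure_of topspace_weak_star_topology openin_weak_star_topology
    proof (intro conjI allI impI \<phi>)
      fix T assume "\<phi> \<in> T \<and> (\<exists>U. open U \<and> T = blinfun_apply -` U \<inter> dual_space smul)"
      then obtain U where U: "open U" "blinfun_apply \<phi> \<in> U" "T = blinfun_apply -` U \<inter> dual_space smul"
        by auto
      have "\<exists>n. blinfun_apply (\<psi> n) \<in> U"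
        by (rule eventually_happens'[OF sequentially_bot topological_tendstoD[OF lim U(1,2)]])
      then obtain n where "blinfun_apply (\<psi> n) \<in> U" ..
      then have "\<psi> n \<in> D \<and> \<psi> n \<in> T" using \<psi>(1)[of n] D U(3) by auto
      then show "\<exists>y. y \<in> D \<and> y \<in> T" ..
    qed
  qed
qed

end

section \<open>Generation of a semigroup by implicit Euler steps\<close>

lemma blinfun_pow_add_apply: "blinfun_pow A (m + n) x = blinfun_pow A m (blinfun_pow A n x)"
  by (induction m) auto

lemma blinfun_pow_Suc_apply: "blinfun_pow A (Suc n) x = blinfun_pow A n (A x)"
  using blinfun_pow_add_apply[of A n 1 x] by simp

lemma blinfun_pow_commute:
  assumes "\<And>x. blinfun_apply A (blinfun_apply B x) = blinfun_apply B (blinfun_apply A x)"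
  shows "blinfun_apply A (blinfun_pow B n x) = blinfun_pow B n (blinfun_apply A x)"
  by (induction n) (simp_all add: assms)

lemma blinfun_pow_diff_telescope:
  "blinfun_pow A n x - x = (\<Sum>i<n. blinfun_pow A i (A x - x))"
proof (induction n)
  case (Suc n)
  have "blinfun_pow A (Suc n) x - x = blinfun_pow A n (A x - x) + (blinfun_pow A n x - x)"
    by (simp only: blinfun_pow_Suc_apply blinfun.diff_right) simp
  then show ?case using Suc.IH by (simp add: add.commute)
qed simp

lemma convergent_geometric_steps:
  fixes X :: "nat \<Rightarrow> 'a::banach"
  assumes "\<And>j. norm (X (Suc j) - X j) \<le> c * (1 / 2) ^ j"
  shows "convergent X"
proof -
  have "summable (\<lambda>j. X (Suc j) - X j)"
    by (rule summable_comparison_test'[of "\<lambda>j. c * (1 / 2) ^ j" 0])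
      (auto intro: assms summable_mult summable_geometric)
  then have "(\<lambda>n. \<Sum>j<n. X (Suc j) - X j) \<longlonglongrightarrow> (\<Sum>j. X (Suc j) - X j)"
    by (rule summable_LIMSEQ)
  then have "(\<lambda>n. X n - X 0) \<longlonglongrightarrow> (\<Sum>j. X (Suc j) - X j)"
    by (simp add: sum_lessThan_telescope)
  from tendsto_add[OF this tendsto_const[of "X 0"]] show ?thesis
    by (simp add: convergent_def) blast
qed

context normed_space_over begin

lemma smul_scaleR: "smul c (r *\<^sub>R x) = r *\<^sub>R smul c x"
  by (metis scale_left_commute smul_of_real)

lemma bounded_linear_smul: "bounded_linear (smul c)"
  by (rule bounded_linear_intro[where K = "norm c"])
    (simp_all add: scale_right_distrib smul_scaleR norm_smul mult.commute)

lemmas tendsto_smul = bounded_linear.tendsto[OF bounded_linear_smul]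

end

text \<open>\<open>G h\<close> stands for the inverse of \<open>1 - h B\<close>: \<open>G_in\<close>
  makes it a right inverse, \<open>G_inv\<close> a left inverse, and \<open>G_pow\<close> is the
  power estimate of the generation theorem, uniform for small steps. \<open>B\<close> enters as a
  relation; that it is single-valued comes out of \<open>generated\<close>.\<close>

locale resolvent_family = banach_space_over smul
  for smul :: "'k::real_or_complex \<Rightarrow> 'a::banach \<Rightarrow> 'a" +
  fixes B :: "('a \<times> 'a) set" and G :: "real \<Rightarrow> 'a \<Rightarrow>\<^sub>L 'a" and \<delta> M b :: real
  assumes B_add: "(x, z) \<in> B \<Longrightarrow> (x', z') \<in> B \<Longrightarrow> (x + x', z + z') \<in> B"
    and B_smul: "(x, z) \<in> B \<Longrightarrow> (smul c x, smul c z) \<in> B"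
    and dense: "closure (Domain B) = UNIV"
    and pos: "\<delta> > 0" "M \<ge> 1" "b \<ge> 0"
    and G_in: "0 < h \<Longrightarrow> h \<le> \<delta> \<Longrightarrow> (G h y, (1 / h) *\<^sub>R (G h y - y)) \<in> B"
    and G_inv: "0 < h \<Longrightarrow> h \<le> \<delta> \<Longrightarrow> (x, z) \<in> B \<Longrightarrow> G h (x - h *\<^sub>R z) = x"
    and G_pow: "0 < h \<Longrightarrow> h \<le> \<delta> \<Longrightarrow> norm (blinfun_pow (G h) m) \<le> M * exp (b * (real m * h))"
begin

lemma B_scaleR: "(x, z) \<in> B \<Longrightarrow> (r *\<^sub>R x, r *\<^sub>R z) \<in> B"
  using B_smul[of x z "of_real r"] by (simp add: smul_of_real)

lemma B_diff: "(x, z) \<in> B \<Longrightarrow> (x', z') \<in> B \<Longrightarrow> (x - x', z - z') \<in> B"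
  using B_add[of x z "(-1) *\<^sub>R x'" "(-1) *\<^sub>R z'"] B_scaleR[of x' z' "-1"] by simp

lemma G_smul:
  assumes "0 < h" "h \<le> \<delta>" shows "G h (smul c y) = smul c (G h y)"
proof -
  have "smul c (G h y) - h *\<^sub>R smul c ((1 / h) *\<^sub>R (G h y - y)) = smul c y"
    using assms(1) by (simp add: smul_scaleR scale_right_diff_distrib)
  with G_inv[OF assms B_smul[OF G_in[OF assms, of y], of c]] show ?thesis by simp
qed

text \<open>Let \<open>x = G h (G h' y)\<close> and let \<open>q\<close> be its image under
  \<open>B\<close>. Then \<open>G h'\<close> maps \<open>x - h' q\<close> to \<open>x\<close>. An
  image of \<open>x - h' q\<close> under \<open>B\<close> is known explicitly as well, and it
  identifies this vector with \<open>G h y\<close>.\<close>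

lemma G_commute:
  assumes h: "0 < h" "h \<le> \<delta>" and h': "0 < h'" "h' \<le> \<delta>"
  shows "G h (G h' y) = G h' (G h y)"
proof -
  define u x where "u = G h' y" and "x = G h u"
  define p q where "p = (1 / h') *\<^sub>R (u - y)" and "q = (1 / h) *\<^sub>R (x - u)"
  have up: "(u, p) \<in> B" and xq: "(x, q) \<in> B"
    using G_in[OF h'] G_in[OF h] by (simp_all add: u_def x_def p_def q_def)
  have u: "u = x - h *\<^sub>R q" and y: "y = u - h' *\<^sub>R p"
    using h h' by (simp_all add: p_def q_def)
  have hq: "(h *\<^sub>R q, q - p) \<in> B" using B_diff[OF xq up] u by simp
  have "(q, (1 / h) *\<^sub>R (q - p)) \<in> B" using B_scaleR[OF hq, of "1 / h"] h by simp
  then have "(x - h' *\<^sub>R q, q - h' *\<^sub>R ((1 / h) *\<^sub>R (q - p))) \<in> B"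
    using B_diff[OF xq B_scaleR] by blast
  from G_inv[OF h this]
  have "G h ((x - h' *\<^sub>R q) - h *\<^sub>R (q - h' *\<^sub>R ((1 / h) *\<^sub>R (q - p)))) = x - h' *\<^sub>R q" .
  also have "(x - h' *\<^sub>R q) - h *\<^sub>R (q - h' *\<^sub>R ((1 / h) *\<^sub>R (q - p))) = y"
    using h unfolding y u by (simp add: algebra_simps)
  finally have "G h' (G h y) = G h' (x - h' *\<^sub>R q)" by simp
  also have "\<dots> = x" by (rule G_inv[OF h' xq])
  finally show ?thesis by (simp add: x_def u_def)
qed

lemma G_step:
  assumes "0 < h" "h \<le> \<delta>" "(x, z) \<in> B"
  shows "G h x - x = h *\<^sub>R G h z"
  using G_inv[OF assms] by (simp add: blinfun.diff_right blinfun.scaleR_right algebra_simps)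

definition "K s = M * exp (b * s)"

lemma K_ge_1: "s \<ge> 0 \<Longrightarrow> K s \<ge> 1"
  unfolding K_def using mult_mono[of 1 M 1 "exp (b * s)"] pos by simp

lemma K_mono: "s \<le> u \<Longrightarrow> K s \<le> K u"
  unfolding K_def using pos by (simp add: mult_left_mono)

lemma norm_pow_le:
  assumes "0 < h" "h \<le> \<delta>" "real m * h \<le> s"
  shows "norm (blinfun_pow (G h) m) \<le> K s"
  using G_pow[OF assms(1,2), of m] K_mono[OF assms(3)] unfolding K_def by linarith

lemma norm_pow_apply_le:
  assumes "0 < h" "h \<le> \<delta>" "real m * h \<le> s"
  shows "norm (blinfun_pow (G h) m x) \<le> K s * norm x"
  by (rule norm_blinfun_le[OF norm_pow_le[OF assms]])

text \<open>On the domain of \<open>B\<close>, steps of total length at most \<open>s\<close> move a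
  vector by \<open>O(s)\<close>, independently of \<open>h\<close>. Splitting a general
  \<open>x\<close> at a domain vector \<open>y\<close> gives an estimate that survives the limit of
  vanishing step length.\<close>

lemma norm_pow_diff_le:
  assumes h: "0 < h" "h \<le> \<delta>" "real m * h \<le> s" and yz: "(y, z) \<in> B"
  shows "norm (blinfun_pow (G h) m x - x) \<le> (K s + 1) * norm (x - y) + s * K s * norm z"
proof -
  have s: "0 \<le> s" using h(1,3) mult_nonneg_nonneg[of "real m" h] by linarith
  have "blinfun_pow (G h) m y - y = (\<Sum>i<m. blinfun_pow (G h) i (h *\<^sub>R G h z))"
    unfolding blinfun_pow_diff_telescope G_step[OF h(1,2) yz] ..
  also have "\<dots> = (\<Sum>i<m. h *\<^sub>R blinfun_pow (G h) (Suc i) z)"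
    by (simp only: blinfun.scaleR_right blinfun_pow_Suc_apply)
  also have "norm \<dots> \<le> (\<Sum>i<m. h * (K s * norm z))"
  proof (rule sum_norm_le)
    fix i assume "i \<in> {..<m}"
    then have "real (Suc i) * h \<le> real m * h" using h(1) by (intro mult_right_mono) auto
    then have "real (Suc i) * h \<le> s" using h(3) by (rule order_trans)
    then have "norm (blinfun_pow (G h) (Suc i) z) \<le> K s * norm z"
      by (rule norm_pow_apply_le[OF h(1,2)])
    then show "norm (h *\<^sub>R blinfun_pow (G h) (Suc i) z) \<le> h * (K s * norm z)"
      using h(1) by (simp del: blinfun_pow.simps)
  qed
  also have "\<dots> = (real m * h) * (K s * norm z)" by simp
  also have "\<dots> \<le> s * (K s * norm z)"
    using K_ge_1[OF s] by (intro mult_right_mono h) simp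
  finally have 1: "norm (blinfun_pow (G h) m y - y) \<le> s * K s * norm z" by (simp add: mult.assoc)
  have eq: "blinfun_pow (G h) m x - x = (blinfun_pow (G h) m (x - y) - (x - y)) + (blinfun_pow (G h) m y - y)"
    by (simp add: blinfun.diff_right)
  have "norm (blinfun_pow (G h) m x - x) \<le> norm (blinfun_pow (G h) m (x - y)) + norm (x - y) + norm (blinfun_pow (G h) m y - y)"
    unfolding eq using norm_triangle_ineq[of "blinfun_pow (G h) m (x - y) - (x - y)" "blinfun_pow (G h) m y - y"]
      norm_triangle_ineq4[of "blinfun_pow (G h) m (x - y)" "x - y"] by linarith
  with 1 norm_pow_apply_le[OF h, of "x - y"] show ?thesis by (simp add: distrib_right)
qed

text \<open>\<open>R\<close> is the resolvent of \<open>B\<close> at the largest admissible step,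
  and \<open>A\<^sub>R\<close> is the bounded operator \<open>B R\<close>, the Yosida approximation
  of \<open>B\<close>.\<close>

definition "R = G \<delta>"
definition "A\<^sub>R = (1 / \<delta>) *\<^sub>R (R - id_blinfun)"

lemma A\<^sub>R_apply: "A\<^sub>R x = (1 / \<delta>) *\<^sub>R (R x - x)"
  by (simp add: A\<^sub>R_def blinfun.scaleR_left blinfun.diff_left)

lemma R_in: "(R y, A\<^sub>R y) \<in> B"
  using G_in[of \<delta> y] pos by (simp add: R_def A\<^sub>R_apply)

lemma R_inv: "(x, z) \<in> B \<Longrightarrow> R (x - \<delta> *\<^sub>R z) = x"
  using G_inv[of \<delta> x z] pos by (simp add: R_def)

lemma A\<^sub>R_R: "A\<^sub>R (R y) = R (A\<^sub>R y)"
  by (simp add: A\<^sub>R_apply blinfun.diff_right blinfun.scaleR_right)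

lemma dense_range_R: "closure (range (blinfun_apply R)) = UNIV"
proof -
  have "Domain B \<subseteq> range (blinfun_apply R)"
    using R_inv by (metis DomainE rangeI subsetI)
  then show ?thesis using dense closure_mono by blast
qed

lemma dense_range_RR: "closure (range (\<lambda>y. R (R y))) = UNIV"
proof -
  have "closure (blinfun_apply R ` range (blinfun_apply R)) = UNIV"
    by (rule dense_image[OF linear_continuous_on[OF blinfun.bounded_linear_right] dense_range_R dense_range_R])
  then show ?thesis by (simp add: image_image)
qed

text \<open>The Euler step of length \<open>2 g\<close> agrees with two steps of length \<open>g\<close> up to
  \<open>g\<^sup>2 B\<^sup>2\<close>, because \<open>(1 - g B)\<^sup>2 = (1 - 2 g B) + g\<^sup>2 B\<^sup>2\<close>.\<close>

lemma G_double_step: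
  fixes y :: 'a
  assumes g: "0 < g" "2 * g \<le> \<delta>"
  defines "w \<equiv> A\<^sub>R (A\<^sub>R y)"
  shows "G (2 * g) (R (R y)) - G g (G g (R (R y))) = (g * g) *\<^sub>R G (2 * g) (G g (G g w))"
proof -
  let ?x = "R (R y)" and ?v = "R (A\<^sub>R y)"
  have g': "0 < g" "g \<le> \<delta>" and g2: "0 < 2 * g" "2 * g \<le> \<delta>" using g by auto
  have xv: "(?x, ?v) \<in> B" using R_in[of "R y"] by (simp add: A\<^sub>R_R)
  have vw: "(?v, w) \<in> B" using R_in[of "A\<^sub>R y"] by (simp add: w_def)
  define u where "u = ?x - g *\<^sub>R ?v"
  have uB: "(u, ?v - g *\<^sub>R w) \<in> B" unfolding u_def by (intro B_diff B_scaleR xv vw)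
  define q where "q = ?x - (2 * g) *\<^sub>R ?v + (g * g) *\<^sub>R w"
  have "u - g *\<^sub>R (?v - g *\<^sub>R w) = q" by (simp add: u_def q_def algebra_simps flip: scaleR_2)
  then have "G g q = u" using G_inv[OF g' uB] by simp
  then have ggq: "G g (G g q) = ?x" using G_inv[OF g' xv] by (simp add: u_def)
  have "G (2 * g) q = ?x + (g * g) *\<^sub>R G (2 * g) w"
    using G_inv[OF g2 xv] by (simp add: q_def blinfun.add_right blinfun.scaleR_right)
  then have "G g (G g (G (2 * g) q)) = G g (G g ?x) + (g * g) *\<^sub>R G g (G g (G (2 * g) w))"
    by (simp add: blinfun.add_right blinfun.scaleR_right)
  moreover have "G g (G g (G (2 * g) z)) = G (2 * g) (G g (G g z))" for z
    using G_commute[OF g' g2] by metis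
  ultimately show ?thesis by (simp add: ggq)
qed

text \<open>Telescoping the error of one double step gives \<open>k\<close> terms, each with the
  factor \<open>g * g\<close>, which is \<open>O(g)\<close> as long as \<open>k * g\<close> stays
  bounded. The powers of the two resolvents are kept together, so that each is estimated once by the
  power bound and no constants accumulate.\<close>

lemma G_double_pow:
  fixes y :: 'a
  assumes g: "0 < g" "2 * g \<le> \<delta>"
  defines "w \<equiv> A\<^sub>R (A\<^sub>R y)"
  shows "blinfun_pow (G (2 * g)) k (R (R y)) - blinfun_pow (G g) (2 * k) (R (R y)) =
    (g * g) *\<^sub>R (\<Sum>i<k. blinfun_pow (G (2 * g)) (Suc i) (blinfun_pow (G g) (2 * (k - i)) w))"
proof (induction k)
  case (Suc k)
  have g': "0 < g" "g \<le> \<delta>" and g2: "0 < 2 * g" "2 * g \<le> \<delta>" using g by auto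
  let ?x = "R (R y)" and ?G = "blinfun_pow (G (2 * g))" and ?g = "blinfun_pow (G g)"
  have com: "G g (?G n z) = ?G n (G g z)" for n z
    by (rule blinfun_pow_commute) (rule G_commute[OF g' g2])
  have "2 * Suc k = Suc (Suc (2 * k))" by simp
  then have e1: "?g (2 * Suc k) ?x = G g (G g (?g (2 * k) ?x))"
    by (simp only: blinfun_pow.simps(2) blinfun_apply_blinfun_compose)
  have e2: "G g (G g (?G k ?x)) = ?G k (G g (G g ?x))" by (simp only: com)
  have e3: "?g (2 * (Suc k - k)) w = G g (G g w)" by (simp add: numeral_2_eq_2)
  have "?G (Suc k) ?x - ?g (2 * Suc k) ?x =
      ?G k (G (2 * g) ?x - G g (G g ?x)) + G g (G g (?G k ?x - ?g (2 * k) ?x))"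
    unfolding e1 blinfun_pow_Suc_apply by (simp only: blinfun.diff_right e2) simp
  also have "?G k (G (2 * g) ?x - G g (G g ?x)) = (g * g) *\<^sub>R ?G (Suc k) (?g (2 * (Suc k - k)) w)"
    by (simp only: G_double_step[OF g] w_def[symmetric] e3 blinfun.scaleR_right blinfun_pow_Suc_apply)
  also have "G g (G g (?G k ?x - ?g (2 * k) ?x)) =
      (g * g) *\<^sub>R (\<Sum>i<k. ?G (Suc i) (?g (2 * (Suc k - i)) w))"
  proof -
    have *: "G g (G g (?G (Suc i) (?g (2 * (k - i)) w))) = ?G (Suc i) (?g (2 * (Suc k - i)) w)"
      if "i \<in> {..<k}" for i
    proof -
      have "2 * (Suc k - i) = Suc (Suc (2 * (k - i)))" using that by simp
      then have e4: "?g (2 * (Suc k - i)) w = G g (G g (?g (2 * (k - i)) w))"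
        by (simp only: blinfun_pow.simps(2) blinfun_apply_blinfun_compose)
      show ?thesis unfolding e4 by (simp only: com)
    qed
    have "(\<Sum>i<k. G g (G g (?G (Suc i) (?g (2 * (k - i)) w)))) = (\<Sum>i<k. ?G (Suc i) (?g (2 * (Suc k - i)) w))"
      by (rule sum.cong[OF refl *])
    then show ?thesis unfolding Suc.IH blinfun.scaleR_right blinfun.sum_right by (rule arg_cong)
  qed
  finally show ?case by (simp only: sum.lessThan_Suc scaleR_right_distrib add.commute)
qed simp

end

section \<open>Convergence of dyadic Euler approximations\<close>

lemma nat_floor_double:
  fixes y :: real assumes "y \<ge> 0"
  shows "nat \<lfloor>2 * y\<rfloor> = 2 * nat \<lfloor>y\<rfloor> \<or> nat \<lfloor>2 * y\<rfloor> = Suc (2 * nat \<lfloor>y\<rfloor>)"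
proof -
  have "2 * \<lfloor>y\<rfloor> \<le> \<lfloor>2 * y\<rfloor>" "\<lfloor>2 * y\<rfloor> < 2 * \<lfloor>y\<rfloor> + 2" "0 \<le> \<lfloor>y\<rfloor>"
    using floor_correct[of y] assms by (simp_all add: le_floor_iff floor_less_iff) linarith+
  then show ?thesis by linarith
qed

lemma nat_floor_add:
  fixes y z :: real assumes "y \<ge> 0" "z \<ge> 0"
  shows "nat \<lfloor>y + z\<rfloor> = nat \<lfloor>y\<rfloor> + nat \<lfloor>z\<rfloor> \<or> nat \<lfloor>y + z\<rfloor> = Suc (nat \<lfloor>y\<rfloor> + nat \<lfloor>z\<rfloor>)"
proof -
  have "\<lfloor>y\<rfloor> + \<lfloor>z\<rfloor> \<le> \<lfloor>y + z\<rfloor>" "\<lfloor>y + z\<rfloor> < \<lfloor>y\<rfloor> + \<lfloor>z\<rfloor> + 2" "0 \<le> \<lfloor>y\<rfloor>" "0 \<le> \<lfloor>z\<rfloor>"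
    using floor_correct[of y] floor_correct[of z] assms by (simp_all add: le_floor_iff floor_less_iff) linarith+
  then show ?thesis by linarith
qed

lemma blinfun_compose_id_right: "A o\<^sub>L id_blinfun = A"
  by (rule blinfun_eqI) simp

context resolvent_family begin

text \<open>Steps are halved because \<open>G_double_pow\<close> compares the lengths
  \<open>2 * g\<close> and \<open>g\<close>. On smooth vectors the differences of consecutive levels
  then decay geometrically, which is enough for convergence.\<close>

definition "step j = \<delta> / 2 ^ j"
definition "N j s = nat \<lfloor>s / step j\<rfloor>"
definition "P j s = blinfun_pow (G (step j)) (N j s)"

lemma step: "0 < step j" "step j \<le> \<delta>"
  using pos by (simp_all add: step_def divide_le_eq one_le_power)

lemma step_double: "step j = 2 * step (Suc j)"
  by (simp add: step_def)

lemma step_tendsto: "step \<longlonglongrightarrow> 0"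
  using LIMSEQ_divide_realpow_zero[of 2 \<delta>] by (simp add: step_def[abs_def])

lemma N_bounds:
  assumes "s \<ge> 0"
  shows "real (N j s) * step j \<le> s" "s \<le> real (N j s) * step j + step j"
proof -
  have *: "s / step j \<ge> 0" using assms step(1)[of j] by simp
  have "real (N j s) \<le> s / step j" "s / step j \<le> real (N j s) + 1"
    using floor_correct[of "s / step j"] * by (simp_all add: N_def)
  then show "real (N j s) * step j \<le> s" "s \<le> real (N j s) * step j + step j"
    using step(1)[of j] by (simp_all add: field_simps)
qed

lemma N_Suc: "s \<ge> 0 \<Longrightarrow> N (Suc j) s = 2 * N j s \<or> N (Suc j) s = Suc (2 * N j s)"
  using nat_floor_double[of "s / step j"] step(1)[of j] step_double[of j] by (simp add: N_def)

lemma N_add: "s \<ge> 0 \<Longrightarrow> u \<ge> 0 \<Longrightarrow> N j (s + u) = N j s + N j u \<or> N j (s + u) = Suc (N j s + N j u)"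
  using nat_floor_add[of "s / step j" "u / step j"] step(1)[of j] by (simp add: N_def add_divide_distrib)

lemma norm_P: "s \<ge> 0 \<Longrightarrow> norm (P j s) \<le> K s"
  unfolding P_def by (intro norm_pow_le step N_bounds)

lemma norm_P_apply: "s \<ge> 0 \<Longrightarrow> norm (P j s x) \<le> K s * norm x"
  by (rule norm_blinfun_le[OF norm_P])

text \<open>Level \<open>Suc j\<close> makes twice as many steps as level \<open>j\<close>, or one
  more. The first summand of the bound is the error of the double steps, the second pays for the
  possible extra step.\<close>

lemma norm_P_diff:
  fixes y :: 'a
  assumes s: "s \<ge> 0"
  defines "x \<equiv> R (R y)" and "v \<equiv> R (A\<^sub>R y)" and "w \<equiv> A\<^sub>R (A\<^sub>R y)"
  shows "norm (P (Suc j) s x - P j s x) \<le> (s * (K s * K s) * norm w + K s * norm v) * step (Suc j)"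
proof -
  define g k where "g = step (Suc j)" and "k = N j s"
  have g: "0 < g" "2 * g \<le> \<delta>" and sj: "step j = 2 * g"
    using step(1)[of "Suc j"] step(2)[of j] step_double[of j] by (auto simp: g_def)
  have g': "g \<le> \<delta>" using g by simp
  have kg: "real k * (2 * g) \<le> s" using N_bounds(1)[OF s, of j] by (simp add: k_def sj)
  have "0 \<le> real k * g" using g by simp
  with kg have kg': "real k * g \<le> s" by linarith
  have K1: "K s \<ge> 1" by (rule K_ge_1[OF s])
  have 1: "norm (blinfun_pow (G (2 * g)) k x - blinfun_pow (G g) (2 * k) x) \<le> s * (K s * K s) * norm w * g"
  proof -
    have "norm (\<Sum>i<k. blinfun_pow (G (2 * g)) (Suc i) (blinfun_pow (G g) (2 * (k - i)) w))
        \<le> (\<Sum>i<k. K s * (K s * norm w))"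
    proof (rule sum_norm_le)
      fix i assume i: "i \<in> {..<k}"
      have "real (Suc i) * (2 * g) \<le> real k * (2 * g)"
        using i g by (intro mult_right_mono) auto
      then have "real (Suc i) * (2 * g) \<le> s" using kg by (rule order_trans)
      then have a: "norm (blinfun_pow (G (2 * g)) (Suc i) z) \<le> K s * norm z" for z
        using g by (intro norm_pow_apply_le) simp_all
      have "real (2 * (k - i)) * g \<le> real k * (2 * g)"
        using g by (simp add: of_nat_diff)
      then have "real (2 * (k - i)) * g \<le> s" using kg by (rule order_trans)
      then have "norm (blinfun_pow (G g) (2 * (k - i)) w) \<le> K s * norm w"
        by (rule norm_pow_apply_le[OF g(1) g'])
      then have "K s * norm (blinfun_pow (G g) (2 * (k - i)) w) \<le> K s * (K s * norm w)"
        using K1 by (intro mult_left_mono) auto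
      with a[of "blinfun_pow (G g) (2 * (k - i)) w"]
      show "norm (blinfun_pow (G (2 * g)) (Suc i) (blinfun_pow (G g) (2 * (k - i)) w)) \<le> K s * (K s * norm w)"
        by linarith
    qed
    then have "norm (blinfun_pow (G (2 * g)) k x - blinfun_pow (G g) (2 * k) x)
        \<le> (g * g) * (real k * (K s * (K s * norm w)))"
      unfolding x_def w_def G_double_pow[OF g] norm_scaleR using g by (simp add: mult_left_mono)
    also have "\<dots> = (real k * g) * (K s * (K s * norm w) * g)" by simp
    also have "\<dots> \<le> s * (K s * (K s * norm w) * g)"
      using kg' g K1 by (intro mult_right_mono) auto
    finally show ?thesis by (simp add: mult_ac)
  qed
  have 2: "norm (blinfun_pow (G g) (Suc (2 * k)) x - blinfun_pow (G g) (2 * k) x) \<le> K s * norm v * g"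
    if "N (Suc j) s = Suc (2 * k)"
  proof -
    have xv: "(x, v) \<in> B" using R_in[of "R y"] by (simp add: A\<^sub>R_R x_def v_def)
    have "blinfun_pow (G g) (Suc (2 * k)) x - blinfun_pow (G g) (2 * k) x = blinfun_pow (G g) (2 * k) (G g x - x)"
      by (simp only: blinfun_pow_Suc_apply blinfun.diff_right)
    also have "\<dots> = g *\<^sub>R blinfun_pow (G g) (Suc (2 * k)) v"
      unfolding G_step[OF g(1) g' xv] by (simp only: blinfun.scaleR_right blinfun_pow_Suc_apply)
    also have "norm \<dots> = norm (blinfun_pow (G g) (Suc (2 * k)) v) * g"
      unfolding norm_scaleR using g by (simp only: abs_of_pos mult.commute)
    also have "\<dots> \<le> (K s * norm v) * g"
    proof (intro mult_right_mono norm_pow_apply_le)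
      show "real (Suc (2 * k)) * g \<le> s" using N_bounds(1)[OF s, of "Suc j"] unfolding that g_def .
    qed (use g g' in auto)
    finally show ?thesis .
  qed
  have P: "P j s x = blinfun_pow (G (2 * g)) k x" by (simp only: P_def sj k_def)
  have PS: "P (Suc j) s x = blinfun_pow (G g) (N (Suc j) s) x" by (simp only: P_def g_def)
  from N_Suc[OF s, of j] show ?thesis
  proof
    assume N: "N (Suc j) s = 2 * N j s"
    have "0 \<le> K s * norm v * g" using K1 g by simp
    with 1 show ?thesis
      unfolding P PS N k_def[symmetric] g_def[symmetric] by (simp add: norm_minus_commute distrib_right)
  next
    assume N: "N (Suc j) s = Suc (2 * N j s)"
    let ?a = "blinfun_pow (G g) (Suc (2 * k)) x" and ?b = "blinfun_pow (G g) (2 * k) x"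
      and ?c = "blinfun_pow (G (2 * g)) k x"
    have "norm (?a - ?c) \<le> norm (?a - ?b) + norm (?c - ?b)"
      using norm_triangle_ineq4[of "?a - ?b" "?c - ?b"] by simp
    with 1 2[OF N[folded k_def]] show ?thesis
      unfolding P PS N k_def[symmetric] g_def[symmetric] by (simp only: distrib_right)
  qed
qed

lemma P_convergent:
  assumes s: "s \<ge> 0"
  shows "\<exists>L. (\<forall>x. (\<lambda>j. P j s x) \<longlonglongrightarrow> blinfun_apply L x) \<and> norm L \<le> K s"
proof -
  have conv: "convergent (\<lambda>j. P j s x)" if xr: "x \<in> range (\<lambda>y. R (R y))" for x
  proof -
    obtain y where y: "x = R (R y)" using xr by auto
    let ?c = "s * (K s * K s) * norm (A\<^sub>R (A\<^sub>R y)) + K s * norm (R (A\<^sub>R y))"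
    show ?thesis
    proof (rule convergent_geometric_steps)
      show "norm (P (Suc j) s x - P j s x) \<le> (?c * \<delta> / 2) * (1 / 2) ^ j" for j
        using norm_P_diff[OF s, of j y] by (simp add: y step_def power_divide)
    qed
  qed
  have ev: "eventually (\<lambda>j. norm (P j s) \<le> K s) sequentially" by (simp add: norm_P[OF s])
  show ?thesis
  proof (rule strong_limit_exists[OF ev dense_range_RR conv])
    fix L assume "\<And>x. (\<lambda>j. P j s x) \<longlonglongrightarrow> blinfun_apply L x" "norm L \<le> K s"
    then show ?thesis by auto
  qed
qed

section \<open>The limit semigroup and its generator\<close>

definition "T s = (SOME L. (\<forall>x. (\<lambda>j. P j s x) \<longlonglongrightarrow> blinfun_apply L x) \<and> norm L \<le> K s)"

lemma T_limit: "s \<ge> 0 \<Longrightarrow> (\<lambda>j. P j s x) \<longlonglongrightarrow> T s x"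
  and norm_T: "s \<ge> 0 \<Longrightarrow> norm (T s) \<le> K s"
  using someI_ex[OF P_convergent[of s]] unfolding T_def by auto

lemma T_smul:
  assumes s: "s \<ge> 0" shows "T s (smul c x) = smul c (T s x)"
proof -
  have "blinfun_pow (G (step j)) n (smul c x) = smul c (blinfun_pow (G (step j)) n x)" for j n
    by (induction n) (simp_all add: G_smul step)
  then have P: "P j s (smul c x) = smul c (P j s x)" for j
    unfolding P_def .
  have "(\<lambda>j. P j s (smul c x)) \<longlonglongrightarrow> smul c (T s x)"
    unfolding P by (rule tendsto_smul[OF T_limit[OF s]])
  from LIMSEQ_unique[OF T_limit[OF s] this] show ?thesis .
qed

lemma G_step_tendsto: "(\<lambda>j. G (step j) x) \<longlonglongrightarrow> x"
proof -
  have "(\<lambda>j. G (step j) x) \<longlonglongrightarrow> id_blinfun x"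
  proof (rule strong_limit_dense[OF _ dense, of _ "K \<delta>"])
    show "eventually (\<lambda>j. norm (G (step j)) \<le> K \<delta>) sequentially"
      using norm_pow_le[of "step _" 1 \<delta>] step by (simp add: blinfun_compose_id_right)
    fix x assume "x \<in> Domain B"
    then obtain z where z: "(x, z) \<in> B" by auto
    have "(\<lambda>j. G (step j) x - x) \<longlonglongrightarrow> 0"
    proof (rule Lim_null_comparison)
      show "eventually (\<lambda>j. norm (G (step j) x - x) \<le> step j * (K \<delta> * norm z)) sequentially"
      proof (rule always_eventually, rule allI)
        fix j
        have "norm (G (step j) z) \<le> K \<delta> * norm z"
          using norm_pow_apply_le[of "step j" 1 \<delta> z] step by simp
        then show "norm (G (step j) x - x) \<le> step j * (K \<delta> * norm z)"
          unfolding G_step[OF step(1,2) z] norm_scaleR using step(1)[of j] by (simp add: mult_left_mono)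
      qed
      show "(\<lambda>j. step j * (K \<delta> * norm z)) \<longlonglongrightarrow> 0"
        by (rule tendsto_mult_left_zero[OF step_tendsto])
    qed
    then show "(\<lambda>j. G (step j) x) \<longlonglongrightarrow> id_blinfun x" by (simp add: LIM_zero_iff)
  qed
  then show ?thesis by simp
qed

text \<open>The numbers of steps for \<open>s\<close> and \<open>u\<close> add up to that for
  \<open>s + u\<close>, except for at most one step, and a single step tends strongly to the
  identity.\<close>

lemma T_add:
  assumes s: "s \<ge> 0" and u: "u \<ge> 0"
  shows "T (s + u) x = T s (T u x)"
proof -
  have 1: "(\<lambda>j. P j s (P j u x)) \<longlonglongrightarrow> T s (T u x)"
    by (rule strong_tendsto_apply[where C = "K s", OF _ T_limit[OF s] T_limit[OF u]]) (simp add: norm_P[OF s])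
  have "(\<lambda>j. P j (s + u) x - P j s (P j u x)) \<longlonglongrightarrow> 0"
  proof (rule Lim_null_comparison)
    show "(\<lambda>j. K (s + u) * norm (G (step j) x - x)) \<longlonglongrightarrow> 0"
      using G_step_tendsto[of x] by (intro tendsto_mult_right_zero tendsto_norm_zero) (simp add: LIM_zero_iff)
    show "eventually (\<lambda>j. norm (P j (s + u) x - P j s (P j u x)) \<le> K (s + u) * norm (G (step j) x - x)) sequentially"
    proof (rule always_eventually, rule allI)
      fix j
      let ?g = "blinfun_pow (G (step j))"
      have PP: "P j s (P j u x) = ?g (N j s + N j u) x"
        by (simp only: P_def blinfun_pow_add_apply)
      from N_add[OF s u, of j] show "norm (P j (s + u) x - P j s (P j u x)) \<le> K (s + u) * norm (G (step j) x - x)"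
      proof
        assume N: "N j (s + u) = N j s + N j u"
        show ?thesis unfolding PP P_def[of j "s + u"] N using K_ge_1[of "s + u"] s u by simp
      next
        assume N: "N j (s + u) = Suc (N j s + N j u)"
        have "P j (s + u) x - P j s (P j u x) = ?g (N j s + N j u) (G (step j) x - x)"
          unfolding PP P_def[of j "s + u"] N by (simp only: blinfun_pow_Suc_apply blinfun.diff_right)
        moreover have "real (N j s + N j u) * step j \<le> s + u"
          using N_bounds(1)[OF s, of j] N_bounds(1)[OF u, of j] by (simp add: distrib_right)
        ultimately show ?thesis by (simp add: norm_pow_apply_le step)
      qed
    qed
  qed
  from tendsto_add[OF this 1] have "(\<lambda>j. P j (s + u) x) \<longlonglongrightarrow> T s (T u x)" by simp
  with T_limit[of "s + u" x] s u show ?thesis by (intro LIMSEQ_unique) auto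
qed

lemma T_zero: "T 0 = id_blinfun"
proof (rule blinfun_eqI)
  fix x
  have "(\<lambda>j. P j 0 x) \<longlonglongrightarrow> id_blinfun x" by (simp add: P_def N_def)
  from LIMSEQ_unique[OF T_limit this] show "T 0 x = id_blinfun x" by simp
qed

lemma norm_T_diff:
  assumes s: "s \<ge> 0" and yz: "(y, z) \<in> B"
  shows "norm (T s x - x) \<le> (K s + 1) * norm (x - y) + s * K s * norm z"
proof (rule LIMSEQ_le_const2)
  show "(\<lambda>j. norm (P j s x - x)) \<longlonglongrightarrow> norm (T s x - x)" by (intro tendsto_intros T_limit s)
  show "\<exists>n0. \<forall>j\<ge>n0. norm (P j s x - x) \<le> (K s + 1) * norm (x - y) + s * K s * norm z"
    unfolding P_def by (intro exI allI impI norm_pow_diff_le[OF step(1,2) N_bounds(1)[OF s] yz])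
qed

text \<open>Telescoping writes the increment of the Euler approximation as a sum of steps along the
  discrete orbit of \<open>z\<close>. Its distance from the same multiple of \<open>z\<close> is
  governed by how far that orbit moves, which is \<open>norm_pow_diff_le\<close> at
  \<open>z\<close>, split at \<open>y\<close>.\<close>

lemma norm_T_derivative:
  assumes s: "s \<ge> 0" and xz: "(x, z) \<in> B" and yw: "(y, w) \<in> B"
  shows "norm (T s x - x - s *\<^sub>R z) \<le> s * ((K s + 1) * norm (z - y) + s * K s * norm w)"
proof (rule LIMSEQ_le_const2)
  let ?c = "(K s + 1) * norm (z - y) + s * K s * norm w"
  have "(\<lambda>j. s - real (N j s) * step j) \<longlonglongrightarrow> 0"
  proof (rule Lim_null_comparison[OF _ step_tendsto], rule always_eventually, rule allI)
    fix j show "norm (s - real (N j s) * step j) \<le> step j" using N_bounds[OF s, of j] by simp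
  qed
  then have "(\<lambda>j. s - (s - real (N j s) * step j)) \<longlonglongrightarrow> s - 0" by (intro tendsto_intros)
  then have lim: "(\<lambda>j. real (N j s) * step j) \<longlonglongrightarrow> s" by simp
  show "(\<lambda>j. norm (P j s x - x - (real (N j s) * step j) *\<^sub>R z)) \<longlonglongrightarrow> norm (T s x - x - s *\<^sub>R z)"
    by (intro tendsto_intros T_limit s lim)
  have "norm (P j s x - x - (real (N j s) * step j) *\<^sub>R z) \<le> s * ?c" for j
  proof -
    let ?g = "blinfun_pow (G (step j))" and ?n = "N j s"
    have "P j s x - x = (\<Sum>i<?n. step j *\<^sub>R ?g (Suc i) z)"
      unfolding P_def blinfun_pow_diff_telescope G_step[OF step(1,2) xz] blinfun.scaleR_right blinfun_pow_Suc_apply ..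
    moreover have "(real ?n * step j) *\<^sub>R z = (\<Sum>i<?n. step j *\<^sub>R z)" by (simp add: sum_constant_scaleR)
    ultimately have "P j s x - x - (real ?n * step j) *\<^sub>R z = (\<Sum>i<?n. step j *\<^sub>R (?g (Suc i) z - z))"
      by (simp only: sum_subtractf scaleR_right_diff_distrib)
    also have "norm \<dots> \<le> (\<Sum>i<?n. step j * ?c)"
    proof (rule sum_norm_le)
      fix i assume "i \<in> {..<?n}"
      then have "real (Suc i) * step j \<le> real ?n * step j"
        using step(1)[of j] by (intro mult_right_mono) auto
      then have "real (Suc i) * step j \<le> s" using N_bounds(1)[OF s, of j] by (rule order_trans)
      then have "norm (?g (Suc i) z - z) \<le> ?c" by (rule norm_pow_diff_le[OF step(1,2) _ yw])
      then show "norm (step j *\<^sub>R (?g (Suc i) z - z)) \<le> step j * ?c"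
        unfolding norm_scaleR using step(1)[of j] by (simp only: abs_of_pos mult_left_mono less_imp_le)
    qed
    also have "\<dots> = (real ?n * step j) * ?c" by simp
    also have "\<dots> \<le> s * ?c"
      using N_bounds(1)[OF s, of j] K_ge_1[OF s] s by (intro mult_right_mono) auto
    finally show ?thesis .
  qed
  then show "\<exists>n0. \<forall>j\<ge>n0. norm (P j s x - x - (real (N j s) * step j) *\<^sub>R z) \<le> s * ?c" by blast
qed

lemma eventually_at_right_small:
  "eventually (\<lambda>s. 0 < s \<and> s \<le> 1 \<and> (K s + 1) * a + s * K s * c \<le> (K 1 + 1) * a + s * (K 1 * c)) (at_right 0)"
  if "a \<ge> 0" "c \<ge> 0" for a c :: real
proof -
  have "eventually (\<lambda>s::real. s \<in> {0<..<1}) (at_right 0)" by (rule eventually_at_right_real) simp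
  then show ?thesis
  proof eventually_elim
    case (elim s)
    then have "K s \<le> K 1" by (intro K_mono) simp
    then have 1: "(K s + 1) * a \<le> (K 1 + 1) * a" and 2: "s * (K s * c) \<le> s * (K 1 * c)"
      using that elim by (auto intro!: mult_right_mono mult_left_mono)
    have "(K s + 1) * a + s * K s * c \<le> (K 1 + 1) * a + s * (K 1 * c)"
      using add_mono[OF 1 2] by (simp only: mult.assoc)
    with elim show ?case by auto
  qed
qed

text \<open>The common shape of the two limits at \<open>0\<close>: the first term is made small by density of
  the domain, the second by the choice of \<open>s\<close>.\<close>

lemma tendsto_at_right_0I:
  fixes f :: "real \<Rightarrow> 'a"
  assumes "\<And>y w s. (y, w) \<in> B \<Longrightarrow> 0 < s \<Longrightarrow> norm (f s - l) \<le> (K s + 1) * norm (z - y) + s * K s * norm w"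
  shows "(f \<longlongrightarrow> l) (at_right 0)"
proof (rule tendstoI)
  fix e :: real assume e: "e > 0"
  have K1: "K 1 + 1 > 0" using K_ge_1[of 1] by simp
  have "z \<in> closure (Domain B)" using dense by simp
  then obtain y where y: "y \<in> Domain B" "dist y z < e / (2 * (K 1 + 1))"
    using e K1 by (metis closure_approachable divide_pos_pos mult_pos_pos zero_less_numeral)
  then obtain w where yw: "(y, w) \<in> B" by auto
  have a: "(K 1 + 1) * norm (z - y) < e / 2"
    using y(2) K1 by (simp add: dist_norm norm_minus_commute field_simps)
  have "((\<lambda>s. s * (K 1 * norm w)) \<longlongrightarrow> 0 * (K 1 * norm w)) (at_right 0)"
    by (intro tendsto_intros)
  then have "eventually (\<lambda>s. s * (K 1 * norm w) < e / 2) (at_right 0)"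
    using e by (intro order_tendstoD(2)) auto
  with eventually_at_right_small[OF norm_ge_zero[of "z - y"] norm_ge_zero[of w]]
  show "eventually (\<lambda>s. dist (f s) l < e) (at_right 0)"
  proof eventually_elim
    case (elim s)
    with assms[OF yw, of s] a show "dist (f s) l < e" by (simp add: dist_norm)
  qed
qed

lemma T_strongly_continuous: "((\<lambda>s. T s x) \<longlongrightarrow> x) (at_right 0)"
  by (rule tendsto_at_right_0I[where z = x]) (simp add: norm_T_diff)

lemma T_derivative:
  assumes "(x, z) \<in> B"
  shows "((\<lambda>s. inverse s *\<^sub>R (T s x - T 0 x)) \<longlongrightarrow> z) (at_right 0)"
proof (rule tendsto_at_right_0I[where z = z])
  fix y w s assume yw: "(y, w) \<in> B" and s: "(0::real) < s"
  have "inverse s *\<^sub>R (T s x - T 0 x) - z = inverse s *\<^sub>R (T s x - x - s *\<^sub>R z)"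
    using s by (simp add: T_zero scaleR_right_diff_distrib)
  then have "norm (inverse s *\<^sub>R (T s x - T 0 x) - z) = inverse s * norm (T s x - x - s *\<^sub>R z)"
    using s by simp
  also have "\<dots> \<le> inverse s * (s * ((K s + 1) * norm (z - y) + s * K s * norm w))"
    using s by (intro mult_left_mono norm_T_derivative assms yw) auto
  also have "\<dots> = (K s + 1) * norm (z - y) + s * K s * norm w" using s by simp
  finally show "norm (inverse s *\<^sub>R (T s x - T 0 x) - z) \<le> (K s + 1) * norm (z - y) + s * K s * norm w" .
qed

lemma T_R:
  assumes s: "s \<ge> 0" shows "T s (R x) = R (T s x)"
proof -
  have "P j s (R x) = R (P j s x)" for j
    unfolding P_def by (rule blinfun_pow_commute[symmetric]) (use G_commute step pos in \<open>simp add: R_def\<close>)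
  then have "(\<lambda>j. P j s (R x)) \<longlonglongrightarrow> R (T s x)"
    using blinfun.tendsto[OF tendsto_const T_limit[OF s]] by simp
  from LIMSEQ_unique[OF T_limit[OF s] this] show ?thesis .
qed

text \<open>The semigroup differentiates every element of \<open>B\<close> correctly. For the other
  inclusion let \<open>z\<close> be the derivative at \<open>x\<close>. Since \<open>T\<close>
  commutes with \<open>R\<close>, the derivative at \<open>R x\<close> is both
  \<open>A\<^sub>R x\<close> and \<open>R z\<close>; their equality says
  \<open>x = R (x - \<delta> z)\<close>, and a value of \<open>R\<close> paired with its image lies
  in \<open>B\<close>.\<close>

lemma generated: "op_deriv0 T = B"
proof
  show "B \<subseteq> op_deriv0 T" using T_derivative by (auto simp: strong_deriv0_def)
  show "op_deriv0 T \<subseteq> B"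
  proof (rule subrelI)
    fix x z assume "(x, z) \<in> op_deriv0 T"
    then have "((\<lambda>s. inverse s *\<^sub>R (T s x - T 0 x)) \<longlongrightarrow> z) (at_right 0)"
      by (simp add: strong_deriv0_def)
    then have "((\<lambda>s. R (inverse s *\<^sub>R (T s x - T 0 x))) \<longlongrightarrow> R z) (at_right 0)"
      by (intro blinfun.tendsto tendsto_const)
    moreover have "eventually (\<lambda>s. R (inverse s *\<^sub>R (T s x - T 0 x)) = inverse s *\<^sub>R (T s (R x) - T 0 (R x))) (at_right 0)"
      using eventually_at_right_real[of 0 "1::real", OF zero_less_one]
      by eventually_elim (simp add: blinfun.scaleR_right blinfun.diff_right T_R)
    ultimately have "((\<lambda>s. inverse s *\<^sub>R (T s (R x) - T 0 (R x))) \<longlongrightarrow> R z) (at_right 0)"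
      by (rule Lim_transform_eventually)
    from tendsto_unique[OF trivial_limit_at_right_real T_derivative[OF R_in[of x]] this]
    have "A\<^sub>R x = R z" .
    then have "\<delta> *\<^sub>R A\<^sub>R x = \<delta> *\<^sub>R R z" by simp
    then have "R x - x = \<delta> *\<^sub>R R z" unfolding A\<^sub>R_apply using pos by simp
    then have x: "x = R (x - \<delta> *\<^sub>R z)" by (simp add: blinfun.diff_right blinfun.scaleR_right algebra_simps)
    have "A\<^sub>R (x - \<delta> *\<^sub>R z) = z" unfolding A\<^sub>R_apply x[symmetric] using pos by simp
    with R_in[of "x - \<delta> *\<^sub>R z"] x show "(x, z) \<in> B" by simp
  qed
qed

lemma generates_T: "generates smul B T"
  unfolding generates_def C0_semigroup_def
  by (auto simp: generated T_zero T_strongly_continuous T_smul T_add bounded_operators_def intro!: blinfun_eqI)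

end

section \<open>Resolvents of the difference quotients\<close>

lemma exp_le_one_plus_double: "0 \<le> x \<Longrightarrow> x \<le> 1 \<Longrightarrow> exp (x::real) \<le> 1 + 2 * x"
proof -
  assume x: "0 \<le> x" "x \<le> 1"
  then have "x\<^sup>2 \<le> x" by (simp add: power2_eq_square mult_left_le)
  with exp_bound[OF x] show ?thesis by simp
qed

lemma inverse_one_minus_le_exp:
  fixes x :: real assumes "0 \<le> x" "x \<le> 1 / 2"
  shows "1 / (1 - x) \<le> exp (2 * x)"
proof -
  have "1 \<le> (1 + 2 * x) * (1 - x)"
    using mult_left_mono[OF assms(2) assms(1)] by (simp add: algebra_simps)
  also have "\<dots> \<le> exp (2 * x) * (1 - x)"
    using exp_ge_add_one_self[of "2 * x"] assms by (intro mult_right_mono) auto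
  finally show ?thesis using assms by (simp add: divide_le_eq)
qed

lemma strong_pow_tendsto:
  fixes J :: "nat \<Rightarrow> 'a::real_normed_vector \<Rightarrow>\<^sub>L 'a"
  assumes J: "\<And>x. (\<lambda>n. J n x) \<longlonglongrightarrow> blinfun_apply G x"
    and bd: "eventually (\<lambda>n. norm (J n) \<le> C) sequentially"
  shows "(\<lambda>n. blinfun_pow (J n) m x) \<longlonglongrightarrow> blinfun_pow G m x"
proof (induction m)
  case (Suc m)
  show ?case using strong_tendsto_apply[OF bd J Suc.IH] by simp
qed simp

locale chernoff_family = banach_space_over smul
  for smul :: "'k::real_or_complex \<Rightarrow> 'a::banach \<Rightarrow> 'a" +
  fixes Z :: "('a \<times> 'a) set" and F :: "real \<Rightarrow> 'a \<Rightarrow>\<^sub>L 'a" and M \<omega> :: real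
  assumes Z_add: "(x, z) \<in> Z \<Longrightarrow> (x', z') \<in> Z \<Longrightarrow> (x + x', z + z') \<in> Z"
    and Z_smul: "(x, z) \<in> Z \<Longrightarrow> (smul c x, smul c z) \<in> Z"
    and dense_Z: "closure (Domain Z) = UNIV"
    and M: "M \<ge> 1" and \<omega>: "\<omega> \<ge> 1"
    and F_pow: "h \<ge> 0 \<Longrightarrow> norm (blinfun_pow (F h) m) \<le> M * exp (\<omega> * (real m * h))"
    and F_deriv: "(x, z) \<in> Z \<Longrightarrow> ((\<lambda>h. inverse h *\<^sub>R (F h x - x)) \<longlongrightarrow> z) (at_right 0)"
begin

text \<open>The bound on the step has two purposes. It keeps
  \<open>h * ((exp (\<omega> * \<epsilon>) - 1) / \<epsilon>)\<close> at most 1/2, so that the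
  Neumann series of \<open>J\<close> converges with growth \<open>\<rho>\<close> at most 2. It also
  makes the weights in \<open>discount_factor\<close> decay faster than the powers of
  \<open>F\<close> grow.\<close>

definition "\<delta> = 1 / (4 * \<omega>)"

definition A :: "real \<Rightarrow> 'a \<Rightarrow> 'a" where "A \<epsilon> x = (1 / \<epsilon>) *\<^sub>R (F \<epsilon> x - x)"

text \<open>\<open>J \<epsilon> h\<close> is the Neumann series of \<open>(1 - h A \<epsilon>)\<^bsup>-1\<^esup> = ((1 + c) - c F \<epsilon>)\<^bsup>-1\<^esup>\<close>
  with \<open>c = h / \<epsilon>\<close>.\<close>

definition \<theta> :: "real \<Rightarrow> real \<Rightarrow> real" where "\<theta> \<epsilon> h = (h / \<epsilon>) / (1 + h / \<epsilon>)"
text \<open>This is the value of the series of \<open>J\<close> with the powers of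
  \<open>F \<epsilon>\<close> replaced by the scalars
  \<open>exp (\<omega> * \<epsilon>) ^ k\<close>: the resolvent of the scalar growth rate
  \<open>(exp (\<omega> * \<epsilon>) - 1) / \<epsilon>\<close>.\<close>

definition \<rho> :: "real \<Rightarrow> real \<Rightarrow> real" where "\<rho> \<epsilon> h = 1 / (1 - h * ((exp (\<omega> * \<epsilon>) - 1) / \<epsilon>))"
definition J :: "real \<Rightarrow> real \<Rightarrow> 'a \<Rightarrow>\<^sub>L 'a" where
  "J \<epsilon> h = (1 / (1 + h / \<epsilon>)) *\<^sub>R (\<Sum>k. \<theta> \<epsilon> h ^ k *\<^sub>R blinfun_pow (F \<epsilon>) k)"

lemma \<delta>_pos: "\<delta> > 0" using \<omega> by (simp add: \<delta>_def)

lemma norm_F_pow_le: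
  assumes "h \<ge> 0" "real m * h \<le> u"
  shows "norm (blinfun_pow (F h) m) \<le> M * exp (\<omega> * u)"
proof -
  have "M * exp (\<omega> * (real m * h)) \<le> M * exp (\<omega> * u)"
    using M \<omega> assms(2) by (intro mult_left_mono) (auto intro: mult_left_mono)
  with F_pow[OF assms(1), of m] show ?thesis by linarith
qed

lemma F_pow_apply:
  assumes "h \<ge> 0" shows "norm (blinfun_pow (F h) m x) \<le> M * exp (\<omega> * h) ^ m * norm x"
proof -
  have "exp (\<omega> * (real m * h)) = exp (\<omega> * h) ^ m"
    by (simp add: exp_of_nat_mult[symmetric] mult_ac)
  then show ?thesis using norm_blinfun_le[OF F_pow[OF assms, of m], of x] by simp
qed

context
  fixes \<epsilon> h :: real
  assumes \<epsilon>: "0 < \<epsilon>" "\<epsilon> \<le> 1 / \<omega>" and h: "0 < h" "h \<le> \<delta>"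
begin

lemma growth_le: "h * ((exp (\<omega> * \<epsilon>) - 1) / \<epsilon>) \<le> 2 * \<omega> * h" "2 * \<omega> * h \<le> 1 / 2"
  "0 \<le> h * ((exp (\<omega> * \<epsilon>) - 1) / \<epsilon>)"
proof -
  have "exp (\<omega> * \<epsilon>) - 1 \<le> 2 * \<omega> * \<epsilon>"
    using exp_le_one_plus_double[of "\<omega> * \<epsilon>"] \<epsilon> \<omega> by (simp add: field_simps)
  then have "(exp (\<omega> * \<epsilon>) - 1) / \<epsilon> \<le> 2 * \<omega>" using \<epsilon> by (simp add: divide_le_eq)
  from mult_left_mono[OF this, of h] h show "h * ((exp (\<omega> * \<epsilon>) - 1) / \<epsilon>) \<le> 2 * \<omega> * h"
    by (simp add: mult_ac)
  show "2 * \<omega> * h \<le> 1 / 2" using h(2) \<omega> by (simp add: \<delta>_def field_simps)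
  show "0 \<le> h * ((exp (\<omega> * \<epsilon>) - 1) / \<epsilon>)" using \<epsilon> \<omega> h by simp
qed

lemma \<rho>_bounds: "0 < \<rho> \<epsilon> h" "\<rho> \<epsilon> h \<le> exp (4 * \<omega> * h)" "\<rho> \<epsilon> h \<le> 2"
proof -
  let ?g = "h * ((exp (\<omega> * \<epsilon>) - 1) / \<epsilon>)"
  have g: "0 \<le> ?g" "?g \<le> 2 * \<omega> * h" "2 * \<omega> * h \<le> 1 / 2" using growth_le by auto
  then show "0 < \<rho> \<epsilon> h" unfolding \<rho>_def by (intro divide_pos_pos) linarith+
  have "\<rho> \<epsilon> h \<le> exp (2 * ?g)" unfolding \<rho>_def using g by (intro inverse_one_minus_le_exp) linarith+
  also have "\<dots> \<le> exp (4 * \<omega> * h)" using g by simp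
  finally show "\<rho> \<epsilon> h \<le> exp (4 * \<omega> * h)" .
  have "1 / 2 \<le> 1 - ?g" using g by linarith
  then have "1 / (1 - ?g) \<le> 1 / (1 / 2)" by (intro divide_left_mono mult_pos_pos) linarith+
  then show "\<rho> \<epsilon> h \<le> 2" unfolding \<rho>_def by simp
qed

lemma \<theta>_bounds: "0 \<le> \<theta> \<epsilon> h" "0 \<le> \<theta> \<epsilon> h * exp (\<omega> * \<epsilon>)" "\<theta> \<epsilon> h * exp (\<omega> * \<epsilon>) < 1"
  "(1 / (1 + h / \<epsilon>)) * (1 / (1 - \<theta> \<epsilon> h * exp (\<omega> * \<epsilon>))) = \<rho> \<epsilon> h"
proof -
  let ?c = "h / \<epsilon>" and ?e = "exp (\<omega> * \<epsilon>)"
  have c: "0 < ?c" using \<epsilon> h by simp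
  show "0 \<le> \<theta> \<epsilon> h" unfolding \<theta>_def using c \<epsilon> h by (intro divide_nonneg_nonneg) linarith+
  then show "0 \<le> \<theta> \<epsilon> h * ?e" by simp
  have eq: "(1 + ?c) * (1 - \<theta> \<epsilon> h * ?e) = 1 - h * ((?e - 1) / \<epsilon>)"
    unfolding \<theta>_def using c \<epsilon> by (simp add: right_diff_distrib) (simp add: field_simps)
  then have "(1 + ?c) * (1 - \<theta> \<epsilon> h * ?e) > 0" using growth_le by linarith
  then show "\<theta> \<epsilon> h * ?e < 1" using c by (simp add: zero_less_mult_iff)
  show "(1 / (1 + ?c)) * (1 / (1 - \<theta> \<epsilon> h * ?e)) = \<rho> \<epsilon> h"
    unfolding \<rho>_def eq[symmetric] by simp
qed

lemma J_summable: "summable (\<lambda>k. \<theta> \<epsilon> h ^ k *\<^sub>R blinfun_pow (F \<epsilon>) k)"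
proof (rule summable_comparison_test')
  let ?q = "\<theta> \<epsilon> h * exp (\<omega> * \<epsilon>)"
  show "summable (\<lambda>k. M * ?q ^ k)" using \<theta>_bounds by (intro summable_mult summable_geometric) simp
  fix k :: nat
  have "exp (\<omega> * (real k * \<epsilon>)) = exp (\<omega> * \<epsilon>) ^ k"
    by (simp add: exp_of_nat_mult[symmetric] mult_ac)
  then have "norm (blinfun_pow (F \<epsilon>) k) \<le> M * exp (\<omega> * \<epsilon>) ^ k" using F_pow[of \<epsilon> k] \<epsilon> by simp
  then have "\<theta> \<epsilon> h ^ k * norm (blinfun_pow (F \<epsilon>) k) \<le> \<theta> \<epsilon> h ^ k * (M * exp (\<omega> * \<epsilon>) ^ k)"
    using \<theta>_bounds by (intro mult_left_mono) auto
  then show "norm (\<theta> \<epsilon> h ^ k *\<^sub>R blinfun_pow (F \<epsilon>) k) \<le> M * ?q ^ k"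
    using \<theta>_bounds by (simp add: power_mult_distrib mult_ac)
qed

lemma J_sums: "(\<lambda>k. \<theta> \<epsilon> h ^ k *\<^sub>R blinfun_pow (F \<epsilon>) k x) sums ((1 + h / \<epsilon>) *\<^sub>R J \<epsilon> h x)"
proof -
  have "1 + h / \<epsilon> > 0" using \<epsilon> h by (simp add: add_pos_pos)
  then have "(1 + h / \<epsilon>) *\<^sub>R J \<epsilon> h = (\<Sum>k. \<theta> \<epsilon> h ^ k *\<^sub>R blinfun_pow (F \<epsilon>) k)"
    by (simp add: J_def)
  then have "(\<lambda>k. blinfun_apply (\<theta> \<epsilon> h ^ k *\<^sub>R blinfun_pow (F \<epsilon>) k) x) sums ((1 + h / \<epsilon>) *\<^sub>R J \<epsilon> h) x"
    using bounded_linear.sums[OF blinfun.bounded_linear_left summable_sums[OF J_summable]] by simp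
  then show ?thesis by (simp only: blinfun.scaleR_left)
qed

lemma J_F: "F \<epsilon> (J \<epsilon> h x) = J \<epsilon> h (F \<epsilon> x)"
proof -
  let ?c = "1 + h / \<epsilon>"
  have c: "?c > 0" using \<epsilon> h by (simp add: add_pos_pos)
  have "(\<lambda>k. \<theta> \<epsilon> h ^ k *\<^sub>R F \<epsilon> (blinfun_pow (F \<epsilon>) k x)) sums (?c *\<^sub>R F \<epsilon> (J \<epsilon> h x))"
    using bounded_linear.sums[OF blinfun.bounded_linear_right J_sums[of x], of "F \<epsilon>"]
    by (simp only: blinfun.scaleR_right)
  moreover have "F \<epsilon> (blinfun_pow (F \<epsilon>) k x) = blinfun_pow (F \<epsilon>) k (F \<epsilon> x)" for k
    by (simp only: blinfun_pow_Suc_apply[symmetric]) simp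
  ultimately have "(\<lambda>k. \<theta> \<epsilon> h ^ k *\<^sub>R blinfun_pow (F \<epsilon>) k (F \<epsilon> x)) sums (?c *\<^sub>R F \<epsilon> (J \<epsilon> h x))" by simp
  from sums_unique2[OF this J_sums[of "F \<epsilon> x"]] c show ?thesis by simp
qed

text \<open>Applying \<open>\<theta> \<epsilon> h\<close> times \<open>F \<epsilon>\<close> shifts
  the series by one term, which gives the right inverse. As \<open>J\<close> commutes with
  \<open>F\<close>, it is a left inverse too.\<close>

lemma J_resolvent: "J \<epsilon> h x = x + h *\<^sub>R A \<epsilon> (J \<epsilon> h x)" "J \<epsilon> h (x - h *\<^sub>R A \<epsilon> x) = x"
proof -
  let ?c = "h / \<epsilon>" and ?f = "\<lambda>k. \<theta> \<epsilon> h ^ k *\<^sub>R blinfun_pow (F \<epsilon>) k x"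
  have c: "1 + ?c > 0" using \<epsilon> h by (simp add: add_pos_pos)
  have "(\<lambda>k. \<theta> \<epsilon> h *\<^sub>R F \<epsilon> (?f k)) sums (\<theta> \<epsilon> h *\<^sub>R F \<epsilon> ((1 + ?c) *\<^sub>R J \<epsilon> h x))"
    by (intro bounded_linear.sums[OF bounded_linear_scaleR_right] bounded_linear.sums[OF blinfun.bounded_linear_right] J_sums)
  moreover have "\<theta> \<epsilon> h *\<^sub>R F \<epsilon> (?f k) = ?f (Suc k)" for k by (simp add: blinfun.scaleR_right)
  ultimately have "(\<lambda>k. ?f (Suc k)) sums (\<theta> \<epsilon> h *\<^sub>R F \<epsilon> ((1 + ?c) *\<^sub>R J \<epsilon> h x))" by (simp only:)
  from sums_Suc[OF this] have "?f sums (\<theta> \<epsilon> h *\<^sub>R F \<epsilon> ((1 + ?c) *\<^sub>R J \<epsilon> h x) + ?f 0)" .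
  from sums_unique2[OF J_sums this]
  have "(1 + ?c) *\<^sub>R J \<epsilon> h x = (\<theta> \<epsilon> h * (1 + ?c)) *\<^sub>R F \<epsilon> (J \<epsilon> h x) + x"
    by (simp add: blinfun.scaleR_right)
  also have "\<theta> \<epsilon> h * (1 + ?c) = ?c" using c by (simp add: \<theta>_def)
  finally have *: "(1 + ?c) *\<^sub>R J \<epsilon> h x = ?c *\<^sub>R F \<epsilon> (J \<epsilon> h x) + x" .
  then have eq: "J \<epsilon> h x = x + ?c *\<^sub>R (F \<epsilon> (J \<epsilon> h x) - J \<epsilon> h x)"
    by (simp add: scaleR_left_distrib scaleR_right_diff_distrib algebra_simps)
  then show "J \<epsilon> h x = x + h *\<^sub>R A \<epsilon> (J \<epsilon> h x)" by (simp add: A_def)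
  have "J \<epsilon> h (x - h *\<^sub>R A \<epsilon> x) = J \<epsilon> h x - ?c *\<^sub>R (F \<epsilon> (J \<epsilon> h x) - J \<epsilon> h x)"
    by (simp add: A_def blinfun.diff_right blinfun.scaleR_right J_F)
  also have "\<dots> = x" by (subst (1) eq) simp
  finally show "J \<epsilon> h (x - h *\<^sub>R A \<epsilon> x) = x" .
qed

text \<open>A bound for \<open>J\<close> alone, raised to a power, would produce
  \<open>M ^ m\<close>. Carrying a power of \<open>F\<close> through the induction avoids this: each
  new \<open>J\<close> is expanded into powers of \<open>F\<close>, which merge with the one in
  front, and \<open>M\<close> is paid only once, at the end.\<close>

lemma norm_F_pow_J_pow:
  "norm (blinfun_pow (F \<epsilon>) l (blinfun_pow (J \<epsilon> h) m x)) \<le> M * exp (\<omega> * \<epsilon>) ^ l * \<rho> \<epsilon> h ^ m * norm x"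
proof (induction m arbitrary: l)
  case 0
  show ?case using F_pow_apply[of \<epsilon> l x] \<epsilon> by simp
next
  case (Suc m)
  let ?c = "1 + h / \<epsilon>" and ?z = "blinfun_pow (J \<epsilon> h) m x" and ?e = "exp (\<omega> * \<epsilon>)"
  let ?q = "\<theta> \<epsilon> h * ?e" and ?C = "M * ?e ^ l * \<rho> \<epsilon> h ^ m * norm x"
  have c: "?c > 0" using \<epsilon> h by (simp add: add_pos_pos)
  have s: "(\<lambda>k. \<theta> \<epsilon> h ^ k *\<^sub>R blinfun_pow (F \<epsilon>) l (blinfun_pow (F \<epsilon>) k ?z)) sums
      (?c *\<^sub>R blinfun_pow (F \<epsilon>) l (J \<epsilon> h ?z))"
    using bounded_linear.sums[OF blinfun.bounded_linear_right J_sums[of ?z], of "blinfun_pow (F \<epsilon>) l"]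
    by (simp only: blinfun.scaleR_right)
  have gs: "(\<lambda>k. ?C * ?q ^ k) sums (?C * (1 / (1 - ?q)))"
    using \<theta>_bounds by (intro sums_mult geometric_sums) simp
  have "norm (?c *\<^sub>R blinfun_pow (F \<epsilon>) l (J \<epsilon> h ?z)) \<le> ?C * (1 / (1 - ?q))"
    unfolding sums_unique[OF s] sums_unique[OF gs]
  proof (rule norm_suminf_le)
    show "summable (\<lambda>k. ?C * ?q ^ k)" using gs by (rule sums_summable)
    fix k
    have "norm (blinfun_pow (F \<epsilon>) l (blinfun_pow (F \<epsilon>) k ?z)) \<le> M * ?e ^ (l + k) * \<rho> \<epsilon> h ^ m * norm x"
      using Suc.IH[of "l + k"] by (simp only: blinfun_pow_add_apply)
    then have "\<theta> \<epsilon> h ^ k * norm (blinfun_pow (F \<epsilon>) l (blinfun_pow (F \<epsilon>) k ?z)) \<le>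
        \<theta> \<epsilon> h ^ k * (M * ?e ^ (l + k) * \<rho> \<epsilon> h ^ m * norm x)"
      using \<theta>_bounds by (intro mult_left_mono) auto
    then show "norm (\<theta> \<epsilon> h ^ k *\<^sub>R blinfun_pow (F \<epsilon>) l (blinfun_pow (F \<epsilon>) k ?z)) \<le> ?C * ?q ^ k"
      using \<theta>_bounds by (simp add: power_mult_distrib power_add mult_ac)
  qed
  then have "?c * norm (blinfun_pow (F \<epsilon>) l (J \<epsilon> h ?z)) \<le> ?C * (1 / (1 - ?q))"
    by (simp only: norm_scaleR abs_of_pos[OF c])
  then have "norm (blinfun_pow (F \<epsilon>) l (J \<epsilon> h ?z)) \<le> (?C * (1 / (1 - ?q))) / ?c"
    unfolding pos_le_divide_eq[OF c] by (simp only: mult.commute)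
  also have "\<dots> = ?C * ((1 / ?c) * (1 / (1 - ?q)))" by simp
  also have "\<dots> = ?C * \<rho> \<epsilon> h" by (simp only: \<theta>_bounds(4))
  finally show ?case by (simp add: mult_ac)
qed

lemma norm_J_pow: "norm (blinfun_pow (J \<epsilon> h) m) \<le> M * exp (4 * \<omega> * (real m * h))"
proof (rule norm_blinfun_bound)
  show "0 \<le> M * exp (4 * \<omega> * (real m * h))" using M by simp
  fix x :: 'a
  have "\<rho> \<epsilon> h ^ m \<le> exp (4 * \<omega> * h) ^ m" using \<rho>_bounds by (intro power_mono) auto
  also have "\<dots> = exp (4 * \<omega> * (real m * h))" by (simp add: exp_of_nat_mult[symmetric] mult_ac)
  finally have "M * \<rho> \<epsilon> h ^ m * norm x \<le> M * exp (4 * \<omega> * (real m * h)) * norm x"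
    using M by (intro mult_right_mono mult_left_mono) auto
  then show "norm (blinfun_pow (J \<epsilon> h) m x) \<le> M * exp (4 * \<omega> * (real m * h)) * norm x"
    using norm_F_pow_J_pow[of 0 m x] by simp
qed

lemma norm_J: "norm (J \<epsilon> h) \<le> 2 * M"
proof (rule norm_blinfun_bound)
  show "0 \<le> 2 * M" using M by simp
  fix x :: 'a
  have "M * \<rho> \<epsilon> h * norm x \<le> M * 2 * norm x"
    using M \<rho>_bounds by (intro mult_right_mono mult_left_mono) auto
  then show "norm (J \<epsilon> h x) \<le> 2 * M * norm x"
    using norm_F_pow_J_pow[of 0 1 x] by (simp add: mult_ac)
qed

end

lemma A_tendsto:
  assumes "(x, z) \<in> Z" "filterlim e (at_right 0) sequentially"
  shows "(\<lambda>n. A (e n) x) \<longlonglongrightarrow> z"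
  using filterlim_compose[OF F_deriv[OF assms(1)] assms(2)] by (simp add: A_def inverse_eq_divide)

lemma eventually_small:
  assumes "filterlim e (at_right 0) sequentially"
  shows "eventually (\<lambda>n. 0 < e n \<and> e n \<le> 1 / \<omega>) sequentially"
proof -
  have "eventually (\<lambda>\<epsilon>::real. \<epsilon> \<in> {0<..<1 / \<omega>}) (at_right 0)" using \<omega> by (intro eventually_at_right_real) simp
  then have "eventually (\<lambda>n. e n \<in> {0<..<1 / \<omega>}) sequentially"
    using assms unfolding filterlim_iff by blast
  then show ?thesis by eventually_elim auto
qed

text \<open>\<open>J\<close> inverts \<open>1 - h A\<close> exactly, so the error is
  \<open>J\<close> applied to \<open>h\<close> times the difference of \<open>A x\<close> and
  \<open>z\<close>, and the uniform bound on \<open>J\<close> suffices.\<close>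

lemma J_consistent:
  assumes xz: "(x, z) \<in> Z" and e: "filterlim e (at_right 0) sequentially" and h: "0 < h" "h \<le> \<delta>"
  shows "(\<lambda>n. J (e n) h (x - h *\<^sub>R z)) \<longlonglongrightarrow> x"
proof -
  have "(\<lambda>n. J (e n) h (x - h *\<^sub>R z) - x) \<longlonglongrightarrow> 0"
  proof (rule Lim_null_comparison)
    show "eventually (\<lambda>n. norm (J (e n) h (x - h *\<^sub>R z) - x) \<le> 2 * M * (h * norm (A (e n) x - z))) sequentially"
      using eventually_small[OF e]
    proof eventually_elim
      case (elim n)
      then have en: "0 < e n" "e n \<le> 1 / \<omega>" by auto
      have "J (e n) h (x - h *\<^sub>R z) - J (e n) h (x - h *\<^sub>R A (e n) x) = J (e n) h (h *\<^sub>R (A (e n) x - z))"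
        unfolding blinfun.diff_right[symmetric] by (simp add: algebra_simps)
      then have "J (e n) h (x - h *\<^sub>R z) - x = J (e n) h (h *\<^sub>R (A (e n) x - z))"
        by (simp only: J_resolvent(2)[OF en h])
      then show ?case
        using norm_blinfun_le[OF norm_J[OF en h], of "h *\<^sub>R (A (e n) x - z)"] h by simp
    qed
    have "(\<lambda>n. A (e n) x - z) \<longlonglongrightarrow> 0" using A_tendsto[OF xz e] by (simp add: LIM_zero_iff)
    then show "(\<lambda>n. 2 * M * (h * norm (A (e n) x - z))) \<longlonglongrightarrow> 0"
      by (intro tendsto_mult_right_zero tendsto_norm_zero)
  qed
  then show ?thesis by (simp add: LIM_zero_iff)
qed

end

section \<open>Density of the range\<close>

lemma filterlim_divide_at_right_0:
  assumes "t > 0" shows "filterlim (\<lambda>n. t / real n) (at_right 0) sequentially"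
  unfolding filterlim_at
proof
  show "eventually (\<lambda>n. t / real n \<in> {0<..} \<and> t / real n \<noteq> 0) sequentially"
    using eventually_gt_at_top[of 0] by eventually_elim (use assms in simp)
  show "(\<lambda>n. t / real n) \<longlonglongrightarrow> 0" by (rule lim_const_over_n)
qed

context chernoff_family begin

text \<open>The weak limits of \<open>F(t/n)\<^bsup>[ns]\<^esup> Z f\<close> and of \<open>Z g\<close> coincide, because
  \<open>A \<epsilon>\<close> commutes with \<open>F \<epsilon>\<close> and can be moved to functionals in the domain of the
  derivative of the adjoint.\<close>

lemma weak_limits_eq:
  assumes ii: "weak_star_topology smul closure_of Domain (adjoint_deriv0 smul F) = dual_space smul"
    and F0: "F 0 = id_blinfun"
    and fz: "(f, z) \<in> Z" and e: "filterlim e (at_right 0) sequentially"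
    and Wb: "\<And>n. norm (blinfun_pow (F (e n)) (k n)) \<le> C"
    and Wf: "weakly_converges_to smul (\<lambda>n. blinfun_pow (F (e n)) (k n) f) u"
    and Wz: "weakly_converges_to smul (\<lambda>n. blinfun_pow (F (e n)) (k n) z) w"
    and gy: "eventually (\<lambda>n. (g n, y n) \<in> Z) sequentially"
    and g: "weakly_converges_to smul g u" and y: "weakly_converges_to smul y v"
  shows "w = v"
proof -
  let ?W = "\<lambda>n. blinfun_pow (F (e n)) (k n)"
  have "w - v = 0"
  proof (rule weak_star_dense_separates[OF ii])
    fix \<psi> assume "\<psi> \<in> Domain (adjoint_deriv0 smul F)"
    then obtain \<eta> where "(\<psi>, \<eta>) \<in> adjoint_deriv0 smul F" by auto
    then have \<psi>: "\<psi> \<in> dual_space smul" and \<eta>: "\<eta> \<in> dual_space smul"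
      and lim: "((\<lambda>h. inverse h *\<^sub>R (adjoint_op (F h) \<psi> - adjoint_op (F 0) \<psi>)) \<longlongrightarrow> \<eta>) (at_right 0)"
      by (auto simp: strong_deriv0_def)
    let ?\<eta> = "\<lambda>h. inverse h *\<^sub>R (adjoint_op (F h) \<psi> - adjoint_op (F 0) \<psi>)"
    have \<eta>A: "?\<eta> h x = \<psi> (A h x)" for h x
      by (simp add: A_def adjoint_op_def F0 blinfun.scaleR_left blinfun.scaleR_right blinfun.diff_left
          blinfun.diff_right inverse_eq_divide)
    \<comment> \<open>Thus \<open>\<psi>\<close> is in the domain of the adjoint of
      \<open>Z\<close>, with image \<open>\<eta>\<close>. Applied to the pairs
      \<open>(g n, y n)\<close> this expresses \<open>\<psi> v\<close> by \<open>u\<close>.\<close>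
    have \<eta>Z: "\<eta> x = \<psi> x'" if "(x, x') \<in> Z" for x x'
    proof -
      have "((\<lambda>h. ?\<eta> h x) \<longlongrightarrow> \<eta> x) (at_right 0)" by (rule blinfun.tendsto[OF lim tendsto_const])
      moreover have "((\<lambda>h. ?\<eta> h x) \<longlongrightarrow> \<psi> x') (at_right 0)"
        unfolding \<eta>A A_def using blinfun.tendsto[OF tendsto_const F_deriv[OF that], of \<psi>] by (simp add: inverse_eq_divide)
      ultimately show ?thesis by (rule tendsto_unique[OF trivial_limit_at_right_real])
    qed
    have 1: "\<eta> u = \<psi> v"
    proof (rule LIMSEQ_unique)
      show "(\<lambda>n. \<eta> (g n)) \<longlonglongrightarrow> \<eta> u" by (rule weakly_converges_toD[OF g \<eta>])
      show "(\<lambda>n. \<eta> (g n)) \<longlonglongrightarrow> \<psi> v"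
        by (rule Lim_transform_eventually[OF weakly_converges_toD[OF y \<psi>]])
          (use gy in \<open>eventually_elim, simp add: \<eta>Z\<close>)
    qed
    \<comment> \<open>Along the sequence \<open>\<psi> (W z)\<close> is close to
      \<open>\<psi> (W (A f))\<close>, which equals \<open>\<psi> (A (W f))\<close> and so the
      difference quotient of the adjoint at \<open>W f\<close>, which is close to
      \<open>\<eta> (W f)\<close>. The last comparison uses norm convergence of the quotient,
      because \<open>W f\<close> is merely bounded.\<close>
    have 2: "\<psi> w = \<eta> u"
    proof -
      have "(\<lambda>n. norm \<psi> * (C * norm (z - A (e n) f)) + norm (?\<eta> (e n) - \<eta>) * (C * norm f)) \<longlonglongrightarrow>
          norm \<psi> * (C * norm (z - z)) + norm (\<eta> - \<eta>) * (C * norm f)"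
        by (intro tendsto_intros A_tendsto[OF fz e] filterlim_compose[OF lim e])
      then have lim0: "(\<lambda>n. norm \<psi> * (C * norm (z - A (e n) f)) + norm (?\<eta> (e n) - \<eta>) * (C * norm f)) \<longlonglongrightarrow> 0"
        by simp
      have "(\<lambda>n. \<psi> (?W n z) - \<eta> (?W n f)) \<longlonglongrightarrow> 0"
      proof (rule Lim_null_comparison[OF always_eventually lim0], rule allI)
        fix n
        have com: "A (e n) (?W n f) = ?W n (A (e n) f)"
          by (simp add: A_def blinfun.diff_right blinfun.scaleR_right blinfun_pow_commute)
        have "\<psi> (?W n z) - \<eta> (?W n f) = \<psi> (?W n (z - A (e n) f)) + (?\<eta> (e n) - \<eta>) (?W n f)"
          unfolding blinfun.diff_left \<eta>A com by (simp add: blinfun.diff_right)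
        then have "norm (\<psi> (?W n z) - \<eta> (?W n f)) \<le> norm (\<psi> (?W n (z - A (e n) f))) + norm ((?\<eta> (e n) - \<eta>) (?W n f))"
          by (simp only: norm_triangle_ineq)
        moreover have "norm (\<psi> (?W n (z - A (e n) f))) \<le> norm \<psi> * (C * norm (z - A (e n) f))"
          by (rule order_trans[OF norm_blinfun mult_left_mono[OF norm_blinfun_le[OF Wb] norm_ge_zero]])
        moreover have "norm ((?\<eta> (e n) - \<eta>) (?W n f)) \<le> norm (?\<eta> (e n) - \<eta>) * (C * norm f)"
          by (rule order_trans[OF norm_blinfun mult_left_mono[OF norm_blinfun_le[OF Wb] norm_ge_zero]])
        ultimately show "norm (\<psi> (?W n z) - \<eta> (?W n f)) \<le>
            norm \<psi> * (C * norm (z - A (e n) f)) + norm (?\<eta> (e n) - \<eta>) * (C * norm f)" by linarith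
      qed
      moreover have "(\<lambda>n. \<psi> (?W n z) - \<eta> (?W n f)) \<longlonglongrightarrow> \<psi> w - \<eta> u"
        by (intro tendsto_diff weakly_converges_toD[OF Wz \<psi>] weakly_converges_toD[OF Wf \<eta>])
      ultimately have "\<psi> w - \<eta> u = 0" by (rule LIMSEQ_unique[rotated])
      then show ?thesis by simp
    qed
    from 1 2 show "\<psi> (w - v) = 0" by (simp add: blinfun.diff_right)
  qed
  then show ?thesis by simp
qed

section \<open>Geometric discounting along the powers of F\<close>

lemma discounted_sum:
  fixes p :: "nat \<Rightarrow> 'k" and c :: real
  assumes c: "c > 0"
  shows "norm (p 0) \<le> (c / (1 + c)) ^ N * norm (p N) + (\<Sum>k<N. norm ((1 + c) *\<^sub>R p k - c *\<^sub>R p (Suc k))) / c"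
proof -
  let ?e = "\<lambda>k. (1 + c) *\<^sub>R p k - c *\<^sub>R p (Suc k)" and ?\<theta> = "c / (1 + c)"
  have \<theta>: "0 \<le> ?\<theta>" "?\<theta> \<le> 1" using c by auto
  show ?thesis
  proof (induction N)
    case (Suc N)
    have "p N = (1 / (1 + c)) *\<^sub>R ?e N + ?\<theta> *\<^sub>R p (Suc N)"
      using c by (simp add: scaleR_right_diff_distrib)
    then have "norm (p N) \<le> norm ((1 / (1 + c)) *\<^sub>R ?e N) + norm (?\<theta> *\<^sub>R p (Suc N))"
      by (metis norm_triangle_ineq)
    also have "\<dots> = norm (?e N) / (1 + c) + ?\<theta> * norm (p (Suc N))" using c by simp
    also have "norm (?e N) / (1 + c) \<le> norm (?e N) / c" using c by (intro divide_left_mono) auto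
    finally have *: "norm (p N) \<le> norm (?e N) / c + ?\<theta> * norm (p (Suc N))" by simp
    have "?\<theta> ^ N * norm (p N) \<le> ?\<theta> ^ N * (norm (?e N) / c + ?\<theta> * norm (p (Suc N)))"
      by (rule mult_left_mono[OF *]) (rule zero_le_power[OF \<theta>(1)])
    also have "\<dots> = ?\<theta> ^ N * (norm (?e N) / c) + ?\<theta> ^ Suc N * norm (p (Suc N))"
      by (simp only: distrib_left power_Suc mult_ac)
    also have "?\<theta> ^ N * (norm (?e N) / c) \<le> 1 * (norm (?e N) / c)"
      by (rule mult_right_mono[OF power_le_one[OF \<theta>]]) (use c in simp)
    finally show ?case using Suc.IH by (simp only: sum.lessThan_Suc add_divide_distrib) linarith
  qed simp
qed

text \<open>Since \<open>exp (2 * \<omega> * \<tau>)\<close> is at most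
  \<open>1 + 4 * \<omega> * \<tau>\<close>, hence at most \<open>1 + \<tau> / h\<close>, a geometric
  weight absorbs the growth factor of one step twice. The surplus makes the boundary term in
  \<open>annihilator_vanishes\<close> decay in \<open>S\<close> uniformly in
  \<open>n\<close>.\<close>

lemma discount_factor:
  assumes \<tau>: "0 < \<tau>" "2 * \<omega> * \<tau> \<le> 1" and h: "0 < h" "h \<le> \<delta>"
  shows "(h / \<tau>) / (1 + h / \<tau>) * exp (\<omega> * \<tau>) \<le> exp (- (\<omega> * \<tau>))"
proof -
  have "exp (2 * \<omega> * \<tau>) \<le> 1 + 4 * \<omega> * \<tau>"
    using exp_le_one_plus_double[of "2 * \<omega> * \<tau>"] \<tau> \<omega> by simp
  also have "4 * \<omega> * \<tau> \<le> \<tau> / h"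
  proof -
    have "4 * \<omega> * h \<le> 1" using h(2) \<omega> by (simp add: \<delta>_def field_simps)
    from mult_right_mono[OF this, of \<tau>] \<tau>(1) h show ?thesis by (simp add: field_simps)
  qed
  finally have "exp (2 * \<omega> * \<tau>) \<le> 1 + \<tau> / h" by simp
  then have "(h / \<tau>) * exp (2 * \<omega> * \<tau>) \<le> (h / \<tau>) * (1 + \<tau> / h)"
    using h \<tau> by (intro mult_left_mono) auto
  also have "\<dots> = 1 + h / \<tau>" using h \<tau> by (simp add: field_simps)
  finally have *: "(h / \<tau>) * exp (2 * \<omega> * \<tau>) \<le> 1 + h / \<tau>" .
  have pos: "1 + h / \<tau> > 0" using h \<tau> by (simp add: add_pos_pos)
  have "exp (2 * \<omega> * \<tau>) = exp (\<omega> * \<tau>) * exp (\<omega> * \<tau>)" by (simp add: exp_add[symmetric])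
  with * have "((h / \<tau>) * exp (\<omega> * \<tau>)) * exp (\<omega> * \<tau>) \<le> 1 + h / \<tau>" by (simp only: mult.assoc)
  then have "(h / \<tau>) * exp (\<omega> * \<tau>) \<le> (1 + h / \<tau>) / exp (\<omega> * \<tau>)"
    by (simp only: pos_le_divide_eq[OF exp_gt_zero])
  then have "(h / \<tau>) * exp (\<omega> * \<tau>) / (1 + h / \<tau>) \<le> (1 + h / \<tau>) / exp (\<omega> * \<tau>) / (1 + h / \<tau>)"
    using pos by (intro divide_right_mono) auto
  then show ?thesis using pos by (simp add: exp_minus inverse_eq_divide)
qed

text \<open>\<open>discounted_sum\<close> is applied to the values of \<open>\<phi>\<close> on the
  discrete orbit of \<open>f\<close>, with \<open>c = h / (t / n)\<close> and
  \<open>N = n * S\<close>. Its error terms are the quantities of the hypothesis, and the factor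
  \<open>1 / c\<close> turns their sum into an average, which tends to 0. There remains the boundary
  term of order \<open>exp (- (\<omega> * t * S))\<close>, and \<open>S\<close> is
  arbitrary.\<close>

lemma annihilator_vanishes:
  fixes \<phi> :: "'a \<Rightarrow>\<^sub>L 'k"
  assumes t: "t > 0" and h: "0 < h" "h \<le> \<delta>" and fz: "(f, z) \<in> Z"
    and lim: "\<And>s. s \<ge> 0 \<Longrightarrow>
      (\<lambda>n. \<phi> (blinfun_pow (F (t / real n)) (nat \<lfloor>real n * s\<rfloor>) (f - h *\<^sub>R A (t / real n) f))) \<longlonglongrightarrow> 0"
  shows "\<phi> f = 0"
proof -
  define W where "W n = blinfun_pow (F (t / real n))" for n
  define q where "q n = f - h *\<^sub>R A (t / real n) f" for n
  have tn: "filterlim (\<lambda>n. t / real n) (at_right 0) sequentially" by (rule filterlim_divide_at_right_0[OF t])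
  have "q \<longlonglongrightarrow> f - h *\<^sub>R z"
    unfolding q_def[abs_def] by (intro tendsto_intros A_tendsto[OF fz tn])
  then have "Bseq q" by (intro convergent_imp_Bseq) (auto simp: convergent_def)
  then obtain Q where Q: "\<And>n. norm (q n) \<le> Q" by (auto simp: Bseq_def)
  have bound: "norm (\<phi> f) \<le> norm \<phi> * (M * norm f) * exp (- (\<omega> * t * real S))" for S :: nat
  proof -
    have Wb: "norm (W n k x) \<le> M * exp (\<omega> * (t * real S)) * norm x" if "k \<le> n * S" for n k x
    proof -
      have "real k \<le> real (n * S)" using that by (simp only: of_nat_le_iff)
      then have "real k * (t / real n) \<le> real (n * S) * (t / real n)"
        using t by (intro mult_right_mono) auto
      also have "\<dots> \<le> t * real S" using t by simp
      finally show ?thesis unfolding W_def using t by (intro norm_blinfun_le norm_F_pow_le) auto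
    qed
    have avg: "(\<lambda>n. (\<Sum>k<n * S. norm (\<phi> (W n k (q n)))) / real n) \<longlonglongrightarrow> 0"
    proof (rule average_tendsto_zero)
      fix n k assume "k \<le> n * S"
      have "norm (\<phi> (W n k (q n))) \<le> norm \<phi> * norm (W n k (q n))" by (rule norm_blinfun)
      also have "\<dots> \<le> norm \<phi> * (M * exp (\<omega> * (t * real S)) * norm (q n))"
        by (intro mult_left_mono Wb \<open>k \<le> n * S\<close>) simp
      also have "\<dots> \<le> norm \<phi> * (M * exp (\<omega> * (t * real S)) * Q)"
        using M by (intro mult_left_mono Q) auto
      finally show "\<bar>norm (\<phi> (W n k (q n)))\<bar> \<le> norm \<phi> * (M * exp (\<omega> * (t * real S)) * Q)" by simp
    next
      fix s :: real assume "0 \<le> s"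
      from tendsto_norm_zero[OF lim[OF this]]
      show "(\<lambda>n. norm (\<phi> (W n (nat \<lfloor>real n * s\<rfloor>) (q n)))) \<longlonglongrightarrow> 0" by (simp only: W_def q_def)
    qed
    have "(\<lambda>n. norm \<phi> * (M * norm f) * exp (- (\<omega> * t * real S)) +
        (t / h) * ((\<Sum>k<n * S. norm (\<phi> (W n k (q n)))) / real n)) \<longlonglongrightarrow>
        norm \<phi> * (M * norm f) * exp (- (\<omega> * t * real S)) + (t / h) * 0"
      by (intro tendsto_intros avg)
    moreover have "eventually (\<lambda>n. norm (\<phi> f) \<le> norm \<phi> * (M * norm f) * exp (- (\<omega> * t * real S)) +
        (t / h) * ((\<Sum>k<n * S. norm (\<phi> (W n k (q n)))) / real n)) sequentially"
    proof -
      have "eventually (\<lambda>\<epsilon>::real. \<epsilon> \<in> {0<..<1 / (2 * \<omega>)}) (at_right 0)"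
        using \<omega> by (intro eventually_at_right_real) simp
      then have "eventually (\<lambda>n. t / real n \<in> {0<..<1 / (2 * \<omega>)}) sequentially"
        using tn unfolding filterlim_iff by blast
      with eventually_gt_at_top[of 0] show ?thesis
      proof eventually_elim
        case (elim n)
        let ?\<tau> = "t / real n"
        let ?c = "h / ?\<tau>" and ?N = "n * S" and ?p = "\<lambda>k. \<phi> (W n k f)"
        have n: "real n > 0" using elim by simp
        have \<tau>: "0 < ?\<tau>" "2 * \<omega> * ?\<tau> \<le> 1" using elim \<omega> t by (auto simp: field_simps)
        have c: "?c > 0" by (rule divide_pos_pos[OF h(1) \<tau>(1)])
        have \<theta>0: "0 \<le> ?c / (1 + ?c)"
          by (rule divide_nonneg_pos[OF less_imp_le[OF c] add_pos_pos[OF zero_less_one c]])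
        have ek: "(1 + ?c) *\<^sub>R ?p k - ?c *\<^sub>R ?p (Suc k) = \<phi> (W n k (q n))" for k
        proof -
          have "W n k (q n) = W n k f - ?c *\<^sub>R (W n k (F ?\<tau> f) - W n k f)"
            by (simp add: q_def A_def blinfun.diff_right blinfun.scaleR_right)
          also have "W n k (F ?\<tau> f) = W n (Suc k) f" by (simp only: W_def blinfun_pow_Suc_apply)
          finally show ?thesis
            by (simp add: blinfun.diff_right blinfun.scaleR_right scaleR_left_distrib scaleR_right_diff_distrib)
        qed
        have "norm (?p 0) \<le> (?c / (1 + ?c)) ^ ?N * norm (?p ?N)
            + (\<Sum>k<?N. norm ((1 + ?c) *\<^sub>R ?p k - ?c *\<^sub>R ?p (Suc k))) / ?c"
          by (rule discounted_sum[OF c])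
        then have 1: "norm (\<phi> f) \<le> (?c / (1 + ?c)) ^ ?N * norm (?p ?N) + (\<Sum>k<?N. norm (\<phi> (W n k (q n)))) / ?c"
          unfolding ek by (simp add: W_def)
        have "norm (?p ?N) \<le> norm \<phi> * (M * exp (\<omega> * ?\<tau>) ^ ?N * norm f)"
          unfolding W_def using \<tau> by (intro order_trans[OF norm_blinfun mult_left_mono] F_pow_apply) auto
        then have "(?c / (1 + ?c)) ^ ?N * norm (?p ?N) \<le> (?c / (1 + ?c)) ^ ?N * (norm \<phi> * (M * exp (\<omega> * ?\<tau>) ^ ?N * norm f))"
          by (rule mult_left_mono[OF _ zero_le_power[OF \<theta>0]])
        also have "\<dots> = norm \<phi> * (M * norm f) * (?c / (1 + ?c) * exp (\<omega> * ?\<tau>)) ^ ?N"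
          by (simp only: power_mult_distrib mult_ac)
        also have "\<dots> \<le> norm \<phi> * (M * norm f) * exp (- (\<omega> * ?\<tau>)) ^ ?N"
          using M by (intro mult_left_mono power_mono discount_factor \<tau> h mult_nonneg_nonneg[OF \<theta>0 exp_ge_zero]) auto
        also have "exp (- (\<omega> * ?\<tau>)) ^ ?N = exp (- (\<omega> * t * real S))"
          using n by (simp add: exp_of_nat_mult[symmetric] field_simps)
        finally have 2: "(?c / (1 + ?c)) ^ ?N * norm (?p ?N) \<le> norm \<phi> * (M * norm f) * exp (- (\<omega> * t * real S))" .
        have "(\<Sum>k<?N. norm (\<phi> (W n k (q n)))) / ?c = (t / h) * ((\<Sum>k<?N. norm (\<phi> (W n k (q n)))) / real n)"
          by simp
        with 1 2 show ?case by linarith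
      qed
    qed
    ultimately show ?thesis by (intro tendsto_lowerbound[of _ _ sequentially]) auto
  qed
  have "(\<lambda>S. norm \<phi> * (M * norm f) * exp (- (\<omega> * t)) ^ S) \<longlonglongrightarrow> norm \<phi> * (M * norm f) * 0"
    using \<omega> t by (intro tendsto_intros LIMSEQ_power_zero) simp
  moreover have "exp (- (\<omega> * t)) ^ S = exp (- (\<omega> * t * real S))" for S
    by (simp add: exp_of_nat_mult[symmetric] mult_ac)
  ultimately have "(\<lambda>S. norm \<phi> * (M * norm f) * exp (- (\<omega> * t * real S))) \<longlonglongrightarrow> 0" by simp
  then have "norm (\<phi> f) \<le> 0" by (rule LIMSEQ_le_const) (use bound in blast)
  then show ?thesis by simp
qed

end

section \<open>Annihilators of the range of 1 - h Z\<close>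

context chernoff_family begin

definition "range_shift h = (\<lambda>(x, z). x - h *\<^sub>R z) ` Z"

lemma range_shift_dense:
  assumes ii: "weak_star_topology smul closure_of Domain (adjoint_deriv0 smul F) = dual_space smul"
    and F0: "F 0 = id_blinfun"
    and t: "t > 0" and h: "0 < h" "h \<le> \<delta>" and Z0: "(0, 0) \<in> Z"
    and \<A>: "\<A> \<subseteq> Domain Z" "closure \<A> = UNIV"
    and iii: "\<And>f s. f \<in> \<A> \<Longrightarrow> s \<ge> 0 \<Longrightarrow> \<exists>g y. (\<forall>n\<ge>1. (g n, y n) \<in> Z) \<and>
      (\<lambda>n. norm (blinfun_pow (F (t / real n)) (nat \<lfloor>real n * s\<rfloor>) f - g n)) \<longlonglongrightarrow> 0 \<and>
      subseqs_have_weakly_convergent_subseq smul g \<and> subseqs_have_weakly_convergent_subseq smul y"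
  shows "closure (range_shift h) = UNIV"
proof (rule dense_subspaceI)
  show "module.subspace smul (range_shift h)"
  proof (rule subspaceI)
    show "0 \<in> range_shift h" using Z0 by (force simp: range_shift_def)
    show "a + b \<in> range_shift h" if a: "a \<in> range_shift h" and b: "b \<in> range_shift h" for a b
    proof -
      obtain x z x' z' where "(x, z) \<in> Z" "a = x - h *\<^sub>R z" "(x', z') \<in> Z" "b = x' - h *\<^sub>R z'"
        using a b unfolding range_shift_def by auto
      then show ?thesis unfolding range_shift_def
        by (intro image_eqI[of _ _ "(x + x', z + z')"]) (auto simp: Z_add algebra_simps)
    qed
    show "smul c a \<in> range_shift h" if a: "a \<in> range_shift h" for c a
    proof -
      obtain x z where "(x, z) \<in> Z" "a = x - h *\<^sub>R z" using a unfolding range_shift_def by auto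
      then show ?thesis unfolding range_shift_def
        by (intro image_eqI[of _ _ "(smul c x, smul c z)"]) (auto simp: Z_smul scale_right_diff_distrib smul_scaleR)
    qed
  qed
next
  fix \<phi> x assume \<phi>: "\<phi> \<in> dual_space smul" and ann: "\<And>y. y \<in> range_shift h \<Longrightarrow> \<phi> y = 0"
  have \<phi>Z: "\<phi> a = h *\<^sub>R \<phi> b" if "(a, b) \<in> Z" for a b
  proof -
    have "a - h *\<^sub>R b \<in> range_shift h" using that by (force simp: range_shift_def)
    from ann[OF this] show ?thesis by (simp add: blinfun.diff_right blinfun.scaleR_right)
  qed
  have "\<phi> f = 0" if f: "f \<in> \<A>" for f
  proof -
    obtain z where fz: "(f, z) \<in> Z" using f \<A>(1) by auto
    show ?thesis
    proof (rule annihilator_vanishes[OF t h fz])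
      fix s :: real assume s: "s \<ge> 0"
      define e where "e n = t / real n" for n
      define k where "k n = nat \<lfloor>real n * s\<rfloor>" for n
      define W where "W n = blinfun_pow (F (e n)) (k n)" for n
      define C where "C = M * exp (\<omega> * (t * s))"
      have e: "filterlim e (at_right 0) sequentially"
        unfolding e_def by (rule filterlim_divide_at_right_0[OF t])
      have Wb: "norm (W n) \<le> C" for n
      proof -
        have "real (k n) * e n \<le> (real n * s) * e n"
          using s t by (intro mult_right_mono) (auto simp: k_def e_def)
        also have "\<dots> \<le> t * s" using s t by (simp add: e_def)
        finally show ?thesis
          unfolding W_def C_def using t by (intro norm_F_pow_le) (auto simp: e_def)
      qed
      have W\<A>: "subseqs_have_weakly_convergent_subseq smul (\<lambda>n. W n f')" if "f' \<in> \<A>" for f'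
        unfolding subseqs_have_weakly_convergent_subseq_def
      proof (intro allI impI)
        fix r :: "nat \<Rightarrow> nat" assume r: "strict_mono r"
        from iii[OF that s] obtain g where g: "(\<lambda>n. norm (W n f' - g n)) \<longlonglongrightarrow> 0"
          "subseqs_have_weakly_convergent_subseq smul g" by (auto simp: W_def e_def k_def)
        from weakly_precompactD[OF g(2) r] obtain q l where
          q: "strict_mono q" "weakly_converges_to smul (\<lambda>n. g (r (q n))) l" .
        have "(\<lambda>n. norm (W (r (q n)) f' - g (r (q n)))) \<longlonglongrightarrow> 0"
          using LIMSEQ_subseq_LIMSEQ[OF g(1) strict_mono_o[OF r q(1)]] by (simp add: o_def)
        from weakly_converges_to_cong_norm[OF q(2) this] q(1)
        show "\<exists>(q::nat \<Rightarrow> nat) l. strict_mono q \<and> weakly_converges_to smul ((\<lambda>n. W n f') \<circ> r \<circ> q) l"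
          unfolding o_def by auto
      qed
      \<comment> \<open>The vector \<open>z\<close> need not lie in \<open>\<A>\<close>, so the
        hypothesis says nothing about its orbit directly. Density of \<open>\<A>\<close> and the
        bound \<open>Wb\<close> extend weak precompactness to all vectors.\<close>
      have Wall: "subseqs_have_weakly_convergent_subseq smul (\<lambda>n. W n y)" for y
      proof -
        have "y \<in> closure \<A>" using \<A>(2) by simp
        then obtain a where a: "\<And>j. a j \<in> \<A>" "a \<longlonglongrightarrow> y" unfolding closure_sequential by auto
        show ?thesis
        proof (rule weakly_precompact_limit[OF W\<A>[OF a(1)]])
          show "norm (W n (a j) - W n y) \<le> C * norm (a j - y)" for j n
            unfolding blinfun.diff_right[symmetric] by (rule norm_blinfun_le[OF Wb])
          have "(\<lambda>j. a j - y) \<longlonglongrightarrow> 0" using a(2) by (simp add: LIM_zero_iff)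
          then show "(\<lambda>j. C * norm (a j - y)) \<longlonglongrightarrow> 0" by (intro tendsto_mult_right_zero tendsto_norm_zero)
        qed
      qed
      from iii[OF f s] obtain g y where gy: "\<And>n. n \<ge> 1 \<Longrightarrow> (g n, y n) \<in> Z"
        and Wg: "(\<lambda>n. norm (W n f - g n)) \<longlonglongrightarrow> 0"
        and gc: "subseqs_have_weakly_convergent_subseq smul g"
        and yc: "subseqs_have_weakly_convergent_subseq smul y" by (auto simp: W_def e_def k_def)
      have "(\<lambda>n. \<phi> (W n (f - h *\<^sub>R A (e n) f))) \<longlonglongrightarrow> 0"
      \<comment> \<open>The three refinements make \<open>g\<close>, \<open>y\<close> and the orbit
        of \<open>z\<close> converge weakly in turn. They depend on \<open>s\<close> and on the
        given subsequence, but the limit found along them is always 0.\<close>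
      proof (rule LIMSEQ_subseqI)
        fix r :: "nat \<Rightarrow> nat" assume r: "strict_mono r"
        obtain q1 u where q1: "strict_mono q1" "weakly_converges_to smul (\<lambda>n. g (r (q1 n))) u"
          by (rule weakly_precompactD[OF gc r])
        have r1: "strict_mono (\<lambda>n. r (q1 n))" using strict_mono_o[OF r q1(1)] by (simp add: o_def)
        obtain q2 v where q2: "strict_mono q2" "weakly_converges_to smul (\<lambda>n. y (r (q1 (q2 n)))) v"
          by (rule weakly_precompactD[OF yc r1])
        have r2: "strict_mono (\<lambda>n. r (q1 (q2 n)))" using strict_mono_o[OF r1 q2(1)] by (simp add: o_def)
        obtain q3 w where q3: "strict_mono q3" "weakly_converges_to smul (\<lambda>n. W (r (q1 (q2 (q3 n)))) z) w"
          by (rule weakly_precompactD[OF Wall r2])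
        define p where "p n = r (q1 (q2 (q3 n)))" for n
        have p: "strict_mono p" using strict_mono_o[OF r2 q3(1)] by (simp add: o_def p_def[abs_def])
        have gp: "weakly_converges_to smul (\<lambda>n. g (p n)) u"
          using weakly_converges_to_subseq[OF weakly_converges_to_subseq[OF q1(2) q2(1)] q3(1)] by (simp add: p_def)
        have yp: "weakly_converges_to smul (\<lambda>n. y (p n)) v"
          using weakly_converges_to_subseq[OF q2(2) q3(1)] by (simp add: p_def)
        have Wz: "weakly_converges_to smul (\<lambda>n. W (p n) z) w" using q3(2) by (simp add: p_def)
        have "(\<lambda>n. norm (W (p n) f - g (p n))) \<longlonglongrightarrow> 0"
          using LIMSEQ_subseq_LIMSEQ[OF Wg p] by (simp add: o_def)
        then have Wf: "weakly_converges_to smul (\<lambda>n. W (p n) f) u" by (rule weakly_converges_to_cong_norm[OF gp])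
        have ep: "filterlim (\<lambda>n. e (p n)) (at_right 0) sequentially"
          by (rule filterlim_compose[OF e filterlim_subseq[OF p]])
        have Zp: "eventually (\<lambda>n. (g (p n), y (p n)) \<in> Z) sequentially"
          using eventually_ge_at_top[of 1]
        proof eventually_elim
          case (elim n)
          \<comment> \<open>A subsequence never falls below its index, which avoids the
            unconstrained entry at 0.\<close>
          then have "p n \<ge> 1" using seq_suble[OF p, of n] by linarith
          then show ?case by (rule gy)
        qed
        have wv: "w = v"
          by (rule weak_limits_eq[OF ii F0 fz ep Wb[unfolded W_def] Wf[unfolded W_def] Wz[unfolded W_def] Zp gp yp])
        have uv: "\<phi> u = h *\<^sub>R \<phi> v"
        proof (rule LIMSEQ_unique)
          show "(\<lambda>n. \<phi> (g (p n))) \<longlonglongrightarrow> \<phi> u" by (rule weakly_converges_toD[OF gp \<phi>])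
          have "(\<lambda>n. h *\<^sub>R \<phi> (y (p n))) \<longlonglongrightarrow> h *\<^sub>R \<phi> v"
            by (intro tendsto_intros weakly_converges_toD[OF yp \<phi>])
          then show "(\<lambda>n. \<phi> (g (p n))) \<longlonglongrightarrow> h *\<^sub>R \<phi> v"
            by (rule Lim_transform_eventually) (use Zp in \<open>eventually_elim, simp add: \<phi>Z\<close>)
        qed
        have "(\<lambda>n. z - A (e (p n)) f) \<longlonglongrightarrow> z - z" by (intro tendsto_intros A_tendsto[OF fz ep])
        then have v0: "(\<lambda>n. z - A (e (p n)) f) \<longlonglongrightarrow> 0" by simp
        have "(\<lambda>n. W (p n) (z - A (e (p n)) f)) \<longlonglongrightarrow> 0"
          by (rule strong_tendsto_apply[where C = C, OF _ _ v0]) (simp_all add: Wb)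
        from blinfun.tendsto[OF tendsto_const this, of \<phi>]
        have d0: "(\<lambda>n. \<phi> (W (p n) (z - A (e (p n)) f))) \<longlonglongrightarrow> 0" by simp
        \<comment> \<open>Here \<open>f - h A f\<close> is split into \<open>f - h z\<close> and the
          null sequence \<open>h (z - A f)\<close>. The limit \<open>\<phi> u - h \<phi> w\<close>
          vanishes by \<open>wv\<close> and \<open>uv\<close>.\<close>
        have "(\<lambda>n. \<phi> (W (p n) f) - h *\<^sub>R \<phi> (W (p n) z) + h *\<^sub>R \<phi> (W (p n) (z - A (e (p n)) f)))
            \<longlonglongrightarrow> \<phi> u - h *\<^sub>R \<phi> w + h *\<^sub>R 0"
          by (intro tendsto_intros weakly_converges_toD[OF Wf \<phi>] weakly_converges_toD[OF Wz \<phi>] d0)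
        then have "(\<lambda>n. \<phi> (W (p n) (f - h *\<^sub>R A (e (p n)) f))) \<longlonglongrightarrow> 0"
          by (simp add: uv wv blinfun.diff_right blinfun.scaleR_right scaleR_right_diff_distrib)
        then have lim: "(\<lambda>n. \<phi> (W (r (q1 (q2 (q3 n)))) (f - h *\<^sub>R A (e (r (q1 (q2 (q3 n))))) f))) \<longlonglongrightarrow> 0"
          by (simp only: p_def)
        have "strict_mono (\<lambda>n. q1 (q2 (q3 n)))"
          using strict_mono_o[OF q1(1) strict_mono_o[OF q2(1) q3(1)]] by (simp add: o_def)
        with lim show "\<exists>q::nat \<Rightarrow> nat. strict_mono q \<and>
            (\<lambda>n. \<phi> (W (r (q n)) (f - h *\<^sub>R A (e (r (q n))) f))) \<longlonglongrightarrow> 0"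
          by (intro exI[of _ "\<lambda>n. q1 (q2 (q3 n))"]) simp
      qed
      then show "(\<lambda>n. \<phi> (blinfun_pow (F (t / real n)) (nat \<lfloor>real n * s\<rfloor>) (f - h *\<^sub>R A (t / real n) f))) \<longlonglongrightarrow> 0"
        by (simp only: W_def e_def k_def)
    qed
  qed
  then have "\<A> \<subseteq> {y. \<phi> y = 0}" by auto
  moreover have "closed {y. \<phi> y = 0}"
    by (intro closed_Collect_eq linear_continuous_on blinfun.bounded_linear_right continuous_on_const)
  ultimately have "closure \<A> \<subseteq> {y. \<phi> y = 0}" by (rule closure_minimal)
  with \<A>(2) show "\<phi> x = 0" by auto
qed

end

section \<open>Resolvents of the closure as strong limits\<close>

locale chernoff_family_dense = chernoff_family +
  assumes range_dense: "0 < h \<Longrightarrow> h \<le> \<delta> \<Longrightarrow> closure (range_shift h) = UNIV"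
begin

lemma J_bounded:
  assumes "filterlim e (at_right 0) sequentially" "0 < h" "h \<le> \<delta>"
  shows "eventually (\<lambda>n. norm (J (e n) h) \<le> 2 * M) sequentially"
  using eventually_small[OF assms(1)] by eventually_elim (simp add: norm_J assms)

text \<open>This will be the inverse of \<open>1 - h Z\<close> with the closure in place of
  \<open>Z\<close>. The steps \<open>1 / n\<close> are an arbitrary choice: by
  \<open>J_tendsto\<close> every sequence tending to 0 from the right has the same limit, and the
  product formula uses this for \<open>s / n\<close>.\<close>

definition "G h = (SOME L. \<forall>x. (\<lambda>n. J (1 / real n) h x) \<longlonglongrightarrow> blinfun_apply L x)"

lemma G_inv_Z_and_limit:
  assumes h: "0 < h" "h \<le> \<delta>"
  shows "(x, z) \<in> Z \<Longrightarrow> G h (x - h *\<^sub>R z) = x" "(\<lambda>n. J (1 / real n) h y) \<longlonglongrightarrow> G h y"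
proof -
  have e: "filterlim (\<lambda>n. 1 / real n) (at_right 0) sequentially"
    by (rule filterlim_divide_at_right_0) simp
  have conv: "convergent (\<lambda>n. J (1 / real n) h v)" if v: "v \<in> range_shift h" for v
  proof -
    obtain a b where "(a, b) \<in> Z" "v = a - h *\<^sub>R b" using v unfolding range_shift_def by auto
    with J_consistent[OF _ e h] show ?thesis unfolding convergent_def by auto
  qed
  have "\<exists>L. \<forall>x. (\<lambda>n. J (1 / real n) h x) \<longlonglongrightarrow> blinfun_apply L x"
  proof (rule strong_limit_exists[OF J_bounded[OF e h] range_dense[OF h] conv])
    fix L assume "\<And>x. (\<lambda>n. J (1 / real n) h x) \<longlonglongrightarrow> blinfun_apply L x"
    then show ?thesis by blast
  qed
  then have lim: "\<forall>y. (\<lambda>n. J (1 / real n) h y) \<longlonglongrightarrow> G h y" unfolding G_def by (rule someI_ex)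
  then show "(\<lambda>n. J (1 / real n) h y) \<longlonglongrightarrow> G h y" ..
  show "G h (x - h *\<^sub>R z) = x" if "(x, z) \<in> Z"
    using spec[OF lim] J_consistent[OF that e h] by (rule LIMSEQ_unique)
qed

lemma J_tendsto:
  assumes e: "filterlim e (at_right 0) sequentially" and h: "0 < h" "h \<le> \<delta>"
  shows "(\<lambda>n. J (e n) h y) \<longlonglongrightarrow> G h y"
proof (rule strong_limit_dense[OF J_bounded[OF e h] range_dense[OF h]])
  fix v assume "v \<in> range_shift h"
  then obtain a b where ab: "(a, b) \<in> Z" "v = a - h *\<^sub>R b" unfolding range_shift_def by auto
  show "(\<lambda>n. J (e n) h v) \<longlonglongrightarrow> G h v"
    using J_consistent[OF ab(1) e h] unfolding ab(2) G_inv_Z_and_limit(1)[OF h ab(1)] .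
qed

lemma closure_Z_sequence:
  "(x, z) \<in> closure Z \<longleftrightarrow> (\<exists>a b. (\<forall>n. (a n, b n) \<in> Z) \<and> a \<longlonglongrightarrow> x \<and> b \<longlonglongrightarrow> z)"
proof
  assume "(x, z) \<in> closure Z"
  then obtain p where "\<And>n. p n \<in> Z" "p \<longlonglongrightarrow> (x, z)" unfolding closure_sequential by auto
  then show "\<exists>a b. (\<forall>n. (a n, b n) \<in> Z) \<and> a \<longlonglongrightarrow> x \<and> b \<longlonglongrightarrow> z"
    by (intro exI[of _ "\<lambda>n. fst (p n)"] exI[of _ "\<lambda>n. snd (p n)"])
      (auto dest: tendsto_fst tendsto_snd)
next
  assume "\<exists>a b. (\<forall>n. (a n, b n) \<in> Z) \<and> a \<longlonglongrightarrow> x \<and> b \<longlonglongrightarrow> z"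
  then obtain a b where "\<And>n. (a n, b n) \<in> Z" "a \<longlonglongrightarrow> x" "b \<longlonglongrightarrow> z" by blast
  then show "(x, z) \<in> closure Z"
    unfolding closure_sequential by (intro exI[of _ "\<lambda>n. (a n, b n)"]) (auto intro: tendsto_Pair)
qed

text \<open>On the range of \<open>1 - h Z\<close> the operator \<open>G h\<close> and
  \<open>Z\<close> are tied by an exact equation. That range is dense, so an arbitrary
  \<open>y\<close> is approximated from it and the pairs converge in the closure of the graph. The
  power bound, with the exponent \<open>4 * \<omega>\<close> of \<open>norm_J_pow\<close>, passes to
  the strong limit.\<close>

sublocale resolvent_family smul "closure Z" G \<delta> M "4 * \<omega>"
proof
  fix x z x' z' assume "(x, z) \<in> closure Z" "(x', z') \<in> closure Z"
  then obtain a b a' b' where ab: "\<And>n. (a n, b n) \<in> Z" "a \<longlonglongrightarrow> x" "b \<longlonglongrightarrow> z"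
    and ab': "\<And>n. (a' n, b' n) \<in> Z" "a' \<longlonglongrightarrow> x'" "b' \<longlonglongrightarrow> z'" unfolding closure_Z_sequence by blast
  show "(x + x', z + z') \<in> closure Z" unfolding closure_Z_sequence
    by (intro exI[of _ "\<lambda>n. a n + a' n"] exI[of _ "\<lambda>n. b n + b' n"] conjI allI Z_add ab ab' tendsto_add)
next
  fix x z c assume "(x, z) \<in> closure Z"
  then obtain a b where ab: "\<And>n. (a n, b n) \<in> Z" "a \<longlonglongrightarrow> x" "b \<longlonglongrightarrow> z" unfolding closure_Z_sequence by blast
  show "(smul c x, smul c z) \<in> closure Z" unfolding closure_Z_sequence
    by (intro exI[of _ "\<lambda>n. smul c (a n)"] exI[of _ "\<lambda>n. smul c (b n)"] conjI allI Z_smul ab tendsto_smul)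
next
  have "Domain Z \<subseteq> Domain (closure Z)" using closure_subset by (rule Domain_mono)
  then show "closure (Domain (closure Z)) = UNIV" using closure_mono dense_Z by blast
next
  show "\<delta> > 0" "M \<ge> 1" "4 * \<omega> \<ge> 0" using \<delta>_pos M \<omega> by auto
next
  fix h y assume h: "0 < h" "h \<le> \<delta>"
  have "y \<in> closure (range_shift h)" using range_dense[OF h] by simp
  then obtain v where v: "\<And>n. v n \<in> range_shift h" "v \<longlonglongrightarrow> y" unfolding closure_sequential by blast
  have "\<forall>n. \<exists>p. p \<in> Z \<and> v n = fst p - h *\<^sub>R snd p" using v(1) unfolding range_shift_def by fastforce
  from choice[OF this] obtain p where p: "\<forall>n. p n \<in> Z \<and> v n = fst (p n) - h *\<^sub>R snd (p n)" ..
  have Gv: "G h (v n) = fst (p n)" for n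
    using G_inv_Z_and_limit(1)[OF h, of "fst (p n)" "snd (p n)"] p by simp
  have "snd (p n) = (1 / h) *\<^sub>R (G h (v n) - v n)" for n
    unfolding Gv using spec[OF p, of n] h by simp
  then have pZ: "(G h (v n), (1 / h) *\<^sub>R (G h (v n) - v n)) \<in> Z" for n
    using p Gv[of n] by (metis prod.collapse)
  have "(\<lambda>n. G h (v n)) \<longlonglongrightarrow> G h y" by (intro blinfun.tendsto tendsto_const v)
  with v(2) show "(G h y, (1 / h) *\<^sub>R (G h y - y)) \<in> closure Z"
    unfolding closure_Z_sequence
    by (intro exI[of _ "\<lambda>n. G h (v n)"] exI[of _ "\<lambda>n. (1 / h) *\<^sub>R (G h (v n) - v n)"] conjI allI pZ tendsto_intros)
next
  fix h x z assume h: "0 < h" "h \<le> \<delta>" and "(x, z) \<in> closure Z"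
  then obtain a b where ab: "\<And>n. (a n, b n) \<in> Z" "a \<longlonglongrightarrow> x" "b \<longlonglongrightarrow> z" unfolding closure_Z_sequence by blast
  have "(\<lambda>n. G h (a n - h *\<^sub>R b n)) \<longlonglongrightarrow> G h (x - h *\<^sub>R z)" by (intro tendsto_intros ab)
  then have "a \<longlonglongrightarrow> G h (x - h *\<^sub>R z)" by (simp only: G_inv_Z_and_limit(1)[OF h ab(1)])
  from LIMSEQ_unique[OF this ab(2)] show "G h (x - h *\<^sub>R z) = x" .
next
  fix h m assume h: "0 < h" "h \<le> \<delta>"
  have e: "filterlim (\<lambda>n. 1 / real n) (at_right 0) sequentially"
    by (rule filterlim_divide_at_right_0) simp
  show "norm (blinfun_pow (G h) m) \<le> M * exp (4 * \<omega> * (real m * h))"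
  proof (rule norm_blinfun_bound)
    show "0 \<le> M * exp (4 * \<omega> * (real m * h))" using M by simp
    fix x
    show "norm (blinfun_pow (G h) m x) \<le> M * exp (4 * \<omega> * (real m * h)) * norm x"
    proof (rule tendsto_upperbound[OF tendsto_norm[OF strong_pow_tendsto[OF J_tendsto[OF e h] J_bounded[OF e h]]]])
      show "eventually (\<lambda>n. norm (blinfun_pow (J (1 / real n) h) m x) \<le> M * exp (4 * \<omega> * (real m * h)) * norm x) sequentially"
        using eventually_small[OF e] by eventually_elim (intro norm_blinfun_le norm_J_pow h, auto)
    qed simp
  qed
qed

end

section \<open>Semigroups and the product formula\<close>

locale c0_semigroup = banach_space_over smul
  for smul :: "'k::real_or_complex \<Rightarrow> 'a::banach \<Rightarrow> 'a" +
  fixes U :: "real \<Rightarrow> 'a \<Rightarrow>\<^sub>L 'a"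
  assumes C0: "C0_semigroup smul U"
begin

lemma U_zero: "U 0 = id_blinfun"
  and U_add: "s \<ge> 0 \<Longrightarrow> u \<ge> 0 \<Longrightarrow> U (s + u) x = U s (U u x)"
  and U_smul: "s \<ge> 0 \<Longrightarrow> U s (smul c x) = smul c (U s x)"
  and U_lim: "((\<lambda>s. U s x) \<longlongrightarrow> x) (at_right 0)"
  using C0 by (auto simp: C0_semigroup_def bounded_operators_def)

lemma U_commute: "s \<ge> 0 \<Longrightarrow> u \<ge> 0 \<Longrightarrow> U s (U u x) = U u (U s x)"
  using U_add[of s u x] U_add[of u s x] by (simp add: add.commute)

lemma U_pow: "h \<ge> 0 \<Longrightarrow> blinfun_pow (U h) m = U (real m * h)"
proof (induction m)
  case (Suc m)
  have "U (real (Suc m) * h) = U h o\<^sub>L U (real m * h)"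
    using U_add[of h "real m * h"] Suc.prems by (intro blinfun_eqI) (simp add: distrib_right add.commute)
  then show ?case using Suc by simp
qed (simp add: U_zero)

lemma U_near_zero:
  assumes "e > 0"
  shows "\<exists>b>0. \<forall>s. 0 \<le> s \<and> s < b \<longrightarrow> norm (U s x - x) < e"
proof -
  have "eventually (\<lambda>s. dist (U s x) x < e) (at_right 0)" by (rule tendstoD[OF U_lim assms])
  then obtain b where b: "b > 0" "\<And>s. 0 < s \<Longrightarrow> s < b \<Longrightarrow> dist (U s x) x < e"
    unfolding eventually_at_right[OF zero_less_one] by blast
  have "norm (U s x - x) < e" if "0 \<le> s" "s < b" for s
    using b(2)[of s] assms that by (cases "s = 0") (auto simp: U_zero dist_norm)
  with b(1) show ?thesis by blast
qed

lemma U_tendsto_zero: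
  assumes "\<And>n. v n \<ge> 0" "v \<longlonglongrightarrow> 0"
  shows "(\<lambda>n. U (v n) x) \<longlonglongrightarrow> x"
proof (rule LIMSEQ_I)
  fix e :: real assume "e > 0"
  obtain b where b: "b > 0" "\<And>s. 0 \<le> s \<Longrightarrow> s < b \<Longrightarrow> norm (U s x - x) < e"
    using U_near_zero[OF \<open>e > 0\<close>, of x] by auto
  obtain n0 where "\<And>n. n \<ge> n0 \<Longrightarrow> norm (v n - 0) < b" using LIMSEQ_D[OF assms(2) b(1)] by blast
  then have "\<forall>n\<ge>n0. norm (U (v n) x - x) < e" using b(2) assms(1) by auto
  then show "\<exists>n0. \<forall>n\<ge>n0. norm (U (v n) x - x) < e" ..
qed

text \<open>Otherwise there are times below \<open>inverse (Suc n)\<close> with norms above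
  \<open>4 ^ n\<close>. The gliding hump then provides one vector whose images at these times are
  unbounded, although they converge by strong continuity at 0.\<close>

lemma U_locally_bounded: "\<exists>d>0. \<exists>C\<ge>1. \<forall>s\<in>{0..d}. norm (U s) \<le> C"
proof (rule ccontr)
  assume neg: "\<not> ?thesis"
  have "\<forall>n. \<exists>s. s \<in> {0..inverse (real (Suc n))} \<and> 4 ^ n < norm (U s)"
  proof
    fix n
    have "\<not> (\<forall>s\<in>{0..inverse (real (Suc n))}. norm (U s) \<le> 4 ^ n)"
    proof
      assume "\<forall>s\<in>{0..inverse (real (Suc n))}. norm (U s) \<le> 4 ^ n"
      moreover have "inverse (real (Suc n)) > 0" "(1::real) \<le> 4 ^ n" by simp_all
      ultimately show False using neg by blast
    qed
    then show "\<exists>s. s \<in> {0..inverse (real (Suc n))} \<and> 4 ^ n < norm (U s)" by (auto simp: not_le)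
  qed
  from choice[OF this] obtain v where v: "\<forall>n. v n \<in> {0..inverse (real (Suc n))} \<and> 4 ^ n < norm (U (v n))" ..
  have "\<exists>x. \<forall>B. \<exists>n. norm (U (v n) x) > B" by (rule blinfun_gliding_hump) (use v in simp)
  then obtain x where x: "\<And>B. \<exists>n. norm (U (v n) x) > B" by blast
  have "v \<longlonglongrightarrow> 0"
  proof (rule Lim_null_comparison[OF always_eventually LIMSEQ_inverse_real_of_nat], rule allI)
    fix n show "norm (v n) \<le> inverse (real (Suc n))" using spec[OF v, of n] by simp
  qed
  then have "(\<lambda>n. U (v n) x) \<longlonglongrightarrow> x" using v by (intro U_tendsto_zero) auto
  then have "Bseq (\<lambda>n. U (v n) x)" by (intro convergent_imp_Bseq) (auto simp: convergent_def)
  then obtain B where "\<And>n. norm (U (v n) x) \<le> B" by (auto simp: Bseq_def)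
  with x[of B] show False by (meson not_le)
qed

lemma U_growth: "\<exists>M a. M \<ge> 1 \<and> a \<ge> 0 \<and> (\<forall>s\<ge>0. norm (U s) \<le> M * exp (a * s))"
proof -
  obtain d C where d: "d > 0" and C: "C \<ge> 1" and b: "\<And>s. s \<in> {0..d} \<Longrightarrow> norm (U s) \<le> C"
    using U_locally_bounded by blast
  \<comment> \<open>Apart from a remainder in \<open>{0..d}\<close>, the time \<open>s\<close>
    consists of at most \<open>s / d\<close> pieces, each costing a factor \<open>C\<close>.\<close>
  have "norm (U s) \<le> C * exp (ln C / d * s)" if s: "s \<ge> 0" for s
  proof -
    define k where "k = nat \<lfloor>s / d\<rfloor>"
    have "0 \<le> s / d" using s d by simp
    then have k: "real k \<le> s / d" "s / d < real k + 1"
      using floor_correct[of "s / d"] by (simp_all add: k_def)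
    have r: "s - real k * d \<in> {0..d}" using k d by (auto simp: field_simps)
    have P: "norm (blinfun_pow (U d) k x) \<le> C ^ k * norm x" for k x
    proof (induction k)
      case (Suc k)
      have "norm (U d (blinfun_pow (U d) k x)) \<le> C * norm (blinfun_pow (U d) k x)"
        by (rule norm_blinfun_le) (use b d in simp)
      also have "\<dots> \<le> C * (C ^ k * norm x)" using C Suc.IH by (intro mult_left_mono) auto
      finally show ?case by (simp add: mult.assoc)
    qed simp
    have "norm (U s) \<le> C ^ k * C"
    proof (rule norm_blinfun_bound)
      show "0 \<le> C ^ k * C" using C by simp
      fix x
      have "U s x = blinfun_pow (U d) k (U (s - real k * d) x)"
        using U_add[of "real k * d" "s - real k * d" x] r d U_pow[of d k] by simp
      also have "norm \<dots> \<le> C ^ k * norm (U (s - real k * d) x)" by (rule P)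
      also have "\<dots> \<le> C ^ k * (C * norm x)"
        using C by (intro mult_left_mono norm_blinfun_le b r) auto
      finally show "norm (U s x) \<le> C ^ k * C * norm x" by (simp add: mult.assoc)
    qed
    also have "C ^ k = exp (real k * ln C)" using C by (simp add: exp_of_nat_mult)
    also have "\<dots> \<le> exp (ln C / d * s)"
    proof -
      have "real k * ln C \<le> s / d * ln C" using k C by (intro mult_right_mono) auto
      then show ?thesis by (simp add: mult.commute)
    qed
    finally show ?thesis using C by (simp add: mult.commute mult_left_mono)
  qed
  then show ?thesis using C d by (intro exI[of _ C] exI[of _ "ln C / d"]) auto
qed

lemma U_bounded_on: "\<exists>C\<ge>1. \<forall>u\<in>{0..s}. norm (U u) \<le> C"
proof -
  obtain M a where M: "M \<ge> 1" "a \<ge> 0" and b: "\<And>u. u \<ge> 0 \<Longrightarrow> norm (U u) \<le> M * exp (a * u)"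
    using U_growth by blast
  have "norm (U u) \<le> M * exp (a * \<bar>s\<bar>)" if "u \<in> {0..s}" for u
  proof -
    have "M * exp (a * u) \<le> M * exp (a * \<bar>s\<bar>)" using that M by (auto intro!: mult_left_mono)
    then show ?thesis using b[of u] that by auto
  qed
  moreover have "1 * 1 \<le> M * exp (a * \<bar>s\<bar>)" using M by (intro mult_mono) auto
  ultimately show ?thesis by (intro exI[of _ "M * exp (a * \<bar>s\<bar>)"]) auto
qed

lemma U_tendsto:
  assumes v: "\<And>n. v n \<ge> 0" "v \<longlonglongrightarrow> s"
  shows "(\<lambda>n. U (v n) x) \<longlonglongrightarrow> U s x"
proof -
  have s: "s \<ge> 0" using v by (intro LIMSEQ_le_const[OF v(2)]) auto
  obtain C where C: "C \<ge> 1" "\<And>u. u \<in> {0..s} \<Longrightarrow> norm (U u) \<le> C" using U_bounded_on[of s] by blast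
  \<comment> \<open>Continuity is given only from the right at 0. Factoring out the semigroup at the
    smaller of the two times reduces both sides of \<open>s\<close> to a short time increment and a
    locally uniform bound.\<close>
  have le: "norm (U u x - U s x) \<le> C * norm (U \<bar>u - s\<bar> x - x)" if u: "u \<ge> 0" for u
  proof (cases "u \<le> s")
    case True
    then have "U s x = U u (U \<bar>u - s\<bar> x)" using U_add[of u "s - u" x] u by simp
    then have "norm (U u x - U s x) = norm (U u (U \<bar>u - s\<bar> x - x))"
      by (simp add: blinfun.diff_right norm_minus_commute)
    also have "\<dots> \<le> C * norm (U \<bar>u - s\<bar> x - x)" by (rule norm_blinfun_le) (use C u True in simp)
    finally show ?thesis .
  next
    case False
    then have "U u x = U s (U \<bar>u - s\<bar> x)" using U_add[of s "u - s" x] s by simp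
    then have "norm (U u x - U s x) = norm (U s (U \<bar>u - s\<bar> x - x))"
      by (simp add: blinfun.diff_right)
    also have "\<dots> \<le> C * norm (U \<bar>u - s\<bar> x - x)" by (rule norm_blinfun_le) (use C s in simp)
    finally show ?thesis .
  qed
  have "(\<lambda>n. \<bar>v n - s\<bar>) \<longlonglongrightarrow> 0" using v(2) by (intro tendsto_rabs_zero) (simp add: LIM_zero_iff)
  then have "(\<lambda>n. U \<bar>v n - s\<bar> x) \<longlonglongrightarrow> x" by (intro U_tendsto_zero) auto
  then have "(\<lambda>n. U \<bar>v n - s\<bar> x - x) \<longlonglongrightarrow> 0" by (simp add: LIM_zero_iff)
  then have "(\<lambda>n. C * norm (U \<bar>v n - s\<bar> x - x)) \<longlonglongrightarrow> 0" by (intro tendsto_mult_right_zero tendsto_norm_zero)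
  then have "(\<lambda>n. U (v n) x - U s x) \<longlonglongrightarrow> 0"
    by (rule Lim_null_comparison[rotated]) (simp add: le v(1))
  then show ?thesis by (simp add: LIM_zero_iff)
qed

lemma U_deriv_invariant:
  assumes "(x, z) \<in> op_deriv0 U" and s: "s \<ge> 0"
  shows "(U s x, U s z) \<in> op_deriv0 U"
proof -
  have "((\<lambda>h. U s (inverse h *\<^sub>R (U h x - U 0 x))) \<longlongrightarrow> U s z) (at_right 0)"
    using assms(1) by (intro blinfun.tendsto tendsto_const) (simp add: strong_deriv0_def)
  moreover have "eventually (\<lambda>h. U s (inverse h *\<^sub>R (U h x - U 0 x)) =
      inverse h *\<^sub>R (U h (U s x) - U 0 (U s x))) (at_right 0)"
    using eventually_at_right_real[of 0 "1::real", OF zero_less_one]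
    by eventually_elim (simp add: blinfun.scaleR_right blinfun.diff_right U_zero U_commute[OF s])
  ultimately show ?thesis unfolding strong_deriv0_def by (auto intro: Lim_transform_eventually)
qed

lemma floor_step_tendsto: "(\<lambda>n. real (nat \<lfloor>real n * s\<rfloor>) * (t / real n)) \<longlonglongrightarrow> t * s"
  if "s \<ge> 0" "t > 0" for s t :: real
proof -
  have "(\<lambda>n. real (nat \<lfloor>real n * s\<rfloor>) * (t / real n) - t * s) \<longlonglongrightarrow> 0"
  proof (rule Lim_null_comparison)
    show "(\<lambda>n. t / real n) \<longlonglongrightarrow> 0" by (rule lim_const_over_n)
    show "eventually (\<lambda>n. norm (real (nat \<lfloor>real n * s\<rfloor>) * (t / real n) - t * s) \<le> t / real n) sequentially"
      using eventually_gt_at_top[of 0]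
    proof eventually_elim
      case (elim n)
      let ?y = "real n * s"
      have "0 \<le> ?y" using that by simp
      then have "real (nat \<lfloor>?y\<rfloor>) = of_int \<lfloor>?y\<rfloor>" by simp
      then have k: "real (nat \<lfloor>?y\<rfloor>) \<le> ?y" "?y \<le> real (nat \<lfloor>?y\<rfloor>) + 1"
        using floor_correct[of ?y] by linarith+
      have "real (nat \<lfloor>?y\<rfloor>) * (t / real n) - t * s = (real (nat \<lfloor>?y\<rfloor>) - ?y) * (t / real n)"
        using elim by (simp add: field_simps)
      also have "norm \<dots> = \<bar>real (nat \<lfloor>?y\<rfloor>) - ?y\<bar> * (t / real n)" using that by (simp add: abs_mult)
      also have "\<dots> \<le> 1 * (t / real n)"
      proof (rule mult_right_mono)
        show "\<bar>real (nat \<lfloor>?y\<rfloor>) - ?y\<bar> \<le> 1" using k by linarith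
      qed (use that in simp)
      finally show ?case by simp
    qed
  qed
  then show ?thesis by (simp add: LIM_zero_iff)
qed

end

section \<open>The product formula\<close>

lemma op_deriv0_single_valued: "single_valued (op_deriv0 U)"
  by (auto simp: single_valued_def strong_deriv0_def intro: tendsto_unique[OF trivial_limit_at_right_real])

text \<open>\<open>U\<close> is any semigroup generated by the closure, not the particular one built
  from Euler steps, so the formula is obtained for each such semigroup without a separate uniqueness
  theorem.\<close>

locale chernoff_semigroup = chernoff_family_dense smul Z F M \<omega> + c0_semigroup smul U
  for smul :: "'k::real_or_complex \<Rightarrow> 'a::banach \<Rightarrow> 'a" and Z F M \<omega> U +
  assumes U_gen: "op_deriv0 U = closure Z"
begin

lemma U_R: assumes s: "s \<ge> 0" shows "U s (R y) = R (U s y)"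
proof -
  have "(U s (R y), U s (A\<^sub>R y)) \<in> closure Z"
    using U_deriv_invariant[OF _ s] R_in[of y] unfolding U_gen .
  from R_inv[OF this] have "R (U s (R y - \<delta> *\<^sub>R A\<^sub>R y)) = U s (R y)"
    by (simp add: blinfun.diff_right blinfun.scaleR_right)
  moreover have "R y - \<delta> *\<^sub>R A\<^sub>R y = y" using \<delta>_pos by (simp add: A\<^sub>R_apply)
  ultimately show ?thesis by simp
qed

lemma F_U_telescope:
  assumes "\<epsilon> \<ge> 0"
  shows "blinfun_pow (F \<epsilon>) n y - U (real n * \<epsilon>) y =
    (\<Sum>k<n. blinfun_pow (F \<epsilon>) (n - Suc k) (F \<epsilon> (U (real k * \<epsilon>) y) - U \<epsilon> (U (real k * \<epsilon>) y)))"
proof (induction n)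
  case (Suc n)
  let ?d = "\<lambda>k. F \<epsilon> (U (real k * \<epsilon>) y) - U \<epsilon> (U (real k * \<epsilon>) y)"
  have "U (real (Suc n) * \<epsilon>) y = U \<epsilon> (U (real n * \<epsilon>) y)"
    using U_add[of \<epsilon> "real n * \<epsilon>" y] assms by (simp add: distrib_right add.commute)
  then have "blinfun_pow (F \<epsilon>) (Suc n) y - U (real (Suc n) * \<epsilon>) y =
      F \<epsilon> (blinfun_pow (F \<epsilon>) n y - U (real n * \<epsilon>) y) + ?d n"
    by (simp add: blinfun.diff_right)
  also have "F \<epsilon> (blinfun_pow (F \<epsilon>) n y - U (real n * \<epsilon>) y) = (\<Sum>k<n. F \<epsilon> (blinfun_pow (F \<epsilon>) (n - Suc k) (?d k)))"
    unfolding Suc.IH blinfun.sum_right ..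
  also have "\<dots> = (\<Sum>k<n. blinfun_pow (F \<epsilon>) (Suc n - Suc k) (?d k))"
  proof (rule sum.cong[OF refl])
    fix k assume "k \<in> {..<n}"
    then have "Suc n - Suc k = Suc (n - Suc k)" by auto
    then show "F \<epsilon> (blinfun_pow (F \<epsilon>) (n - Suc k) (?d k)) = blinfun_pow (F \<epsilon>) (Suc n - Suc k) (?d k)" by simp
  qed
  finally show ?case by (simp only: sum.lessThan_Suc diff_self_eq_0 blinfun_pow.simps(1) blinfun_apply_id_blinfun id_apply)
qed (simp add: U_zero)

definition "remainder \<epsilon> x = U \<epsilon> (R x) - R x - \<epsilon> *\<^sub>R A\<^sub>R x"

lemma remainder_tendsto:
  assumes e: "filterlim e (at_right 0) sequentially"
  shows "(\<lambda>n. norm (remainder (e n) x) / e n) \<longlonglongrightarrow> 0"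
proof -
  have "((\<lambda>h. inverse h *\<^sub>R (U h (R x) - U 0 (R x))) \<longlongrightarrow> A\<^sub>R x) (at_right 0)"
    using R_in[of x] unfolding U_gen[symmetric] by (simp add: strong_deriv0_def)
  from filterlim_compose[OF this e]
  have "(\<lambda>n. inverse (e n) *\<^sub>R (U (e n) (R x) - U 0 (R x)) - A\<^sub>R x) \<longlonglongrightarrow> 0" by (simp add: LIM_zero_iff)
  then have lim: "(\<lambda>n. norm (inverse (e n) *\<^sub>R (U (e n) (R x) - U 0 (R x)) - A\<^sub>R x)) \<longlonglongrightarrow> 0"
    by (rule tendsto_norm_zero)
  show ?thesis
  proof (rule Lim_transform_eventually[OF lim])
    show "eventually (\<lambda>n. norm (inverse (e n) *\<^sub>R (U (e n) (R x) - U 0 (R x)) - A\<^sub>R x) = norm (remainder (e n) x) / e n) sequentially"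
      using eventually_small[OF e]
    proof eventually_elim
      case (elim n)
      then have "remainder (e n) x = e n *\<^sub>R (inverse (e n) *\<^sub>R (U (e n) (R x) - U 0 (R x)) - A\<^sub>R x)"
        by (simp add: remainder_def U_zero scaleR_right_diff_distrib)
      then have "norm (remainder (e n) x) = e n * norm (inverse (e n) *\<^sub>R (U (e n) (R x) - U 0 (R x)) - A\<^sub>R x)"
        using elim by simp
      then show ?case using elim by simp
    qed
  qed
qed

text \<open>The vector \<open>R v\<close>, with \<open>v = U s x\<close>, lies in the domain of the
  closure, where \<open>F\<close> is not known to be differentiable. After \<open>J\<close> the
  difference quotient becomes \<open>(J - 1) / \<delta>\<close> and is compared with
  \<open>(R v - v) / \<delta>\<close>, the image of \<open>R v\<close> under the closure. The two
  resolvents of \<open>v\<close> remain, up to the Taylor remainder of \<open>U\<close> at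
  \<open>R x\<close>.\<close>

lemma J_F_U_difference:
  assumes \<epsilon>: "0 < \<epsilon>" "\<epsilon> \<le> 1 / \<omega>" and s: "s \<ge> 0"
  shows "J \<epsilon> \<delta> (F \<epsilon> (U s (R x)) - U \<epsilon> (U s (R x))) =
    (\<epsilon> / \<delta>) *\<^sub>R (J \<epsilon> \<delta> (U s x) - G \<delta> (U s x)) - J \<epsilon> \<delta> (U s (remainder \<epsilon> x))"
proof -
  define v where "v = U s x"
  have \<delta>: "0 < \<delta>" "\<delta> \<le> \<delta>" using \<delta>_pos by auto
  have 1: "F \<epsilon> (R v) - R v = \<epsilon> *\<^sub>R A \<epsilon> (R v)" using \<epsilon> by (simp add: A_def)
  have "J \<epsilon> \<delta> (R v) - \<delta> *\<^sub>R J \<epsilon> \<delta> (A \<epsilon> (R v)) = R v"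
    using J_resolvent(2)[OF \<epsilon> \<delta>, of "R v"] by (simp add: blinfun.diff_right blinfun.scaleR_right)
  then have "\<delta> *\<^sub>R J \<epsilon> \<delta> (A \<epsilon> (R v)) = J \<epsilon> \<delta> (R v) - R v" by (simp add: algebra_simps)
  then have "(1 / \<delta>) *\<^sub>R (\<delta> *\<^sub>R J \<epsilon> \<delta> (A \<epsilon> (R v))) = (1 / \<delta>) *\<^sub>R (J \<epsilon> \<delta> (R v) - R v)" by simp
  then have 2: "J \<epsilon> \<delta> (A \<epsilon> (R v)) = (1 / \<delta>) *\<^sub>R (J \<epsilon> \<delta> (R v) - R v)" using \<delta> by simp
  have 3: "J \<epsilon> \<delta> (F \<epsilon> (R v) - R v) = (\<epsilon> / \<delta>) *\<^sub>R (J \<epsilon> \<delta> (R v) - R v)"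
    unfolding 1 blinfun.scaleR_right 2 by simp
  have "U \<epsilon> (R v) - R v = U s (U \<epsilon> (R x) - R x)"
    using U_R[OF s, of x] U_commute[OF s, of \<epsilon> "R x"] \<epsilon> by (simp add: v_def blinfun.diff_right)
  also have "U \<epsilon> (R x) - R x = \<epsilon> *\<^sub>R A\<^sub>R x + remainder \<epsilon> x" by (simp add: remainder_def)
  also have "U s (\<epsilon> *\<^sub>R A\<^sub>R x + remainder \<epsilon> x) = (\<epsilon> / \<delta>) *\<^sub>R (R v - v) + U s (remainder \<epsilon> x)"
    by (simp add: blinfun.add_right blinfun.scaleR_right blinfun.diff_right A\<^sub>R_apply U_R[OF s] v_def)
  finally have 4: "J \<epsilon> \<delta> (U \<epsilon> (R v) - R v) = (\<epsilon> / \<delta>) *\<^sub>R (J \<epsilon> \<delta> (R v) - J \<epsilon> \<delta> v) + J \<epsilon> \<delta> (U s (remainder \<epsilon> x))"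
    by (simp add: blinfun.add_right blinfun.scaleR_right blinfun.diff_right)
  have "J \<epsilon> \<delta> (F \<epsilon> (R v) - U \<epsilon> (R v)) = J \<epsilon> \<delta> (F \<epsilon> (R v) - R v) - J \<epsilon> \<delta> (U \<epsilon> (R v) - R v)"
    by (simp add: blinfun.diff_right)
  also have "\<dots> = (\<epsilon> / \<delta>) *\<^sub>R (J \<epsilon> \<delta> v - R v) - J \<epsilon> \<delta> (U s (remainder \<epsilon> x))"
    unfolding 3 4 by (simp add: scaleR_right_diff_distrib)
  finally show ?thesis unfolding R_def[symmetric] U_R[OF s] v_def[symmetric] .
qed

text \<open>The telescoping sum has \<open>n\<close> terms with the factor \<open>s / n\<close>, so
  its main part is an average, along the orbit of \<open>x\<close>, of the distance between the
  resolvents \<open>J\<close> and \<open>G\<close>. Their strong convergence at each single time is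
  enough, by \<open>average_tendsto_zero\<close>.\<close>

lemma J_F_U_limit:
  assumes s: "s > 0"
  shows "(\<lambda>n. J (s / real n) \<delta> (blinfun_pow (F (s / real n)) n (R x) - U s (R x))) \<longlonglongrightarrow> 0"
proof -
  define e where "e n = s / real n" for n
  have e: "filterlim e (at_right 0) sequentially"
    unfolding e_def[abs_def] by (rule filterlim_divide_at_right_0[OF s])
  have \<delta>: "0 < \<delta>" "\<delta> \<le> \<delta>" using \<delta>_pos by auto
  obtain C where C: "C \<ge> 1" "\<And>u. u \<in> {0..s} \<Longrightarrow> norm (U u) \<le> C" using U_bounded_on[of s] by blast
  \<comment> \<open>The value 0 for large steps makes the bound hold for every \<open>n\<close>, as
    \<open>average_tendsto_zero\<close> requires; this includes \<open>n = 0\<close>, where the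
    quotient \<open>e n\<close> is 0.\<close>
  define E where "E n k = (if 0 < e n \<and> e n \<le> 1 / \<omega>
    then norm (J (e n) \<delta> (U (real k * e n) x) - G \<delta> (U (real k * e n) x)) else 0)" for n k
  have small: "eventually (\<lambda>n. 0 < e n \<and> e n \<le> 1 / \<omega>) sequentially" by (rule eventually_small[OF e])
  have avg: "(\<lambda>n. (\<Sum>k<n * 1. E n k) / real n) \<longlonglongrightarrow> 0"
  proof (rule average_tendsto_zero)
    fix n k :: nat assume k: "k \<le> n * 1"
    show "\<bar>E n k\<bar> \<le> (2 * M + norm (G \<delta>)) * (C * norm x)"
    proof (cases "0 < e n \<and> e n \<le> 1 / \<omega>")
      case True
      then have n: "real n > 0" using s unfolding e_def zero_less_divide_iff by auto
      have "real k * e n \<le> real n * e n" using k True by (intro mult_right_mono) auto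
      also have "\<dots> = s" using n by (simp add: e_def)
      finally have u: "norm (U (real k * e n) x) \<le> C * norm x"
        using True by (intro norm_blinfun_le C(2)) auto
      have "norm (J (e n) \<delta> (U (real k * e n) x) - G \<delta> (U (real k * e n) x)) \<le>
          norm (J (e n) \<delta> (U (real k * e n) x)) + norm (G \<delta> (U (real k * e n) x))" by (rule norm_triangle_ineq4)
      also have "\<dots> \<le> 2 * M * norm (U (real k * e n) x) + norm (G \<delta>) * norm (U (real k * e n) x)"
        using True by (intro add_mono norm_blinfun_le norm_J \<delta>) auto
      also have "\<dots> = (2 * M + norm (G \<delta>)) * norm (U (real k * e n) x)" by (simp add: distrib_right)
      also have "\<dots> \<le> (2 * M + norm (G \<delta>)) * (C * norm x)" using u M by (intro mult_left_mono) auto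
      finally show ?thesis using True by (simp add: E_def)
    next
      case False
      then have "E n k = 0" unfolding E_def by (rule if_not_P)
      moreover have "0 \<le> (2 * M + norm (G \<delta>)) * (C * norm x)"
        using M C(1) by (intro mult_nonneg_nonneg add_nonneg_nonneg) auto
      ultimately show ?thesis by simp
    qed
  next
    fix r :: real assume r: "0 \<le> r"
    let ?v = "\<lambda>n. real (nat \<lfloor>real n * r\<rfloor>) * e n"
    have v: "(\<lambda>n. U (?v n) x) \<longlonglongrightarrow> U (s * r) x"
      using floor_step_tendsto[OF r s] s by (intro U_tendsto) (simp_all add: e_def)
    have Gl: "(\<lambda>n. G \<delta> (U (?v n) x)) \<longlonglongrightarrow> G \<delta> (U (s * r) x)" by (intro blinfun.tendsto tendsto_const v)
    have "(\<lambda>n. J (e n) \<delta> (U (?v n) x)) \<longlonglongrightarrow> G \<delta> (U (s * r) x)"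
      by (rule strong_tendsto_apply[OF J_bounded[OF e \<delta>] J_tendsto[OF e \<delta>] v])
    from tendsto_diff[OF this Gl]
    have "(\<lambda>n. norm (J (e n) \<delta> (U (?v n) x) - G \<delta> (U (?v n) x))) \<longlonglongrightarrow> 0"
      by (intro tendsto_norm_zero) simp
    then show "(\<lambda>n. E n (nat \<lfloor>real n * r\<rfloor>)) \<longlonglongrightarrow> 0"
      by (rule Lim_transform_eventually) (use small in \<open>eventually_elim, simp add: E_def\<close>)
  qed
  let ?b = "\<lambda>n. M * exp (\<omega> * s) * ((s / \<delta>) * ((\<Sum>k<n * 1. E n k) / real n) + s * (2 * M * C * (norm (remainder (e n) x) / e n)))"
  have "?b \<longlonglongrightarrow> M * exp (\<omega> * s) * ((s / \<delta>) * 0 + s * (2 * M * C * 0))"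
    by (intro tendsto_intros avg remainder_tendsto e)
  then have b0: "?b \<longlonglongrightarrow> 0" by simp
  have "(\<lambda>n. J (e n) \<delta> (blinfun_pow (F (e n)) n (R x) - U s (R x))) \<longlonglongrightarrow> 0"
  proof (rule Lim_null_comparison[OF _ b0])
    show "eventually (\<lambda>n. norm (J (e n) \<delta> (blinfun_pow (F (e n)) n (R x) - U s (R x))) \<le> ?b n) sequentially"
      using small
    proof eventually_elim
      case (elim n)
      then have \<epsilon>: "0 < e n" "e n \<le> 1 / \<omega>" by auto
      then have n: "real n > 0" using s unfolding e_def zero_less_divide_iff by auto
      have ne: "real n * e n = s" using n by (simp add: e_def)
      let ?\<epsilon> = "e n" and ?r = "norm (remainder (e n) x)"
      let ?d = "\<lambda>k. F ?\<epsilon> (U (real k * ?\<epsilon>) (R x)) - U ?\<epsilon> (U (real k * ?\<epsilon>) (R x))"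
      have com: "J ?\<epsilon> \<delta> (blinfun_pow (F ?\<epsilon>) m y) = blinfun_pow (F ?\<epsilon>) m (J ?\<epsilon> \<delta> y)" for m y
        by (rule blinfun_pow_commute) (rule J_F[OF \<epsilon> \<delta>, symmetric])
      have eq: "J ?\<epsilon> \<delta> (blinfun_pow (F ?\<epsilon>) n (R x) - U s (R x)) = (\<Sum>k<n. blinfun_pow (F ?\<epsilon>) (n - Suc k) (J ?\<epsilon> \<delta> (?d k)))"
        using F_U_telescope[of ?\<epsilon> n "R x"] \<epsilon> unfolding ne by (simp only: blinfun.sum_right com less_imp_le)
      have "norm (J ?\<epsilon> \<delta> (blinfun_pow (F ?\<epsilon>) n (R x) - U s (R x))) \<le>
          (\<Sum>k<n. M * exp (\<omega> * s) * ((?\<epsilon> / \<delta>) * E n k + 2 * M * (C * ?r)))"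
        unfolding eq
      proof (rule sum_norm_le)
        fix k assume "k \<in> {..<n}"
        then have "real k * ?\<epsilon> \<le> real n * ?\<epsilon>" "real (n - Suc k) * ?\<epsilon> \<le> real n * ?\<epsilon>"
          using \<epsilon> by (intro mult_right_mono; simp)+
        then have k: "real k * ?\<epsilon> \<in> {0..s}" "real (n - Suc k) * ?\<epsilon> \<le> s" using \<epsilon> unfolding ne by auto
        have "norm (J ?\<epsilon> \<delta> (?d k)) \<le> norm ((?\<epsilon> / \<delta>) *\<^sub>R (J ?\<epsilon> \<delta> (U (real k * ?\<epsilon>) x) - G \<delta> (U (real k * ?\<epsilon>) x)))
            + norm (J ?\<epsilon> \<delta> (U (real k * ?\<epsilon>) (remainder ?\<epsilon> x)))"
          unfolding J_F_U_difference[OF \<epsilon> atLeastAtMost_iff[THEN iffD1, OF k(1), THEN conjunct1]] by (rule norm_triangle_ineq4)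
        also have "norm ((?\<epsilon> / \<delta>) *\<^sub>R (J ?\<epsilon> \<delta> (U (real k * ?\<epsilon>) x) - G \<delta> (U (real k * ?\<epsilon>) x))) = (?\<epsilon> / \<delta>) * E n k"
          using \<epsilon> \<delta> by (simp add: E_def)
        also have "norm (J ?\<epsilon> \<delta> (U (real k * ?\<epsilon>) (remainder ?\<epsilon> x))) \<le> 2 * M * (C * ?r)"
          by (rule order_trans[OF norm_blinfun_le[OF norm_J[OF \<epsilon> \<delta>]] mult_left_mono[OF norm_blinfun_le[OF C(2)[OF k(1)]]]])
            (use M in simp)
        finally have 1: "norm (J ?\<epsilon> \<delta> (?d k)) \<le> (?\<epsilon> / \<delta>) * E n k + 2 * M * (C * ?r)" by simp
        have "norm (blinfun_pow (F ?\<epsilon>) (n - Suc k)) \<le> M * exp (\<omega> * s)"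
          using \<epsilon> k(2) by (intro norm_F_pow_le) auto
        then have "norm (blinfun_pow (F ?\<epsilon>) (n - Suc k) (J ?\<epsilon> \<delta> (?d k))) \<le> M * exp (\<omega> * s) * norm (J ?\<epsilon> \<delta> (?d k))"
          by (rule norm_blinfun_le)
        also have "\<dots> \<le> M * exp (\<omega> * s) * ((?\<epsilon> / \<delta>) * E n k + 2 * M * (C * ?r))"
          using M by (intro mult_left_mono 1) simp
        finally show "norm (blinfun_pow (F ?\<epsilon>) (n - Suc k) (J ?\<epsilon> \<delta> (?d k))) \<le> M * exp (\<omega> * s) * ((?\<epsilon> / \<delta>) * E n k + 2 * M * (C * ?r))" .
      qed
      also have "\<dots> = M * exp (\<omega> * s) * ((?\<epsilon> / \<delta>) * (\<Sum>k<n. E n k) + real n * (2 * M * (C * ?r)))"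
        by (simp only: sum_distrib_left[symmetric] sum.distrib sum_constant card_lessThan) (simp only: mult_ac)
      also have "\<dots> = ?b n"
      proof -
        have "(?\<epsilon> / \<delta>) * (\<Sum>k<n. E n k) = (s / \<delta>) * ((\<Sum>k<n * 1. E n k) / real n)" by (simp add: e_def)
        moreover have "real n * (2 * M * (C * ?r)) = s * (2 * M * C * (?r / ?\<epsilon>))"
          using n s by (simp add: e_def)
        ultimately show ?thesis by (simp only:)
      qed
      finally show ?case .
    qed
  qed
  then show ?thesis by (simp only: e_def)
qed

text \<open>At vectors \<open>R (R x)\<close> the outer resolvent is exchanged for \<open>J\<close>,
  which commutes with the powers of \<open>F\<close>. The inner one provides the smoothness for
  \<open>J_F_U_limit\<close>, and afterwards \<open>J\<close> is exchanged back for
  \<open>R\<close>.\<close>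

theorem chernoff_product_formula:
  assumes s: "s > 0"
  shows "(\<lambda>n. blinfun_pow (F (s / real n)) n f) \<longlonglongrightarrow> U s f"
proof (rule strong_limit_dense[OF _ dense_range_RR])
  have e: "filterlim (\<lambda>n. s / real n) (at_right 0) sequentially" by (rule filterlim_divide_at_right_0[OF s])
  have \<delta>: "0 < \<delta>" "\<delta> \<le> \<delta>" using \<delta>_pos by auto
  show bd: "eventually (\<lambda>n. norm (blinfun_pow (F (s / real n)) n) \<le> M * exp (\<omega> * s)) sequentially"
    using eventually_gt_at_top[of 0]
  proof eventually_elim
    case (elim n)
    then show ?case using s by (intro norm_F_pow_le) auto
  qed
  fix y assume "y \<in> range (\<lambda>x. R (R x))"
  then obtain x where y: "y = R (R x)" by auto
  let ?F = "\<lambda>n. blinfun_pow (F (s / real n)) n" and ?J = "\<lambda>n. J (s / real n) \<delta>"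
  have JR: "(\<lambda>n. ?J n v) \<longlonglongrightarrow> R v" for v using J_tendsto[OF e \<delta>] by (simp add: R_def)
  have "(\<lambda>n. R (R x) - ?J n (R x)) \<longlonglongrightarrow> R (R x) - R (R x)" by (intro tendsto_intros JR)
  then have "(\<lambda>n. R (R x) - ?J n (R x)) \<longlonglongrightarrow> 0" by simp
  from strong_tendsto_apply[OF bd _ this, of 0]
  have "(\<lambda>n. ?F n (R (R x) - ?J n (R x))) \<longlonglongrightarrow> 0" by simp
  from tendsto_add[OF tendsto_add[OF this J_F_U_limit[OF s, of x]] JR[of "U s (R x)"]]
  have "(\<lambda>n. ?F n (R (R x) - ?J n (R x)) + ?J n (?F n (R x) - U s (R x)) + ?J n (U s (R x))) \<longlonglongrightarrow> U s (R (R x))"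
    using s by (simp add: U_R)
  then show "(\<lambda>n. ?F n y) \<longlonglongrightarrow> U s y" unfolding y
  proof (rule Lim_transform_eventually)
    show "eventually (\<lambda>n. ?F n (R (R x) - ?J n (R x)) + ?J n (?F n (R x) - U s (R x)) + ?J n (U s (R x)) = ?F n (R (R x))) sequentially"
      using eventually_small[OF e]
    proof eventually_elim
      case (elim n)
      then have \<epsilon>: "0 < s / real n" "s / real n \<le> 1 / \<omega>" by auto
      have "?J n (?F n (R x)) = ?F n (?J n (R x))"
        by (rule blinfun_pow_commute) (rule J_F[OF \<epsilon> \<delta>, symmetric])
      then show ?case by (simp add: blinfun.diff_right)
    qed
  qed
qed

end

section \<open>The adjoint semigroup\<close>

context c0_semigroup begin

text \<open>Averaging maps into the domain of the generator. As a bounded operator it can be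
  composed with functionals, where it smooths their orbits under the adjoint semigroup.\<close>

definition "mean h = Blinfun (\<lambda>x. (1 / h) *\<^sub>R integral {0..h} (\<lambda>u. U u x))"

lemma U_continuous: "S \<subseteq> {0..} \<Longrightarrow> continuous_on S (\<lambda>u. U u x)"
  unfolding continuous_on_sequentially o_def by (auto intro!: U_tendsto)

lemma U_integrable: "a \<ge> 0 \<Longrightarrow> (\<lambda>u. U u x) integrable_on {a..b}"
  by (intro integrable_continuous_real U_continuous) auto

lemma norm_mean_integral_le:
  assumes h: "h > 0" and le: "\<And>u. u \<in> {0..h} \<Longrightarrow> norm (f u) \<le> c" and f: "f integrable_on {0..h}"
  shows "norm ((1 / h) *\<^sub>R integral {0..h} (f :: real \<Rightarrow> 'a)) \<le> c"
proof -
  have "0 \<le> c" using le[of 0] h by (auto intro: order_trans[OF norm_ge_zero])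
  then have "norm (integral {0..h} f) \<le> c * measure lborel {0..h}"
    using le by (intro has_integral_bound_real[OF _ finite.emptyI integrable_integral[OF f]]) auto
  then show ?thesis using h by (simp add: field_simps)
qed

lemma mean_apply:
  assumes h: "h > 0"
  shows "mean h x = (1 / h) *\<^sub>R integral {0..h} (\<lambda>u. U u x)"
proof -
  obtain C where C: "C \<ge> 1" "\<And>u. u \<in> {0..h} \<Longrightarrow> norm (U u) \<le> C" using U_bounded_on[of h] by blast
  have "bounded_linear (\<lambda>x. (1 / h) *\<^sub>R integral {0..h} (\<lambda>u. U u x))"
  proof (rule bounded_linear_intro[where K = C])
    show "(1 / h) *\<^sub>R integral {0..h} (\<lambda>u. U u (x + y)) =
        (1 / h) *\<^sub>R integral {0..h} (\<lambda>u. U u x) + (1 / h) *\<^sub>R integral {0..h} (\<lambda>u. U u y)" for x y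
      by (simp add: blinfun.add_right integral_add U_integrable scaleR_right_distrib)
    show "(1 / h) *\<^sub>R integral {0..h} (\<lambda>u. U u (r *\<^sub>R x)) = r *\<^sub>R ((1 / h) *\<^sub>R integral {0..h} (\<lambda>u. U u x))" for r x
      by (simp add: blinfun.scaleR_right)
    show "norm ((1 / h) *\<^sub>R integral {0..h} (\<lambda>u. U u x)) \<le> norm x * C" for x
    proof (rule norm_mean_integral_le[OF h _ U_integrable])
      show "norm (U u x) \<le> norm x * C" if "u \<in> {0..h}" for u
        using norm_blinfun_le[OF C(2)[OF that], of x] by (simp only: mult.commute)
    qed simp
  qed
  then show ?thesis by (simp add: mean_def bounded_linear_Blinfun_apply)
qed

lemma mean_commute:
  assumes h: "h > 0" and L: "bounded_linear L" and com: "\<And>u x. u \<ge> 0 \<Longrightarrow> L (U u x) = U u (L x)"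
  shows "mean h (L x) = L (mean h x)"
proof -
  have "integral {0..h} (\<lambda>u. U u (L x)) = integral {0..h} (L \<circ> (\<lambda>u. U u x))"
    by (rule integral_cong) (simp add: com)
  also have "\<dots> = L (integral {0..h} (\<lambda>u. U u x))" by (intro integral_linear U_integrable L) simp
  finally show ?thesis using L by (simp add: mean_apply[OF h] linear_simps(5))
qed

lemma mean_smul: "h > 0 \<Longrightarrow> mean h (smul c x) = smul c (mean h x)"
  by (rule mean_commute) (auto simp: bounded_linear_smul U_smul)

lemma mean_U: "h > 0 \<Longrightarrow> s \<ge> 0 \<Longrightarrow> mean h (U s x) = U s (mean h x)"
  by (rule mean_commute) (auto simp: blinfun.bounded_linear_right U_commute)

lemma mean_mean: "h > 0 \<Longrightarrow> r > 0 \<Longrightarrow> mean h (mean r x) = mean r (mean h x)"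
  by (rule mean_commute) (auto simp: blinfun.bounded_linear_right mean_U)

text \<open>Up to the factor \<open>1 / (r * h)\<close>, both sides are the integral over
  \<open>{0..r + h}\<close> minus those over \<open>{0..r}\<close> and \<open>{0..h}\<close>, which
  is symmetric in \<open>r\<close> and \<open>h\<close>. A difference quotient in the small time
  \<open>r\<close> thus becomes a bounded expression with the fixed time \<open>h\<close>.\<close>

lemma U_mean_diff:
  assumes h: "h > 0" and r: "r > 0"
  shows "(1 / r) *\<^sub>R (U r (mean h x) - mean h x) = (1 / h) *\<^sub>R (U h (mean r x) - mean r x)"
proof -
  let ?I = "\<lambda>a b. integral {a..b} (\<lambda>u. U u x)"
  have shift: "U p (?I 0 q) - ?I 0 q = ?I 0 (p + q) - ?I 0 p - ?I 0 q" if p: "p > 0" and q: "q > 0" for p q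
  proof -
    have "U p (?I 0 q) = integral {0..q} (U p \<circ> (\<lambda>u. U u x))"
      by (rule integral_linear[symmetric]) (simp_all add: U_integrable blinfun.bounded_linear_right)
    also have "\<dots> = integral {0..q} ((\<lambda>u. U u x) \<circ> (+) p)"
      by (rule integral_cong) (use p in \<open>simp add: U_add\<close>)
    also have "\<dots> = ?I p (p + q)"
      by (simp only: integral_shift_Icc_real add_0 add.commute)
    also have "\<dots> = ?I 0 (p + q) - ?I 0 p"
      using Henstock_Kurzweil_Integration.integral_combine[of 0 p "p + q" "\<lambda>u. U u x"] p q U_integrable[of 0 x "p + q"] by (simp add: algebra_simps)
    finally show ?thesis by simp
  qed
  have "U r (?I 0 h) - ?I 0 h = U h (?I 0 r) - ?I 0 r"
    using shift[OF r h] shift[OF h r] by (simp add: add.commute)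
  then have "(1 / (r * h)) *\<^sub>R (U r (?I 0 h) - ?I 0 h) = (1 / (r * h)) *\<^sub>R (U h (?I 0 r) - ?I 0 r)" by simp
  then show ?thesis
    by (simp add: mean_apply h r blinfun.scaleR_right scaleR_right_diff_distrib mult.commute)
qed

lemma norm_mean_diff_le:
  assumes h: "h > 0" and le: "\<And>u. u \<in> {0..h} \<Longrightarrow> norm (U u x - x) \<le> c"
  shows "norm (mean h x - x) \<le> c"
proof -
  have "integral {0..h} (\<lambda>u. U u x - x) = integral {0..h} (\<lambda>u. U u x) - integral {0..h} (\<lambda>u. x)"
    by (rule integral_diff) (auto simp: U_integrable)
  then have "(1 / h) *\<^sub>R integral {0..h} (\<lambda>u. U u x - x) = mean h x - x"
    using h by (simp add: mean_apply scaleR_right_diff_distrib)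
  moreover have "norm ((1 / h) *\<^sub>R integral {0..h} (\<lambda>u. U u x - x)) \<le> c"
    by (rule norm_mean_integral_le[OF h le]) (auto intro!: integrable_diff U_integrable)
  ultimately show ?thesis by simp
qed

lemma norm_mean_le:
  assumes h: "0 < h" "h \<le> s" and C: "\<And>u. u \<in> {0..s} \<Longrightarrow> norm (U u) \<le> C"
  shows "norm (mean h x) \<le> C * norm x"
  unfolding mean_apply[OF h(1)]
proof (rule norm_mean_integral_le[OF h(1) _ U_integrable])
  show "norm (U u x) \<le> C * norm x" if "u \<in> {0..h}" for u
    using h that by (intro norm_blinfun_le C) auto
qed simp

text \<open>Two averages are needed: after the first one the orbit of the functional is Lipschitz
  continuous, after the second one it is differentiable in norm.\<close>

lemma adjoint_deriv_mean:
  assumes \<phi>: "\<phi> \<in> dual_space smul" and h: "0 < h" "h \<le> 1"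
  shows "\<phi> o\<^sub>L mean h o\<^sub>L mean h \<in> Domain (adjoint_deriv0 smul U)"
proof -
  obtain C where C: "C \<ge> 1" "\<And>u. u \<in> {0..1} \<Longrightarrow> norm (U u) \<le> C" using U_bounded_on[of 1] by blast
  define \<psi> where "\<psi> = \<phi> o\<^sub>L mean h o\<^sub>L mean h"
  \<comment> \<open>On the range of \<open>mean h\<close> the generator acts as
    \<open>(U h - 1) / h\<close> on the unaveraged vector; one of the two averages is used up in
    this way.\<close>
  define \<eta> where "\<eta> = (1 / h) *\<^sub>R (\<phi> o\<^sub>L mean h o\<^sub>L (U h - id_blinfun))"
  have \<phi>s: "\<phi> (smul c x) = c * \<phi> x" for c x using in_dual_spaceD[OF \<phi>] .
  have \<psi>: "\<psi> \<in> dual_space smul" by (simp add: dual_space_def \<psi>_def mean_smul h \<phi>s)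
  have \<eta>: "\<eta> \<in> dual_space smul"
    using h by (simp add: dual_space_def \<eta>_def blinfun.scaleR_left blinfun.diff_left U_smul mean_smul
        scale_right_diff_distrib[symmetric] \<phi>s)
  have lip: "norm (U u (mean h x) - mean h x) \<le> (C + 1) * C / h * u * norm x" if u: "0 < u" "u \<le> 1" for u x
  proof -
    have "norm (U h (mean u x) - mean u x) \<le> norm (U h (mean u x)) + norm (mean u x)" by (rule norm_triangle_ineq4)
    also have "\<dots> \<le> C * norm (mean u x) + norm (mean u x)"
      using h by (intro add_mono norm_blinfun_le C) auto
    also have "\<dots> = (C + 1) * norm (mean u x)" by (simp add: distrib_right)
    also have "\<dots> \<le> (C + 1) * (C * norm x)" using C(1) by (intro mult_left_mono norm_mean_le[OF u C(2)]) auto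
    finally have *: "norm (U h (mean u x) - mean u x) \<le> (C + 1) * (C * norm x)" .
    have "U u (mean h x) - mean h x = u *\<^sub>R ((1 / u) *\<^sub>R (U u (mean h x) - mean h x))" using u by simp
    also have "\<dots> = (u / h) *\<^sub>R (U h (mean u x) - mean u x)" unfolding U_mean_diff[OF h(1) u(1)] by simp
    finally have "norm (U u (mean h x) - mean h x) = (u / h) * norm (U h (mean u x) - mean u x)" using u h by simp
    also have "\<dots> \<le> (u / h) * ((C + 1) * (C * norm x))" using u h by (intro mult_left_mono *) auto
    finally show ?thesis by (simp add: mult_ac)
  qed
  let ?q = "\<lambda>r. inverse r *\<^sub>R (adjoint_op (U r) \<psi> - adjoint_op (U 0) \<psi>)"
  define K where "K = 1 / h * (norm \<phi> * ((C + 1) * ((C + 1) * C / h)))"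
  have K: "norm (?q r - \<eta>) \<le> K * r" if r: "0 < r" "r \<le> 1" for r
  proof (rule norm_blinfun_bound)
    show "0 \<le> K * r" using C(1) h r by (simp add: K_def)
    fix x
    \<comment> \<open>The quotient and its limit differ only through this vector. By
      \<open>lip\<close>, the Lipschitz bound that the other average provides, its norm is of order
      \<open>r\<close> uniformly on bounded sets, whence convergence in operator norm.\<close>
    let ?w = "mean r (mean h x) - mean h x"
    have "?q r x = \<phi> (mean h (mean h (inverse r *\<^sub>R (U r x - x))))"
      by (simp add: adjoint_op_def \<psi>_def U_zero blinfun.scaleR_left blinfun.scaleR_right blinfun.diff_left blinfun.diff_right)
    also have "mean h (mean h (inverse r *\<^sub>R (U r x - x))) = mean h ((1 / r) *\<^sub>R (U r (mean h x) - mean h x))"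
      using h r by (simp add: blinfun.scaleR_right blinfun.diff_right mean_U inverse_eq_divide)
    also have "\<dots> = (1 / h) *\<^sub>R (U h (mean r (mean h x)) - mean r (mean h x))"
      unfolding U_mean_diff[OF h(1) r(1)] using h r
      by (simp add: blinfun.scaleR_right blinfun.diff_right mean_U mean_mean[of h r])
    finally have "?q r x = (1 / h) *\<^sub>R \<phi> (U h (mean r (mean h x)) - mean r (mean h x))"
      by (simp only: blinfun.scaleR_right)
    moreover have "\<eta> x = (1 / h) *\<^sub>R \<phi> (U h (mean h x) - mean h x)"
      using h by (simp add: \<eta>_def blinfun.scaleR_left blinfun.diff_left blinfun.diff_right mean_U)
    ultimately have "(?q r - \<eta>) x = (1 / h) *\<^sub>R \<phi> (U h ?w - ?w)"
      by (simp add: blinfun.diff_left blinfun.diff_right scaleR_right_diff_distrib)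
    then have "norm ((?q r - \<eta>) x) = 1 / h * norm (\<phi> (U h ?w - ?w))" using h by simp
    also have "\<dots> \<le> 1 / h * (norm \<phi> * ((C + 1) * ((C + 1) * C / h * r * norm x)))"
    proof (intro mult_left_mono order_trans[OF norm_blinfun])
      have "norm (U h ?w - ?w) \<le> norm (U h ?w) + norm ?w" by (rule norm_triangle_ineq4)
      also have "\<dots> \<le> C * norm ?w + norm ?w" using h by (intro add_mono norm_blinfun_le C) auto
      also have "\<dots> = (C + 1) * norm ?w" by (simp add: distrib_right)
      also have "norm ?w \<le> (C + 1) * C / h * r * norm x"
      proof (rule norm_mean_diff_le[OF r(1)])
        fix u assume u: "u \<in> {0..r}"
        show "norm (U u (mean h x) - mean h x) \<le> (C + 1) * C / h * r * norm x"
        proof (cases "u = 0")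
          case True
          then show ?thesis using C(1) h r by (simp add: U_zero)
        next
          case False
          then have "norm (U u (mean h x) - mean h x) \<le> (C + 1) * C / h * u * norm x"
            using u r by (intro lip) auto
          also have "\<dots> \<le> (C + 1) * C / h * r * norm x"
            using u C(1) h by (intro mult_right_mono mult_left_mono) auto
          finally show ?thesis .
        qed
      qed
      finally show "norm (U h ?w - ?w) \<le> (C + 1) * ((C + 1) * C / h * r * norm x)" using C(1) by simp
    qed (use h in auto)
    finally show "norm ((?q r - \<eta>) x) \<le> K * r * norm x" by (simp add: K_def mult_ac)
  qed
  have "(?q \<longlongrightarrow> \<eta>) (at_right 0)"
  proof (rule LIM_zero_cancel, rule Lim_null_comparison)
    show "eventually (\<lambda>r. norm (?q r - \<eta>) \<le> K * r) (at_right 0)"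
      using eventually_at_right_real[of 0 "1::real", OF zero_less_one] by eventually_elim (intro K, auto)
    have "((\<lambda>r. K * r) \<longlongrightarrow> K * 0) (at_right 0)" by (intro tendsto_intros)
    then show "((\<lambda>r. K * r) \<longlongrightarrow> 0) (at_right 0)" by simp
  qed
  with \<psi> \<eta> have "(\<psi>, \<eta>) \<in> adjoint_deriv0 smul U" by (simp add: strong_deriv0_def)
  then show ?thesis unfolding \<psi>_def by (rule DomainI)
qed

lemma mean_tendsto: "(\<lambda>n. mean (inverse (real (Suc n))) x) \<longlonglongrightarrow> x"
proof (rule LIMSEQ_I)
  fix e :: real assume e: "e > 0"
  then have e2: "e / 2 > 0" by simp
  obtain b where b: "b > 0" "\<And>s. 0 \<le> s \<Longrightarrow> s < b \<Longrightarrow> norm (U s x - x) < e / 2"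
    using U_near_zero[OF e2, of x] by auto
  obtain n0 where n0: "\<And>n. n \<ge> n0 \<Longrightarrow> norm (inverse (real (Suc n)) - 0) < b"
    using LIMSEQ_D[OF LIMSEQ_inverse_real_of_nat b(1)] by blast
  have "norm (mean (inverse (real (Suc n))) x - x) < e" if "n \<ge> n0" for n
  proof -
    have "norm (mean (inverse (real (Suc n))) x - x) \<le> e / 2"
    proof (rule norm_mean_diff_le)
      fix u assume "u \<in> {0..inverse (real (Suc n))}"
      then have "0 \<le> u" "u < b" using n0[OF that] by auto
      then show "norm (U u x - x) \<le> e / 2" using b(2) by (simp add: less_imp_le)
    qed simp
    then show ?thesis using e by simp
  qed
  then show "\<exists>n0. \<forall>n\<ge>n0. norm (mean (inverse (real (Suc n))) x - x) < e" by blast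
qed

text \<open>Since the averages tend strongly to the identity, every functional is the pointwise
  limit of its compositions with two averages. These lie in the domain, and pointwise limits are
  weak-* limits.\<close>

lemma cond_ii_semigroup: "cond_ii smul U"
  unfolding cond_ii_def
proof (rule weak_star_sequential_closure)
  show "Domain (adjoint_deriv0 smul U) \<subseteq> dual_space smul" by (auto simp: strong_deriv0_def)
  fix \<phi> :: "'a \<Rightarrow>\<^sub>L 'k" assume \<phi>: "\<phi> \<in> dual_space smul"
  let ?Q = "\<lambda>n. mean (inverse (real (Suc n)))"
  obtain C where C: "C \<ge> 1" "\<And>u. u \<in> {0..1} \<Longrightarrow> norm (U u) \<le> C" using U_bounded_on[of 1] by blast
  have h: "0 < inverse (real (Suc n))" "inverse (real (Suc n)) \<le> 1" for n
    using le_imp_inverse_le[of 1 "real (Suc n)"] by simp_all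
  have "norm (?Q n) \<le> C" for n
    using C(1) by (intro norm_blinfun_bound norm_mean_le[OF h C(2)]) auto
  then have Q: "(\<lambda>n. blinfun_pow (?Q n) 2 x) \<longlonglongrightarrow> blinfun_pow id_blinfun 2 x" for x
    using mean_tendsto by (intro strong_pow_tendsto[of _ _ C]) simp_all
  have lim: "(\<lambda>n. (\<phi> o\<^sub>L ?Q n o\<^sub>L ?Q n) x) \<longlonglongrightarrow> \<phi> x" for x
    using blinfun.tendsto[OF tendsto_const Q[of x], of \<phi>] by (simp add: numeral_2_eq_2)
  have D: "\<phi> o\<^sub>L ?Q n o\<^sub>L ?Q n \<in> Domain (adjoint_deriv0 smul U)" for n
    by (rule adjoint_deriv_mean[OF \<phi> h])
  show "\<exists>\<psi>. (\<forall>n. \<psi> n \<in> Domain (adjoint_deriv0 smul U)) \<and>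
      (\<forall>x. (\<lambda>n. blinfun_apply (\<psi> n) x) \<longlonglongrightarrow> \<phi> x)"
    by (rule exI[of _ "\<lambda>n. \<phi> o\<^sub>L ?Q n o\<^sub>L ?Q n"]) (use lim D in blast)
qed

end

section \<open>The semigroup as its own approximating function\<close>

lemma op_apply_eq: "single_valued Z \<Longrightarrow> (x, y) \<in> Z \<Longrightarrow> op_apply Z x = y"
  unfolding op_apply_def by (rule the_equality) (auto dest: single_valuedD)

lemma cond_i_iff:
  assumes "single_valued Z" shows "cond_i Z F \<longleftrightarrow> Z \<subseteq> op_deriv0 F"
proof
  assume i: "cond_i Z F"
  show "Z \<subseteq> op_deriv0 F"
  proof (rule subrelI)
    fix x z assume xz: "(x, z) \<in> Z"
    then have "x \<in> Domain (op_deriv0 F)" "op_apply (op_deriv0 F) x = op_apply Z x"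
      using i by (auto simp: cond_i_def)
    then obtain w where w: "(x, w) \<in> op_deriv0 F" by auto
    with \<open>op_apply (op_deriv0 F) x = op_apply Z x\<close> op_apply_eq[OF op_deriv0_single_valued w] op_apply_eq[OF assms xz]
    show "(x, z) \<in> op_deriv0 F" by simp
  qed
next
  assume "Z \<subseteq> op_deriv0 F"
  then show "cond_i Z F"
    unfolding cond_i_def using op_apply_eq[OF assms] op_apply_eq[OF op_deriv0_single_valued]
    by (metis DomainE Domain_mono subsetD)
qed

locale generator_core = c0_semigroup smul U
  for smul :: "'k::real_or_complex \<Rightarrow> 'a::banach \<Rightarrow> 'a" and U +
  fixes Z :: "('a \<times> 'a) set"
  assumes Z_single_valued: "single_valued Z" and Z_core: "op_deriv0 U = closure Z"
    and Z_dense: "closure (Domain Z) = UNIV" and Z_subspace: "module.subspace smul (Domain Z)"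
begin

lemma F_class_semigroup: "U \<in> F_class smul"
proof -
  obtain M a where M: "M \<ge> 1" and b: "\<And>s. s \<ge> 0 \<Longrightarrow> norm (U s) \<le> M * exp (a * s)" using U_growth by blast
  have "norm (blinfun_pow (U (s / real n)) m) \<le> M * exp (a * real m / real n * s)" if "s \<ge> 0" for n m s
    using b[of "real m * (s / real n)"] that by (simp add: U_pow mult_ac)
  moreover have "Domain Z \<subseteq> Domain (op_deriv0 U)" unfolding Z_core using closure_subset by (rule Domain_mono)
  then have "closure (Domain (op_deriv0 U)) = UNIV" using closure_mono Z_dense by blast
  ultimately show ?thesis
    using C0 M unfolding F_class_def C0_semigroup_def by blast
qed

text \<open>With \<open>\<A>\<close> the whole domain of \<open>Z\<close>, the orbit stays in the
  domain of the closure but may leave that of \<open>Z\<close>. A point of the graph of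
  \<open>Z\<close> within \<open>inverse (Suc n)\<close> of the orbit in the product metric repairs
  this, and then both sequences converge even in norm.\<close>

lemma cond_iii_semigroup:
  assumes t: "t > 0" shows "cond_iii smul Z t U"
  unfolding cond_iii_def
proof (intro exI[of _ "Domain Z"] conjI ballI allI impI Z_subspace subset_refl Z_dense)
  fix f and s :: real assume "f \<in> Domain Z" and s: "s \<ge> 0"
  then obtain z where fz: "(f, z) \<in> Z" by auto
  let ?v = "\<lambda>n. real (nat \<lfloor>real n * s\<rfloor>) * (t / real n)"
  have v0: "?v n \<ge> 0" for n using t by simp
  have v: "(\<lambda>n. U (?v n) x) \<longlonglongrightarrow> U (t * s) x" for x
    by (rule U_tendsto[OF v0 floor_step_tendsto[OF s t]])
  have "(f, z) \<in> op_deriv0 U" unfolding Z_core using fz closure_subset by blast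
  then have cl: "(U (?v n) f, U (?v n) z) \<in> closure Z" for n
    using U_deriv_invariant[OF _ v0] unfolding Z_core by blast
  have "\<forall>n. \<exists>p. p \<in> Z \<and> dist p (U (?v n) f, U (?v n) z) < inverse (real (Suc n))"
  proof
    fix n
    have "inverse (real (Suc n)) > 0" by simp
    with cl[of n] show "\<exists>p. p \<in> Z \<and> dist p (U (?v n) f, U (?v n) z) < inverse (real (Suc n))"
      unfolding closure_approachable by blast
  qed
  from choice[OF this] obtain p where p: "\<forall>n. p n \<in> Z \<and> dist (p n) (U (?v n) f, U (?v n) z) < inverse (real (Suc n))" ..
  have "(\<lambda>n. dist (p n) (U (?v n) f, U (?v n) z)) \<longlonglongrightarrow> 0"
  proof (rule Lim_null_comparison[OF always_eventually LIMSEQ_inverse_real_of_nat], rule allI)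
    fix n show "norm (dist (p n) (U (?v n) f, U (?v n) z)) \<le> inverse (real (Suc n))"
      using spec[OF p, of n] by simp
  qed
  then have d: "(\<lambda>n. p n - (U (?v n) f, U (?v n) z)) \<longlonglongrightarrow> 0"
    by (simp add: dist_norm tendsto_norm_zero_iff)
  have d1: "(\<lambda>n. fst (p n) - U (?v n) f) \<longlonglongrightarrow> 0" and d2: "(\<lambda>n. snd (p n) - U (?v n) z) \<longlonglongrightarrow> 0"
    using tendsto_fst[OF d] tendsto_snd[OF d] by simp_all
  from tendsto_add[OF d1 v[of f]] have g: "(\<lambda>n. fst (p n)) \<longlonglongrightarrow> U (t * s) f" by simp
  from tendsto_add[OF d2 v[of z]] have y: "(\<lambda>n. snd (p n)) \<longlonglongrightarrow> U (t * s) z" by simp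
  have pZ: "(fst (p n), snd (p n)) \<in> Z" for n using p by simp
  have y': "(\<lambda>n. op_apply Z (fst (p n))) \<longlonglongrightarrow> U (t * s) z"
    using y by (simp only: op_apply_eq[OF Z_single_valued pZ])
  have pow: "blinfun_pow (U (t / real n)) (nat \<lfloor>real n * s\<rfloor>) = U (?v n)" for n
    using t by (simp add: U_pow)
  show "\<exists>g. (\<forall>n\<ge>1. g n \<in> Domain Z) \<and>
      (\<lambda>n. norm (blinfun_pow (U (t / real n)) (nat \<lfloor>real n * s\<rfloor>) f - g n)) \<longlonglongrightarrow> 0 \<and>
      subseqs_have_weakly_convergent_subseq smul g \<and>
      subseqs_have_weakly_convergent_subseq smul (\<lambda>n. op_apply Z (g n))"
  proof (intro exI[of _ "\<lambda>n. fst (p n)"] conjI allI impI)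
    show "fst (p n) \<in> Domain Z" for n using pZ by (rule DomainI)
    show "(\<lambda>n. norm (blinfun_pow (U (t / real n)) (nat \<lfloor>real n * s\<rfloor>) f - fst (p n))) \<longlonglongrightarrow> 0"
      unfolding pow using tendsto_norm_zero[OF d1] by (simp only: norm_minus_commute)
    show "subseqs_have_weakly_convergent_subseq smul (\<lambda>n. fst (p n))"
      by (rule convergent_imp_weakly_precompact[OF g])
    show "subseqs_have_weakly_convergent_subseq smul (\<lambda>n. op_apply Z (fst (p n)))"
      by (rule convergent_imp_weakly_precompact[OF y'])
  qed
qed

end

section \<open>Assembly of the equivalence\<close>

context normed_space_over begin

lemma linear_operatorD:
  assumes "linear_operator smul Z"
  shows "single_valued Z" "(0, 0) \<in> Z" "\<And>x z x' z'. (x, z) \<in> Z \<Longrightarrow> (x', z') \<in> Z \<Longrightarrow> (x + x', z + z') \<in> Z"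
    "\<And>x z c. (x, z) \<in> Z \<Longrightarrow> (smul c x, smul c z) \<in> Z"
    "module.subspace smul (Domain Z)"
proof -
  interpret pair: module "\<lambda>c (x, y). (smul c x, smul c y)"
    by unfold_locales (auto simp: scale_right_distrib scale_left_distrib)
  have Z: "pair.subspace Z" using assms by (simp add: linear_operator_def)
  show "single_valued Z" using assms by (simp add: linear_operator_def)
  show 0: "(0, 0) \<in> Z" using pair.subspace_0[OF Z] by (simp add: zero_prod_def)
  show add: "(x + x', z + z') \<in> Z" if "(x, z) \<in> Z" "(x', z') \<in> Z" for x z x' z'
    using pair.subspace_add[OF Z that] by simp
  show sc: "(smul c x, smul c z) \<in> Z" if "(x, z) \<in> Z" for x z c
    using pair.subspace_scale[OF Z that, of c] by simp
  show "module.subspace smul (Domain Z)"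
    by (rule subspaceI) (use 0 add sc in blast)+
qed

end

theorem theorem5p2:
  fixes smul :: "'k::real_or_complex \<Rightarrow> 'a::banach \<Rightarrow> 'a"
    and Z :: "('a \<times> 'a) set"
    and t :: real
  assumes "normed_space_over smul"
    and "linear_operator smul Z"
    and "closure (Domain Z) = UNIV"
    and "t > 0"
  shows "((closable Z \<and> (\<exists>T. generates smul (closure Z) T)) \<longleftrightarrow>
            (\<exists>F \<in> F_class smul. cond_i Z F \<and> cond_ii smul F \<and> cond_iii smul Z t F)) \<and>
         (\<forall>F \<in> F_class smul. cond_i Z F \<and> cond_ii smul F \<and> cond_iii smul Z t F \<longrightarrow>
            (\<forall>T. generates smul (closure Z) T \<longrightarrow>
              (\<forall>s>0. \<forall>f. (\<lambda>n. blinfun_apply (blinfun_pow (F (s / real n)) n) f)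
                 \<longlonglongrightarrow> blinfun_apply (T s) f)))"
proof -
  interpret banach_space_over smul using assms(1) by (simp add: banach_space_over_def)
  note Z = linear_operatorD[OF assms(2)]
  \<comment> \<open>Conditions (i)-(iii) enter only here; generation and the product formula both
    follow from the density of the ranges.\<close>
  have dense: "\<exists>M \<omega>. chernoff_family_dense smul Z F M \<omega>"
    if F: "F \<in> F_class smul" and i: "cond_i Z F" and ii: "cond_ii smul F" and iii: "cond_iii smul Z t F" for F
  proof -
    have F0: "F 0 = id_blinfun" and ex: "\<exists>M a. M \<ge> 1 \<and> (\<forall>n\<ge>1. \<forall>m. \<forall>s\<ge>0.
        norm (blinfun_pow (F (s / real n)) m) \<le> M * exp (a * real m / real n * s))"
      using F unfolding F_class_def by simp_all
    from ex obtain M a where M: "M \<ge> 1" and b': "\<forall>n\<ge>1. \<forall>m. \<forall>s\<ge>0.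
        norm (blinfun_pow (F (s / real n)) m) \<le> M * exp (a * real m / real n * s)"
      by blast
    \<comment> \<open>The case \<open>n = 1\<close> already covers every step length
      \<open>h\<close>.\<close>
    have b: "norm (blinfun_pow (F h) m) \<le> M * exp (a * (real m * h))" if "h \<ge> 0" for h m
      using b'[rule_format, of 1 h m] that by (simp add: mult_ac)
    \<comment> \<open>Every exponent above \<open>a\<close> is admissible; this one is also at least
      1.\<close>
    define \<omega> where "\<omega> = max a 0 + 1"
    interpret chernoff_family smul Z F M \<omega>
    proof
      show "(x + x', z + z') \<in> Z" if "(x, z) \<in> Z" "(x', z') \<in> Z" for x z x' z' by (rule Z(3)[OF that])
      show "(smul c x, smul c z) \<in> Z" if "(x, z) \<in> Z" for x z c by (rule Z(4)[OF that])
      show "closure (Domain Z) = UNIV" "M \<ge> 1" "\<omega> \<ge> 1" using assms(3) M by (auto simp: \<omega>_def)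
      show "norm (blinfun_pow (F h) m) \<le> M * exp (\<omega> * (real m * h))" if "h \<ge> 0" for h m
      proof -
        have "norm (blinfun_pow (F h) m) \<le> M * exp (a * (real m * h))" using b[OF that] .
        also have "a * (real m * h) \<le> \<omega> * (real m * h)" using that by (intro mult_right_mono) (auto simp: \<omega>_def)
        then have "M * exp (a * (real m * h)) \<le> M * exp (\<omega> * (real m * h))" using M by (intro mult_left_mono) auto
        finally show ?thesis .
      qed
      show "((\<lambda>h. inverse h *\<^sub>R (F h x - x)) \<longlongrightarrow> z) (at_right 0)" if "(x, z) \<in> Z" for x z
        using that i unfolding cond_i_iff[OF Z(1)] by (auto simp: strong_deriv0_def F0)
    qed
    from iii obtain \<A> where \<A>: "\<A> \<subseteq> Domain Z" "closure \<A> = UNIV"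
      and seq: "\<And>f s. f \<in> \<A> \<Longrightarrow> s \<ge> 0 \<Longrightarrow> \<exists>g::nat \<Rightarrow> 'a. (\<forall>n\<ge>1. g n \<in> Domain Z) \<and>
        (\<lambda>n. norm (blinfun_pow (F (t / real n)) (nat \<lfloor>real n * s\<rfloor>) f - g n)) \<longlonglongrightarrow> 0 \<and>
        subseqs_have_weakly_convergent_subseq smul g \<and>
        subseqs_have_weakly_convergent_subseq smul (\<lambda>n. op_apply Z (g n))"
      unfolding cond_iii_def by blast
    have seq': "\<exists>g y. (\<forall>n\<ge>1. (g n, y n) \<in> Z) \<and>
        (\<lambda>n. norm (blinfun_pow (F (t / real n)) (nat \<lfloor>real n * s\<rfloor>) f - g n)) \<longlonglongrightarrow> 0 \<and>
        subseqs_have_weakly_convergent_subseq smul g \<and> subseqs_have_weakly_convergent_subseq smul y"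
      if "f \<in> \<A>" "s \<ge> 0" for f s
    proof -
      from seq[OF that] obtain g where g: "(\<forall>n\<ge>1. g n \<in> Domain Z) \<and>
        (\<lambda>n. norm (blinfun_pow (F (t / real n)) (nat \<lfloor>real n * s\<rfloor>) f - g n)) \<longlonglongrightarrow> 0 \<and>
        subseqs_have_weakly_convergent_subseq smul g \<and>
        subseqs_have_weakly_convergent_subseq smul (\<lambda>n. op_apply Z (g n))" ..
      have "\<forall>n\<ge>1. (g n, op_apply Z (g n)) \<in> Z"
        using conjunct1[OF g] op_apply_eq[OF Z(1)] by fastforce
      with g show ?thesis by (intro exI[of _ g] exI[of _ "\<lambda>n. op_apply Z (g n)"]) simp
    qed
    have "closure (range_shift h) = UNIV" if "0 < h" "h \<le> \<delta>" for h
      by (rule range_shift_dense[OF ii[unfolded cond_ii_def] F0 assms(4) that Z(2) \<A> seq'])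
    then have "chernoff_family_dense smul Z F M \<omega>" by unfold_locales
    then show ?thesis by blast
  qed
  have forward: "\<exists>F \<in> F_class smul. cond_i Z F \<and> cond_ii smul F \<and> cond_iii smul Z t F"
    if T: "generates smul (closure Z) T" for T
  proof -
    interpret generator_core smul T Z
      using T Z assms(3) by unfold_locales (auto simp: generates_def)
    have "cond_i Z T" unfolding cond_i_iff[OF Z(1)] Z_core by (rule closure_subset)
    with F_class_semigroup cond_ii_semigroup cond_iii_semigroup[OF assms(4)] show ?thesis by blast
  qed
  have backward: "closable Z \<and> (\<exists>T. generates smul (closure Z) T)"
    if "F \<in> F_class smul" "cond_i Z F" "cond_ii smul F" "cond_iii smul Z t F" for F
  proof -
    from dense[OF that] obtain M \<omega> where "chernoff_family_dense smul Z F M \<omega>" by blast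
    then interpret chernoff_family_dense smul Z F M \<omega> .
    \<comment> \<open>The closure has been identified with a strong derivative, and limits are
      unique; this is where closability is obtained.\<close>
    have "single_valued (closure Z)" unfolding generated[symmetric] by (rule op_deriv0_single_valued)
    with generates_T show ?thesis unfolding closable_def by blast
  qed
  have "(\<lambda>n. blinfun_pow (F (s / real n)) n f) \<longlonglongrightarrow> T s f"
    if "F \<in> F_class smul" "cond_i Z F" "cond_ii smul F" "cond_iii smul Z t F"
      and T: "generates smul (closure Z) T" and s: "s > 0" for F T s f
  proof -
    from dense[OF that(1-4)] obtain M \<omega> where "chernoff_family_dense smul Z F M \<omega>" by blast
    then interpret chernoff_family_dense smul Z F M \<omega> .
    interpret chernoff_semigroup smul Z F M \<omega> T
      using T by unfold_locales (auto simp: generates_def)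
    show ?thesis by (rule chernoff_product_formula[OF s])
  qed
  with forward backward show ?thesis by blast
qed

end
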